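(* Let $V\subset\mathbb{R}^d$ be a linear subspace of dimension $k$, let $s_V(\theta)$ denote the squared Euclidean distance from $\theta\in\mathbb{R}^d$ to $V$, let $0<\alpha\le (d-k-2)/2$, and $$f(\theta)=\sum_{a\in\{1,-1\}^d}\bigl(s_V(a_1\theta_1,a_2\theta_2,\dots,a_d\theta_d)\bigr)^{-\alpha}.$$ Then, for the prediction of independent Poisson processes with the same duration (where $\theta_i=\sqrt{\lambda_i}$) or with different durations (where $\theta_i=\sqrt{\lambda_i/\gamma_i}$), the Bayesian predictive distribution based on $\pi_{f,\mathrm J}(\lambda)$ dominates that based on the Jeffreys prior, and is thus nearly minimax.
   Context: $\mathbb{N}=\{0,1,2,\dots\}$. Model: for unknown $\lambda\in(0,\infty)^d$ and known $r_i,s_i>0$, $x$ and $y$ are independent with $p(x\mid\lambda)=\prod_{i=1}^d (r_i\lambda_i)^{x_i}e^{-r_i\lambda_i}/x_i!$ and $p(y\mid\lambda)=\prod_{i=1}^d (s_i\lambda_i)^{y_i}e^{-s_i\lambda_i}/y_i!$, $x,y\in\mathbb{N}^d$. "Same duration" means $r_1=\dots=r_d=r$ and $s_1=\dots=s_d=s$, and then $\theta_i:=\sqrt{\lambda_i}$; "different durations" means general $r_i,s_i>0$, and then $\theta_i:=\sqrt{\lambda_i/\gamma_i}$ with $\gamma_i:=1/r_i-1/(r_i+s_i)$. For a (possibly improper) prior density $\pi(\lambda)$, the Bayesian predictive distribution is $p_\pi(y\mid x)=\int p(x\mid\lambda)p(y\mid\lambda)\pi(\lambda)\,\mathrm{d}\lambda\big/\int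 p(x\mid\lambda)\pi(\lambda)\,\mathrm{d}\lambda$. The Jeffreys prior is $\pi_{\mathrm J}(\lambda)\propto\prod_{i=1}^d\lambda_i^{-1/2}$, and $\pi_{f,\mathrm J}(\lambda)\propto f(\theta_1,\dots,\theta_d)\prod_{i=1}^d\lambda_i^{-1/2}$. The Kullback–Leibler (K-L) risk of a predictive distribution $q(y\mid x)$ at $\lambda$ is $\sum_x p(x\mid\lambda)\sum_y p(y\mid\lambda)\log\frac{p(y\mid\lambda)}{q(y\mid x)}$. $q_1$ dominates $q_2$ if the K-L risk of $q_1$ is at most that of $q_2$ at every $\lambda$, with strict inequality for some $\lambda$. $q$ is nearly minimax if, for every $\lambda$, its K-L risk is less than $1.04$ times the minimax lower bound $0.5\sum_{i=1}^d\log\bigl((r_i+s_i)/r_i\bigr)$. *)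

theory Defs
  imports "HOL-Analysis.Analysis"
begin

definition positive_orthant :: "(real ^ 'd) set" where
  "positive_orthant = {l. \<forall>i. 0 < l $ i}"

definition poisson_prob :: "real ^ 'd \<Rightarrow> real ^ 'd \<Rightarrow> nat ^ 'd \<Rightarrow> real" where
  "poisson_prob t l x =
     (\<Prod>i\<in>UNIV. (t $ i * l $ i) ^ (x $ i) * exp (- (t $ i * l $ i)) / fact (x $ i))"

text \<open>The first argument of \<open>predictive\<close> is the vector of observed durations, the second the vector
  of durations to be predicted, the third an unnormalised, possibly improper, prior density on the
  positive orthant.  If an integral diverges, the value is 0, which \<open>log_ratio\<close> below turns into
  infinite risk.\<close>

definition predictive ::
  "real ^ 'd \<Rightarrow> real ^ 'd \<Rightarrow> (real ^ 'd \<Rightarrow> real) \<Rightarrow> nat ^ 'd \<Rightarrow> nat ^ 'd \<Rightarrow> real" where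
  "predictive r s \<pi> x y =
     (LINT l:positive_orthant|lborel. poisson_prob r l x * poisson_prob s l y * \<pi> l) /
     (LINT l:positive_orthant|lborel. poisson_prob r l x * \<pi> l)"

definition jeffreys_prior :: "real ^ 'd \<Rightarrow> real" where
  "jeffreys_prior l = (\<Prod>i\<in>UNIV. (l $ i) powr (- 1 / 2))"

definition modified_jeffreys_prior ::
  "(real ^ 'd \<Rightarrow> real) \<Rightarrow> (real ^ 'd \<Rightarrow> real ^ 'd) \<Rightarrow> real ^ 'd \<Rightarrow> real" where
  "modified_jeffreys_prior f \<theta> l = f (\<theta> l) * jeffreys_prior l"

text \<open>Sum of an extended-real family as the sum of the positive parts minus the sum of the negative
  parts (\<open>e2ennreal\<close> sends negative numbers to 0), so that divergent sums are not silently 0.\<close>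

definition ext_sum :: "('a \<Rightarrow> ereal) \<Rightarrow> ereal" where
  "ext_sum g = enn2ereal (\<integral>\<^sup>+ z. e2ennreal (g z) \<partial>count_space UNIV)
             - enn2ereal (\<integral>\<^sup>+ z. e2ennreal (- g z) \<partial>count_space UNIV)"

text \<open>Used only with \<open>p > 0\<close> and \<open>q \<ge> 0\<close>.\<close>

definition log_ratio :: "real \<Rightarrow> real \<Rightarrow> ereal" where
  "log_ratio p q = (if q = 0 then \<infinity> else ereal (ln (p / q)))"

definition KL_risk ::
  "real ^ 'd \<Rightarrow> real ^ 'd \<Rightarrow> (nat ^ 'd \<Rightarrow> nat ^ 'd \<Rightarrow> real) \<Rightarrow> real ^ 'd \<Rightarrow> ereal" where
  "KL_risk r s q l =
     ext_sum (\<lambda>x. ereal (poisson_prob r l x) *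
       ext_sum (\<lambda>y. ereal (poisson_prob s l y) * log_ratio (poisson_prob s l y) (q x y)))"

definition dominates ::
  "real ^ 'd \<Rightarrow> real ^ 'd \<Rightarrow> (nat ^ 'd \<Rightarrow> nat ^ 'd \<Rightarrow> real) \<Rightarrow> (nat ^ 'd \<Rightarrow> nat ^ 'd \<Rightarrow> real) \<Rightarrow> bool" where
  "dominates r s q1 q2 \<longleftrightarrow>
     (\<forall>l\<in>positive_orthant. KL_risk r s q1 l \<le> KL_risk r s q2 l) \<and>
     (\<exists>l\<in>positive_orthant. KL_risk r s q1 l < KL_risk r s q2 l)"

definition minimax_lower_bound :: "real ^ 'd \<Rightarrow> real ^ 'd \<Rightarrow> real" where
  "minimax_lower_bound r s = 0.5 * (\<Sum>i\<in>UNIV. ln ((r $ i + s $ i) / r $ i))"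

definition nearly_minimax ::
  "real ^ 'd \<Rightarrow> real ^ 'd \<Rightarrow> (nat ^ 'd \<Rightarrow> nat ^ 'd \<Rightarrow> real) \<Rightarrow> bool" where
  "nearly_minimax r s q \<longleftrightarrow>
     (\<forall>l\<in>positive_orthant. KL_risk r s q l < ereal (1.04 * minimax_lower_bound r s))"

definition theta_same :: "real ^ 'd \<Rightarrow> real ^ 'd" where
  "theta_same l = (\<chi> i. sqrt (l $ i))"

definition gamma_coeff :: "real ^ 'd \<Rightarrow> real ^ 'd \<Rightarrow> 'd \<Rightarrow> real" where
  "gamma_coeff r s i = 1 / r $ i - 1 / (r $ i + s $ i)"

definition theta_diff :: "real ^ 'd \<Rightarrow> real ^ 'd \<Rightarrow> real ^ 'd \<Rightarrow> real ^ 'd" where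
  "theta_diff r s l = (\<chi> i. sqrt (l $ i / gamma_coeff r s i))"

definition sq_dist :: "(real ^ 'd) set \<Rightarrow> real ^ 'd \<Rightarrow> real" where
  "sq_dist V \<theta> = (infdist \<theta> V)\<^sup>2"

text \<open>Where \<open>sq_dist\<close> vanishes, \<open>powr\<close> gives 0 instead of infinity.  For a proper subspace this
  happens only on a null set, so no integral in \<open>predictive\<close> is affected.\<close>

definition shrinkage_fun :: "(real ^ 'd) set \<Rightarrow> real \<Rightarrow> real ^ 'd \<Rightarrow> real" where
  "shrinkage_fun V \<alpha> \<theta> =
     (\<Sum>a | \<forall>i. a $ i \<in> {1, - 1}. sq_dist V (\<chi> i. a $ i * \<theta> $ i) powr (- \<alpha>))"

end

theory Submission
  imports Defs "HOL-Probability.Probability"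
begin

text \<open>
  In the coordinates \<open>\<theta>\<close> the posterior under the Jeffreys prior has a product density proportional to
  \<open>\<theta>\<^sup>2\<^sup>x exp (- \<tau> \<theta>^2)\<close>, and the predictive distribution based on the modified prior is the one based
  on the Jeffreys prior times \<open>h' (x + y) / h x\<close>, where \<open>h\<close> and \<open>h'\<close> are the posterior means of the
  prior factor given \<open>x\<close> and given \<open>x + y\<close>.  The risk difference is the expectation of
  \<open>ln (h' (x + y) / h x) \<ge> 1 - h x / h' (x + y)\<close>.  Given \<open>z = x + y\<close>, \<open>x\<close> is binomial, and averaging the
  posterior density given \<open>x\<close> over it amounts to convolving the posterior density given \<open>z\<close> with an
  isotropic Gaussian (the scaling by \<open>\<gamma>\<close> is what makes it isotropic).  Since the Gaussian average of
  \<open>s\<^sub>V powr (- \<alpha>)\<close> is smaller than this power itself, as its Laplace representation shows, the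
  average of \<open>h x\<close> given \<open>z\<close> is less than \<open>h' z\<close>, and the risk difference is positive.

  The risk under the Jeffreys prior is a sum of one-dimensional terms \<open>\<psi> b - \<psi> a\<close> with
  \<open>m * \<psi>' m = 1 / 2 + m * (ln m - E (ln (x + 1 / 2)))\<close> for a Poisson variable \<open>x\<close> of mean \<open>m\<close>; the second
  summand is shown to be below \<open>1 / 50\<close> by comparing power series coefficients.
\<close>

section \<open>Poisson expectations as power series\<close>

text \<open>In each coordinate the posterior parameters are \<tau> = r \<gamma> = s / (r + s) and
  \<tau>' = (r + s) \<gamma> = s / r, so that 1 / \<tau> - 1 / \<tau>' = 1 whatever the durations
  are. One kernel exp (- |y|^2) therefore serves all coordinates, and it survives the rotation that
  straightens V. Integrating this kernel against exp (- p s_V) produces a power of 1 / (1 + p) with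
  exponent (d - k) / 2, while the substitution q = p / (1 + p) in the Laplace integral consumes the
  exponent \<alpha> + 1. The upper bound on \<alpha> says that enough powers are available; the
  bounded range of q makes the comparison strict. The logarithm is replaced by 1 - h x / h' (x + y)
  because h x then enters linearly and can be averaged given z, where h' z is a constant. The sum
  over sign vectors compensates for \<theta> being confined to the positive orthant, to which V
  bears no relation: an even prior factor extends all integrals to the whole space, where each sign
  choice contributes the same amount.\<close>

definition exp_bounded :: "(nat \<Rightarrow> real) \<Rightarrow> bool" where
  "exp_bounded g \<longleftrightarrow> (\<exists>C\<ge>0. \<exists>K\<ge>1. \<forall>x. \<bar>g x\<bar> \<le> C * K ^ x)"

lemma exp_boundedI: "0 \<le> C \<Longrightarrow> 1 \<le> K \<Longrightarrow> (\<And>x. \<bar>g x\<bar> \<le> C * K ^ x) \<Longrightarrow> exp_bounded g"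
  unfolding exp_bounded_def by blast

lemma exp_bounded_mono:
  assumes "exp_bounded h" "\<And>x. \<bar>g x\<bar> \<le> \<bar>h x\<bar>"
  shows "exp_bounded g"
  using assms unfolding exp_bounded_def by (meson order_trans)

lemma exp_bounded_const [intro, simp]: "exp_bounded (\<lambda>_. c)"
  by (rule exp_boundedI[of "\<bar>c\<bar>" 1]) auto

lemma exp_bounded_real [intro, simp]: "exp_bounded real"
proof (rule exp_boundedI[of 1 2])
  show "\<bar>real x\<bar> \<le> 1 * 2 ^ x" for x
    using of_nat_less_two_power[of x, where 'a=real] by simp
qed auto

lemma exp_bounded_add [intro, simp]:
  assumes "exp_bounded g" "exp_bounded h"
  shows "exp_bounded (\<lambda>x. g x + h x)"
proof -
  obtain C K where 1: "0 \<le> C" "1 \<le> K" "\<And>x. \<bar>g x\<bar> \<le> C * K ^ x"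
    using assms(1) unfolding exp_bounded_def by blast
  obtain D L where 2: "0 \<le> D" "1 \<le> L" "\<And>x. \<bar>h x\<bar> \<le> D * L ^ x"
    using assms(2) unfolding exp_bounded_def by blast
  show ?thesis
  proof (rule exp_boundedI[of "C + D" "max K L"])
    fix x
    have "\<bar>g x + h x\<bar> \<le> C * K ^ x + D * L ^ x"
      using 1(3)[of x] 2(3)[of x] by linarith
    also have "\<dots> \<le> C * max K L ^ x + D * max K L ^ x"
      using 1 2 by (intro add_mono mult_left_mono power_mono) auto
    finally show "\<bar>g x + h x\<bar> \<le> (C + D) * max K L ^ x" by (simp add: algebra_simps)
  qed (use 1 2 in auto)
qed

lemma exp_bounded_mult [intro, simp]:
  assumes "exp_bounded g" "exp_bounded h"
  shows "exp_bounded (\<lambda>x. g x * h x)"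
proof -
  obtain C K where 1: "0 \<le> C" "1 \<le> K" "\<And>x. \<bar>g x\<bar> \<le> C * K ^ x"
    using assms(1) unfolding exp_bounded_def by blast
  obtain D L where 2: "0 \<le> D" "1 \<le> L" "\<And>x. \<bar>h x\<bar> \<le> D * L ^ x"
    using assms(2) unfolding exp_bounded_def by blast
  show ?thesis
  proof (rule exp_boundedI[of "C * D" "K * L"])
    fix x
    have "\<bar>g x * h x\<bar> \<le> (C * K ^ x) * (D * L ^ x)"
      unfolding abs_mult using 1 2 by (intro mult_mono) auto
    then show "\<bar>g x * h x\<bar> \<le> (C * D) * (K * L) ^ x" by (simp add: algebra_simps)
  next
    show "1 \<le> K * L" using 1 2 mult_mono[of 1 K 1 L] by simp
  qed (use 1 2 in auto)
qed

lemma exp_bounded_diff [intro, simp]: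
  assumes "exp_bounded g" "exp_bounded h"
  shows "exp_bounded (\<lambda>x. g x - h x)"
  using exp_bounded_add[OF assms(1) exp_bounded_mult[OF exp_bounded_const[of "-1"] assms(2)]] by simp

lemma exp_bounded_Suc [intro, simp]:
  assumes "exp_bounded g"
  shows "exp_bounded (\<lambda>x. g (Suc x))"
proof -
  obtain C K where 1: "0 \<le> C" "1 \<le> K" "\<And>x. \<bar>g x\<bar> \<le> C * K ^ x"
    using assms(1) unfolding exp_bounded_def by blast
  then show ?thesis
    using 1(3)[of "Suc _"] by (intro exp_boundedI[of "C * K" K]) (auto simp: ac_simps)
qed

text \<open>The expectation of \<open>g\<close> under the Poisson law with mean \<open>m\<close>,
  written as a power series so that it can be differentiated in \<open>m\<close>. The link to the
  probability measure is \<open>integrable_poisson_pmf\<close>.\<close>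

definition pois :: "real \<Rightarrow> (nat \<Rightarrow> real) \<Rightarrow> real" where
  "pois m g = exp (- m) * (\<Sum>x. g x / fact x * m ^ x)"

text \<open>The factorial absorbs any exponential growth, so the series converges for all real
  \<open>m\<close> and may be differentiated termwise. The class \<open>exp_bounded\<close> is
  chosen for this and for its closure under sums, products and shifts.\<close>

lemma summable_pois:
  assumes "exp_bounded g"
  shows "summable (\<lambda>x. g x / fact x * (m::real) ^ x)"
proof -
  obtain C K where 1: "0 \<le> C" "1 \<le> K" "\<And>x. \<bar>g x\<bar> \<le> C * K ^ x"
    using assms(1) unfolding exp_bounded_def by blast
  show ?thesis
  proof (rule summable_comparison_test')
    show "summable (\<lambda>x. C * (inverse (fact x) * (K * \<bar>m\<bar>) ^ x))"
      by (intro summable_mult summable_exp)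
    show "norm (g x / fact x * m ^ x) \<le> C * (inverse (fact x) * (K * \<bar>m\<bar>) ^ x)" for x
      using mult_right_mono[OF 1(3)[of x], of "\<bar>m\<bar> ^ x / fact x"]
      by (simp add: abs_mult power_abs field_simps)
  qed
qed

lemma pois_const [simp]: "pois m (\<lambda>_. c) = c"
proof -
  have "(\<Sum>x. c / fact x * m ^ x) = (\<Sum>x. c * (m ^ x /\<^sub>R fact x))"
    by (intro suminf_cong) (simp add: field_simps)
  also have "\<dots> = c * exp m"
    unfolding exp_def by (rule suminf_mult[OF summable_exp_generic])
  finally show ?thesis unfolding pois_def by (simp add: exp_minus)
qed

lemma pois_add:
  assumes "exp_bounded g" "exp_bounded h"
  shows "pois m (\<lambda>x. g x + h x) = pois m g + pois m h"
proof -
  have "(\<Sum>x. (g x + h x) / fact x * m ^ x) = (\<Sum>x. g x / fact x * m ^ x + h x / fact x * m ^ x)"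
    by (simp add: add_divide_distrib ring_distribs)
  also have "\<dots> = (\<Sum>x. g x / fact x * m ^ x) + (\<Sum>x. h x / fact x * m ^ x)"
    by (rule suminf_add[symmetric]) (intro summable_pois assms)+
  finally show ?thesis unfolding pois_def by (simp only: ring_distribs)
qed

lemma pois_cmult:
  assumes "exp_bounded g"
  shows "pois m (\<lambda>x. c * g x) = c * pois m g"
proof -
  have "(\<Sum>x. c * g x / fact x * m ^ x) = (\<Sum>x. c * (g x / fact x * m ^ x))"
    by (simp add: mult_ac)
  also have "\<dots> = c * (\<Sum>x. g x / fact x * m ^ x)"
    by (rule suminf_mult[OF summable_pois[OF assms]])
  finally show ?thesis unfolding pois_def by simp
qed

lemma pois_diff:
  assumes "exp_bounded g" "exp_bounded h"
  shows "pois m (\<lambda>x. g x - h x) = pois m g - pois m h"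
  using pois_add[OF assms(1) exp_bounded_mult[OF exp_bounded_const[of "-1"] assms(2)], of m] pois_cmult[OF assms(2), of m "-1"]
  by simp

lemma pois_mono:
  assumes "exp_bounded g" "exp_bounded h" "\<And>x. g x \<le> h x" "0 \<le> m"
  shows "pois m g \<le> pois m h"
  unfolding pois_def
  by (intro mult_left_mono suminf_le summable_pois mult_right_mono divide_right_mono assms) (use assms in auto)

text \<open>Termwise differentiation shifts \<open>g\<close> by one, and the factor
  \<open>exp (- m)\<close> subtracts \<open>g\<close>: a derivative in the mean is a forward
  difference of the function.\<close>

lemma pois_deriv:
  assumes "exp_bounded g"
  shows "((\<lambda>m. pois m g) has_real_derivative pois m (\<lambda>x. g (Suc x) - g x)) (at m)"
proof -
  have 1: "((\<lambda>m. \<Sum>x. g x / fact x * m ^ x) has_real_derivative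
      (\<Sum>x. diffs (\<lambda>x. g x / fact x) x * m ^ x)) (at m)"
    by (rule termdiffs_strong_converges_everywhere) (rule summable_pois[OF assms])
  have 2: "diffs (\<lambda>x. g x / fact x) = (\<lambda>x. g (Suc x) / fact x)"
    by (auto simp: diffs_def fun_eq_iff fact_Suc simp del: of_nat_Suc)
  show ?thesis
    unfolding pois_diff[OF exp_bounded_Suc[OF assms] assms]
    unfolding pois_def
    by (rule derivative_eq_intros 1 refl)+ (simp add: 2 algebra_simps)
qed

text \<open>The Stein-Chen identity. It trades a factor \<open>m\<close> outside the expectation for
  a factor \<open>x\<close> inside.\<close>

lemma pois_Suc:
  assumes "exp_bounded g"
  shows "m * pois m (\<lambda>x. g (Suc x)) = pois m (\<lambda>x. real x * g x)"
proof -
  have "(\<Sum>x. real x * g x / fact x * m ^ x) = (\<Sum>x. real (Suc x) * g (Suc x) / fact (Suc x) * m ^ (Suc x))"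
    by (subst suminf_split_head) (use summable_pois[OF exp_bounded_mult[OF exp_bounded_real assms]] in auto)
  also have "\<dots> = (\<Sum>x. m * (g (Suc x) / fact x * m ^ x))"
    by (intro suminf_cong) (simp add: fact_Suc del: of_nat_Suc)
  also have "\<dots> = m * (\<Sum>x. g (Suc x) / fact x * m ^ x)"
    by (rule suminf_mult[OF summable_pois[OF exp_bounded_Suc[OF assms]]])
  finally show ?thesis unfolding pois_def by simp
qed

section \<open>The risk under the Jeffreys prior in one dimension\<close>

text \<open>The cubic correction has this denominator because at w = 1 / (2 v) it becomes exactly a
  telescoping difference of \<open>digamma_gap\<close>. The difference of the two sides vanishes at
  0 and has a nonnegative derivative.\<close>

lemma ln_ratio_le:
  assumes "0 \<le> w" "w < (1::real)"
  shows "ln (1 + w) - ln (1 - w) \<le> 2 * w + 2 / 3 * w ^ 3 / (1 - w^2)^2"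
proof -
  let ?k = "\<lambda>w::real. 2 * w + 2 / 3 * w ^ 3 / (1 - w^2)^2 - (ln (1 + w) - ln (1 - w))"
  have "?k 0 \<le> ?k w"
  proof (rule DERIV_nonneg_imp_nondecreasing[OF assms(1)])
    fix v :: real assume v: "0 \<le> v" "v \<le> w"
    define q where "q = 1 - v^2"
  let ?n = "(2 * v^2 * q^2 + 8 / 3 * v ^ 4 * q)"
  let ?m = "(2 * v^2 * q^2 - 2 / 3 * v ^ 3 * (2 * q * (- 2 * v)))"
    have v1: "v < 1" "\<bar>v\<bar> < 1" using v assms by auto
    then have q: "0 < q" "q \<le> 1" unfolding q_def using abs_square_less_1[of v] by auto
    have "((\<lambda>v. 2 / 3 * v ^ 3) has_real_derivative 2 * v^2) (at v)"
      by (auto intro!: derivative_eq_intros simp: power2_eq_square)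
    moreover have "((\<lambda>v. (1 - v^2)^2) has_real_derivative 2 * q * (- 2 * v)) (at v)"
      by (auto intro!: derivative_eq_intros simp: q_def)
    ultimately have "((\<lambda>v. 2 / 3 * v ^ 3 / (1 - v^2)^2) has_real_derivative
       ?m / (q^2 * q^2)) (at v)"
      unfolding q_def by (rule DERIV_divide) (use q in \<open>simp add: q_def\<close>)
    also have "?m / (q^2 * q^2)
       = ?n / (q^2)^2"
      by (simp add: power2_eq_square power3_eq_cube power4_eq_xxxx)
    finally have d: "((\<lambda>v. 2 / 3 * v ^ 3 / (1 - v^2)^2) has_real_derivative
       ?n / (q^2)^2) (at v)" .
    have "((\<lambda>v. ln (1 + v) - ln (1 - v)) has_real_derivative 1 / (1 + v) + 1 / (1 - v)) (at v)"
      using v v1 by (auto intro!: derivative_eq_intros)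
    moreover have "((\<lambda>v. 2 * v) has_real_derivative 2) (at v)" by (auto intro!: derivative_eq_intros)
    ultimately have "(?k has_real_derivative
       2 + ?n / (q^2)^2 - (1 / (1 + v) + 1 / (1 - v))) (at v)"
      by (intro DERIV_diff DERIV_add d)
    moreover have "1 / (1 + v) + 1 / (1 - v) = 2 / q"
    proof -
      have "q = (1 + v) * (1 - v)" by (simp add: q_def power2_eq_square algebra_simps)
      then show ?thesis using v v1 by (simp add: add_divide_eq_iff divide_simps)
    qed
    \<comment> \<open>Dropping the quartic part of \<open>?n\<close> and enlarging the remaining
      denominator from \<open>q^2\<close> to \<open>q\<close> leaves 2 + 2 v^2 / q - 2 / q, which is
      0 since q = 1 - v^2.\<close>
    moreover have "2 + ?n / (q^2)^2 - 2 / q \<ge> 0"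
    proof -
      have "?n / (q^2)^2 \<ge> (2 * v^2 * q^2) / (q^2)^2"
        using q by (intro divide_right_mono) auto
      also have "(2 * v^2 * q^2) / (q^2)^2 = 2 * v^2 / q^2"
        using q by (simp add: power2_eq_square)
      also have "2 * v^2 / q^2 \<ge> 2 * v^2 / q"
        using q by (intro divide_left_mono) (auto simp: power2_eq_square mult_left_le)
      finally show ?thesis using q by (simp add: q_def field_simps)
    qed
    ultimately show "\<exists>y. (?k has_real_derivative y) (at v) \<and> 0 \<le> y" by auto
  qed
  then show ?thesis by simp
qed

text \<open>The leading term of \<open>Digamma (x + 1) - ln (x + 1 / 2)\<close> for large \<open>x\<close>.\<close>

definition digamma_gap :: "nat \<Rightarrow> real" where
  "digamma_gap x = 1 / (24 * (real x + 1 / 2)^2)"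

text \<open>The term \<open>1 / (real x + 1)\<close> is the increment of Digamma from x + 1 to x +
  2, so this says that Digamma (x + 1) - ln (x + 1 / 2) - \<open>digamma_gap x\<close> is
  nondecreasing in \<open>x\<close>.\<close>

lemma ln_step_le:
  "ln (real (Suc x) + 1 / 2) - ln (real x + 1 / 2) \<le> 1 / (real x + 1) + (digamma_gap x - digamma_gap (Suc x))"
proof -
  define v where "v = real x + 1"
  define w where "w = 1 / (2 * v)"
  have v: "v \<ge> 1" by (simp add: v_def)
  have w: "0 < w" "w < 1" using v by (auto simp: w_def)
  have "ln (real (Suc x) + 1 / 2) - ln (real x + 1 / 2) = ln (1 + w) - ln (1 - w)"
  proof -
    have "real (Suc x) + 1 / 2 = v * (1 + w)" "real x + 1 / 2 = v * (1 - w)"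
      using v by (auto simp: w_def v_def field_simps)
    then show ?thesis using v w by (simp add: ln_mult)
  qed
  also have "\<dots> \<le> 2 * w + 2 / 3 * w ^ 3 / (1 - w^2)^2"
    using w by (intro ln_ratio_le) auto
  also have "2 * w = 1 / (real x + 1)" using v by (simp add: w_def v_def divide_simps)
  also have "2 / 3 * w ^ 3 / (1 - w^2)^2 = digamma_gap x - digamma_gap (Suc x)"
  proof -
    have w2: "1 - w^2 = (4 * v^2 - 1) / (4 * v^2)" using v by (simp add: w_def field_simps power2_eq_square)
    have g: "digamma_gap x = 1 / (6 * (2 * v - 1)^2)" "digamma_gap (Suc x) = 1 / (6 * (2 * v + 1)^2)"
    proof -
      have "6 * (2 * v - 1)^2 = 24 * (real x + 1 / 2)^2" "6 * (2 * v + 1)^2 = 24 * (real (Suc x) + 1 / 2)^2"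
        by (simp_all add: v_def power2_eq_square algebra_simps)
      then show "digamma_gap x = 1 / (6 * (2 * v - 1)^2)" "digamma_gap (Suc x) = 1 / (6 * (2 * v + 1)^2)"
        by (simp_all only: digamma_gap_def)
    qed
    have "4 * v^2 - 1 = (2 * v - 1) * (2 * v + 1)" by (simp add: power2_eq_square algebra_simps)
    moreover have "2 * v - 1 > 0" "2 * v + 1 > 0" using v by auto
    ultimately show ?thesis
      unfolding w2 g using v
      by (simp add: w_def power_divide divide_simps)
         (simp add: power2_eq_square power3_eq_cube power4_eq_xxxx algebra_simps)
  qed
  finally show ?thesis .
qed

lemma pois_indicator_0: "pois m (\<lambda>x. if x = 0 then 1 else 0) = exp (- m)"
proof -
  have "(\<Sum>x. (if x = 0 then 1 else 0) / fact x * m ^ x) = (\<Sum>x\<in>{0}. (if x = 0 then 1 else 0) / fact x * m ^ x)"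
    by (rule suminf_finite) auto
  then show ?thesis by (simp add: pois_def)
qed

lemma pois_inverse_Suc: "m * pois m (\<lambda>x. 1 / (real x + 1)) = 1 - exp (- m)"
proof -
  have b: "exp_bounded (\<lambda>x. 1 / real x)"
    by (rule exp_bounded_mono[OF exp_bounded_const[of 1]]) (auto simp: divide_le_eq)
  have "m * pois m (\<lambda>x. 1 / (real x + 1)) = m * pois m (\<lambda>x. 1 / real (Suc x))"
    by (simp add: add.commute)
  also have "\<dots> = pois m (\<lambda>x. real x * (1 / real x))"
    by (rule pois_Suc[OF b])
  \<comment> \<open>With 1 / 0 = 0 the product is 0 at \<open>x = 0\<close> and 1 elsewhere; the
    missing mass is \<open>exp (- m)\<close>.\<close>
  also have "(\<lambda>x. real x * (1 / real x)) = (\<lambda>x. 1 - (if x = 0 then 1 else 0))" by auto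
  also have "pois m \<dots> = 1 - exp (- m)"
    by (subst pois_diff) (auto simp: pois_indicator_0 intro!: exp_bounded_mono[OF exp_bounded_const[of 1]])
  finally show ?thesis .
qed

lemma exp_bounded_ln_half: "exp_bounded (\<lambda>x. ln (real x + 1 / 2))"
proof (rule exp_bounded_mono[OF exp_bounded_add[OF exp_bounded_real exp_bounded_const[of 1]]])
  fix x
  have "ln (real x + 1 / 2) \<le> real x + 1 / 2 - 1" by (rule ln_le_minus_one) auto
  moreover have "- ln (real x + 1 / 2) \<le> 1 / (real x + 1 / 2) - 1"
    using ln_le_minus_one[of "1 / (real x + 1 / 2)"] by (simp add: ln_div)
  moreover have "1 / (real x + 1 / 2) \<le> 2" by (simp add: field_simps)
  ultimately show "\<bar>ln (real x + 1 / 2)\<bar> \<le> \<bar>real x + 1\<bar>" by linarith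
qed

lemma exp_bounded_digamma_gap: "exp_bounded digamma_gap"
proof (rule exp_bounded_mono[OF exp_bounded_const[of 1]])
  show "\<bar>digamma_gap x\<bar> \<le> \<bar>1\<bar>" for x
  proof -
    have "(1/2)^2 \<le> (real x + 1 / 2)^2" by (rule power_mono) auto
    then have "1 \<le> 24 * (real x + 1 / 2)^2" by (simp add: power2_eq_square)
    then show ?thesis unfolding digamma_gap_def by simp
  qed
qed

definition log_gap :: "real \<Rightarrow> real" where
  "log_gap m = ln m - pois m (\<lambda>x. ln (real x + 1 / 2))"

text \<open>Only the decay at infinity matters: it is the boundary value from which the monotonicity
  argument of \<open>log_gap_le_bound\<close> starts. By ln u <= u - 1 it is enough to bound m / (x
  + 1 / 2) in expectation, and \<open>pois_Suc\<close> controls the two rational terms that dominate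
  it.\<close>

lemma log_gap_le_inverse:
  assumes "0 < m"
  shows "log_gap m \<le> 2 / m"
proof -
  let ?a = "(\<lambda>x. 1 / (real x + 1))"
  let ?b = "(\<lambda>x. 1 / ((real x + 1) * (real x + 2)))"
  let ?c = "\<lambda>x. 1 / (real x + 1) + 2 * (1 / ((real x + 1) * (real x + 2)))"
  have b1: "exp_bounded ?a"
    by (rule exp_bounded_mono[OF exp_bounded_const[of 1]]) auto
  have b2: "exp_bounded (\<lambda>x. 1 / (real x * (real x + 1)))"
  proof (rule exp_bounded_mono[OF exp_bounded_const[of 1]])
    show "\<bar>1 / (real x * (real x + 1))\<bar> \<le> \<bar>1\<bar>" for x by (cases x) (auto simp: divide_le_eq algebra_simps)
  qed
  have b2': "exp_bounded ?b"
    using exp_bounded_Suc[OF b2] by (simp add: add_ac)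
  have e1: "m * pois m ?a \<le> 1" by (simp add: pois_inverse_Suc)
  have "m * pois m ?b = m * pois m (\<lambda>x. 1 / (real (Suc x) * (real (Suc x) + 1)))"
    by (simp add: add_ac)
  also have "\<dots> = pois m (\<lambda>x. real x * (1 / (real x * (real x + 1))))"
    by (rule pois_Suc[OF b2])
  also have "\<dots> \<le> pois m ?a"
    using assms by (intro pois_mono b1 exp_bounded_mult exp_bounded_real b2) (auto simp: divide_simps)
  also have "\<dots> \<le> 1 / m" using e1 assms by (simp add: field_simps)
  finally have e2: "m * pois m ?b \<le> 1 / m" .
  have "pois m (\<lambda>x. ln m + 1 - m * (?c x))
     \<le> pois m (\<lambda>x. ln (real x + 1 / 2))"
  proof (rule pois_mono)
    show "ln m + 1 - m * (?c x) \<le> ln (real x + 1 / 2)" for x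
    proof -
      have "ln (m / (real x + 1 / 2)) \<le> m / (real x + 1 / 2) - 1"
        using assms by (intro ln_le_minus_one) auto
      moreover have "ln (m / (real x + 1 / 2)) = ln m - ln (real x + 1 / 2)"
        using assms by (simp add: ln_div)
      moreover have "m / (real x + 1 / 2) \<le> m * (?c x)"
      proof -
        \<comment> \<open>Equality holds at \<open>x = 0\<close>, which fixes the coefficient 2 in
          \<open>?c\<close>.\<close>
        have "1 / (real x + 1 / 2) \<le> (?c x)"
          by (simp add: divide_simps) (simp add: algebra_simps)
        from mult_left_mono[OF this, of m] show ?thesis using assms by simp
      qed
      ultimately show ?thesis by linarith
    qed
  qed (use assms in \<open>intro exp_bounded_diff exp_bounded_mult exp_bounded_add exp_bounded_const b1 b2' exp_bounded_ln_half | simp\<close>)+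
  also have "pois m (\<lambda>x. ln m + 1 - m * (?c x))
     = ln m + 1 - m * pois m (\<lambda>x. ?c x)"
    using b1 b2' by (simp only: pois_diff pois_cmult pois_const exp_bounded_mult exp_bounded_add exp_bounded_const)
  also have "pois m (\<lambda>x. ?c x)
     = pois m ?a + 2 * pois m ?b"
    using b1 b2' by (simp only: pois_add pois_cmult exp_bounded_mult exp_bounded_const)
  finally show ?thesis using e1 e2 unfolding log_gap_def by (simp add: distrib_left)
qed

text \<open>The Poisson expectation of \<open>Digamma (x + 1)\<close> exceeds \<open>ln m\<close> by the exponential integral of \<open>m\<close>, for
  which \<open>exp (- m) / (m + 1)\<close> is a lower bound.\<close>

definition log_gap_bound :: "real \<Rightarrow> real" where
  "log_gap_bound m = pois m digamma_gap - exp (- m) / (m + 1)"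

text \<open>The difference of the two sides is nondecreasing in \<open>m\<close> and at most 3 / M
  at every large M, hence nonpositive everywhere. In its derivative the Poisson expectations are
  controlled by \<open>ln_step_le\<close>.\<close>

lemma log_gap_le_bound:
  assumes "0 < m"
  shows "log_gap m \<le> log_gap_bound m"
proof -
  let ?G = "\<lambda>m. log_gap m - log_gap_bound m"
  let ?s = "(\<lambda>x. ln (real (Suc x) + 1 / 2) - ln (real x + 1 / 2))"
  let ?d = "(\<lambda>x. digamma_gap (Suc x) - digamma_gap x)"
  have mono: "?G a \<le> ?G b" if "0 < a" "a \<le> b" for a b
  proof (rule DERIV_nonneg_imp_nondecreasing[OF that(2)])
    fix m assume m: "a \<le> m" "m \<le> b"
    then have m0: "0 < m" using that by auto
    let ?y = "1 / m - pois m ?s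
       - (pois m ?d - (- exp (- m) * (m + 1) - exp (- m)) / (m + 1)^2)"
    have "(?G has_real_derivative ?y) (at m)"
      unfolding log_gap_def log_gap_bound_def
      by (rule derivative_eq_intros pois_deriv exp_bounded_ln_half exp_bounded_digamma_gap refl | (use m0 in \<open>simp add: power2_eq_square\<close>; fail))+
    moreover have "?y \<ge> 0"
    proof -
      have "pois m ?s \<le>
          pois m (\<lambda>x. 1 / (real x + 1) - (digamma_gap (Suc x) - digamma_gap x))"
        using m0 ln_step_le
        by (intro pois_mono exp_bounded_diff exp_bounded_Suc[OF exp_bounded_ln_half] exp_bounded_ln_half
            exp_bounded_Suc[OF exp_bounded_digamma_gap] exp_bounded_digamma_gap
            exp_bounded_mono[OF exp_bounded_const[of 1], of "\<lambda>x. 1 / (real x + 1)"]) (auto simp: algebra_simps)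
      also have "\<dots> = pois m (\<lambda>x. 1 / (real x + 1)) - pois m ?d"
        by (intro pois_diff exp_bounded_diff exp_bounded_Suc[OF exp_bounded_digamma_gap] exp_bounded_digamma_gap
            exp_bounded_mono[OF exp_bounded_const[of 1], of "\<lambda>x. 1 / (real x + 1)"]) auto
      also have "pois m (\<lambda>x. 1 / (real x + 1)) = (1 - exp (- m)) / m"
        using pois_inverse_Suc[of m] m0 by (simp add: field_simps)
      finally have "?y \<ge> exp (- m) / m + (- exp (- m) * (m + 1) - exp (- m)) / (m + 1)^2"
        using m0 by (simp add: diff_divide_distrib)
      \<comment> \<open>What remains is positive because (m + 1)^2 - m (m + 2) = 1.\<close>
      also have "exp (- m) / m + (- exp (- m) * (m + 1) - exp (- m)) / (m + 1)^2 = exp (- m) * (1 / (m * (m + 1)^2))"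
        using m0 by (simp add: divide_simps) (simp add: power2_eq_square algebra_simps)
      finally show ?thesis using m0 by (smt (verit) divide_nonneg_nonneg exp_ge_zero mult_nonneg_nonneg zero_le_power2)
    qed
    ultimately show "\<exists>y. (?G has_real_derivative y) (at m) \<and> 0 \<le> y" by blast
  qed
  have "?G m \<le> 3 / M" if "M \<ge> max m 1" for M
  proof -
    have M: "M > 0" "M \<ge> m" "M \<ge> 1" using that by auto
    have "pois M (\<lambda>_. 0) \<le> pois M digamma_gap"
      using M by (intro pois_mono exp_bounded_digamma_gap) (auto simp: digamma_gap_def)
    moreover have "exp (- M) / (M + 1) \<le> 1 / M"
      using M by (intro frac_le) auto
    ultimately have "?G M \<le> 2 / M + 1 / M"
      using log_gap_le_inverse[of M] M unfolding log_gap_bound_def by simp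
    then show ?thesis using mono[of m M] assms M by simp
  qed
  then have "eventually (\<lambda>M. ?G m \<le> 3 / M) at_top"
    using eventually_ge_at_top by (rule eventually_mono[rotated])
  moreover have "((\<lambda>M. 3 / M) \<longlongrightarrow> (0::real)) at_top" by (intro tendsto_divide_0[OF tendsto_const] filterlim_at_top_imp_at_infinity filterlim_ident)
  ultimately have "?G m \<le> 0" by (intro tendsto_lowerbound[of _ 0 at_top]) auto
  then show ?thesis by simp
qed

text \<open>The polynomial is the sum of the first six terms of the power series in
  \<open>log_gap_less\<close>, and m / (m + 1) is the exponential correction of
  \<open>log_gap_bound\<close> after multiplication by m exp m.\<close>

lemma gap_polynomial_pos:
  assumes "0 < (m::real)"
  shows "0 < 1/50 - 11/75 * m - 23/2700 * m^2 + 47/176400 * m ^ 4 + 59/729000 * m ^ 5 + m / (m + 1)"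
proof (cases "m \<le> 4")
  case True
  have "m / (m + 1) \<ge> m / 5" using True assms by (intro divide_left_mono) auto
  moreover have "0 \<le> m ^ 4" "0 \<le> m ^ 5" using assms by simp_all
  moreover have "m^2 \<le> 4 * m" using True assms by (simp add: power2_eq_square)
  ultimately show ?thesis using assms by linarith
next
  case False
  have "m / (m + 1) \<ge> 4 / 5" using False by (simp add: field_simps)
  moreover have "m ^ 5 \<ge> 4 * m ^ 4" using False by (simp add: power_numeral_odd numeral_eq_Suc)
  \<comment> \<open>Two tangents, to the square of \<open>m^2\<close> at m^2 = 20 and to
    \<open>m^2\<close> at m = 5, reduce the claim to a linear inequality.\<close>
  moreover have "m ^ 4 \<ge> 40 * m^2 - 400"
    using zero_le_power2[of "m^2 - 20"] by (simp add: power2_eq_square power4_eq_xxxx algebra_simps)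
  moreover have "0 \<le> (m - 5)^2" by simp
  then have "m^2 \<ge> 10 * m - 25" by (simp add: power2_eq_square algebra_simps)
  ultimately show ?thesis using assms by linarith
qed

text \<open>After multiplication by exp m the claim concerns a power series with coefficients
  \<open>b k / fact k\<close>, of which only those at k = 1 and k = 2 are negative. The loss there
  is repaid by the exponential correction in \<open>log_gap_bound\<close>.\<close>

lemma log_gap_less:
  assumes m: "0 < m"
  shows "m * log_gap m < 1 / 50"
proof -
  \<comment> \<open>This is \<open>digamma_gap\<close> shifted by one, so that
    \<open>pois_Suc\<close> turns m times its expectation into the expectation of k * D' k.\<close>
  define D' where "D' k = 1 / (6 * (2 * real k - 1)^2)" for k
  have D'S: "D' (Suc x) = digamma_gap x" for x
  proof -
    have "6 * (2 * real (Suc x) - 1)^2 = 24 * (real x + 1 / 2)^2"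
      by (simp add: power2_eq_square algebra_simps)
    then show ?thesis by (simp only: digamma_gap_def D'_def)
  qed
  have bD: "exp_bounded D'"
  proof (rule exp_bounded_mono[OF exp_bounded_const[of 1]])
    show "\<bar>D' k\<bar> \<le> \<bar>1\<bar>" for k
    proof (cases k)
      case (Suc x)
      then have "1 \<le> 6 * (2 * real k - 1)^2" by (simp add: power2_eq_square algebra_simps)
      then show ?thesis by (simp add: D'_def divide_le_eq)
    qed (simp add: D'_def)
  qed
  \<comment> \<open>The value 1 / 50 equals 3 * D' 3, so that \<open>b 3 = 0\<close>, and k * D' k
    stays below it for all larger k.\<close>
  define b where "b = (\<lambda>k. 1 / 50 - real k * D' k)"
  have bb: "exp_bounded b" unfolding b_def by (intro exp_bounded_diff exp_bounded_mult exp_bounded_const exp_bounded_real bD)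
  have bn: "0 \<le> b k" if "k \<ge> 3" for k
  proof -
    define j where "j = k - 3"
    with that have k: "k = j + 3" by simp
    have "real k * 50 \<le> 6 * (2 * real k - 1)^2"
      unfolding k by (simp add: power2_eq_square algebra_simps)
    moreover have "0 < 6 * (2 * real k - 1)^2" using that by simp
    ultimately have "real k * D' k \<le> 1 / 50" unfolding D'_def by (simp add: divide_simps)
    then show ?thesis by (simp add: b_def)
  qed
  \<comment> \<open>The discarded terms are nonnegative. Degrees 4 and 5 are kept to outweigh the
    negative linear and quadratic terms when \<open>m\<close> is large.\<close>
  have "(\<Sum>k<6. b k / fact k * m ^ k) \<le> (\<Sum>k. b k / fact k * m ^ k)"
    using m by (intro sum_le_suminf summable_pois bb) (auto intro!: mult_nonneg_nonneg divide_nonneg_nonneg bn)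
  also have "(\<Sum>k. b k / fact k * m ^ k) = exp m * pois m b"
    by (simp add: pois_def exp_minus)
  also have "pois m b = 1 / 50 - m * pois m digamma_gap"
  proof -
    have "pois m b = 1 / 50 - pois m (\<lambda>k. real k * D' k)"
      unfolding b_def by (subst pois_diff) (auto intro!: bD)
    then show ?thesis using pois_Suc[OF bD, of m] by (simp add: D'S)
  qed
  finally have 1: "(\<Sum>k<6. b k / fact k * m ^ k) \<le> exp m * (1 / 50 - m * pois m digamma_gap)" .
  have "(\<Sum>k<6. b k / fact k * m ^ k) = 1/50 - 11/75 * m - 23/2700 * m^2 + 47/176400 * m ^ 4 + 59/729000 * m ^ 5"
  proof -
    have b: "b 0 = 1 / 50" "b 1 = - 11 / 75" "b 2 = - 23 / 1350" "b 3 = 0" "b 4 = 47 / 7350" "b 5 = 59 / 6075"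
      by (simp_all add: b_def D'_def)
    have "(\<Sum>k<6. b k / fact k * m ^ k) = (\<Sum>k\<in>{0, 1, 2, 3, 4, 5}. b k / fact k * m ^ k)"
      by (rule sum.cong) auto
    also have "\<dots> = b 0 + b 1 * m + b 2 / 2 * m^2 + b 3 / 6 * m ^ 3 + b 4 / 24 * m ^ 4 + b 5 / 120 * m ^ 5"
      by (simp add: fact_numeral)
    also have "\<dots> = 1/50 - 11/75 * m - 23/2700 * m^2 + 47/176400 * m ^ 4 + 59/729000 * m ^ 5"
      unfolding b by simp
    finally show ?thesis .
  qed
  with gap_polynomial_pos[OF m] 1 have "0 < exp m * (1 / 50 - m * pois m digamma_gap) + m / (m + 1)" by linarith
  also have "\<dots> = exp m * (1 / 50 - m * log_gap_bound m)"
  proof -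
    have "exp m * (m * (exp (- m) / (m + 1))) = m / (m + 1)" by (simp add: exp_minus)
    then show ?thesis by (simp add: log_gap_bound_def right_diff_distrib)
  qed
  finally have "m * log_gap_bound m < 1 / 50" by (simp add: zero_less_mult_iff)
  moreover have "m * log_gap m \<le> m * log_gap_bound m"
    using m by (intro mult_left_mono log_gap_le_bound) auto
  ultimately show ?thesis by linarith
qed

section \<open>The Jeffreys terms as functions of the Poisson mean\<close>

lemma Gamma_half_Suc: "Gamma (real (Suc x) + 1 / 2) = (real x + 1 / 2) * Gamma (real x + 1 / 2)"
proof -
  have "real x + 1 / 2 \<notin> \<int>\<^sub>\<le>\<^sub>0" by (auto elim!: nonpos_Ints_cases)
  have "real (Suc x) + 1 / 2 = (real x + 1 / 2) + 1" by simp
  with Gamma_plus1[OF \<open>real x + 1 / 2 \<notin> \<int>\<^sub>\<le>\<^sub>0\<close>] show ?thesis by (simp only:)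
qed

lemma exp_bounded_ln_Gamma_half: "exp_bounded (\<lambda>x. ln (Gamma (real x + 1 / 2)))"
proof (rule exp_bounded_mono)
  let ?g = "\<lambda>x. ln (Gamma (real x + 1 / 2))"
  show "exp_bounded (\<lambda>x. \<bar>?g 0\<bar> + real x * (real x + 1))"
    by (intro exp_bounded_add exp_bounded_mult exp_bounded_real exp_bounded_const)
  have "\<bar>?g x\<bar> \<le> \<bar>?g 0\<bar> + real x * (real x + 1)" for x
  proof (induction x)
    case (Suc x)
    have "?g (Suc x) = ln (real x + 1 / 2) + ?g x"
      unfolding Gamma_half_Suc using Gamma_real_pos[of "real x + 1 / 2"] by (intro ln_mult_pos) auto
    moreover have "\<bar>ln (real x + 1 / 2)\<bar> \<le> real x + 1"
    proof -
      have "ln (real x + 1 / 2) \<le> real x + 1 / 2 - 1" by (rule ln_le_minus_one) auto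
      moreover have "- ln (real x + 1 / 2) \<le> 1 / (real x + 1 / 2) - 1"
        using ln_le_minus_one[of "1 / (real x + 1 / 2)"] by (simp add: ln_div)
      moreover have "1 / (real x + 1 / 2) \<le> 2" by (simp add: field_simps)
      ultimately show ?thesis by linarith
    qed
    ultimately show ?case using Suc by (simp add: algebra_simps)
  qed simp
  then show "\<bar>?g x\<bar> \<le> \<bar>\<bar>?g 0\<bar> + real x * (real x + 1)\<bar>" for x by fastforce
qed

text \<open>The part of the expected log ratio between likelihood and Jeffreys marginal that depends
  on the mean, for one coordinate. It is the \<psi> of the overview without ln m / 2, and its
  derivative is \<open>log_gap\<close>.\<close>

definition jeffreys_potential :: "real \<Rightarrow> real" where
  "jeffreys_potential m = m * ln m - m - pois m (\<lambda>x. ln (Gamma (real x + 1 / 2)))"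

lemma jeffreys_potential_diff_less:
  assumes "0 < a" "a < b"
  shows "jeffreys_potential b - jeffreys_potential a < 1 / 50 * ln (b / a)"
proof -
  let ?p = "\<lambda>m. jeffreys_potential m - 1 / 50 * ln m"
  have "?p b < ?p a"
  proof (rule DERIV_neg_imp_decreasing[OF assms(2)])
    fix m assume "a \<le> m" "m \<le> b"
    then have m: "0 < m" using assms by auto
    have "(?p has_real_derivative (ln m - pois m (\<lambda>x. ln (Gamma (real (Suc x) + 1 / 2)) - ln (Gamma (real x + 1 / 2))) - 1 / (50 * m))) (at m)"
      unfolding jeffreys_potential_def
      by (rule derivative_eq_intros pois_deriv exp_bounded_ln_Gamma_half refl | (use m in \<open>simp\<close>; fail))+
    also have "(\<lambda>x. ln (Gamma (real (Suc x) + 1 / 2)) - ln (Gamma (real x + 1 / 2))) = (\<lambda>x. ln (real x + 1 / 2))"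
    proof
      fix x
      have "0 < Gamma (real x + 1 / 2)" by (rule Gamma_real_pos) simp
      then show "ln (Gamma (real (Suc x) + 1 / 2)) - ln (Gamma (real x + 1 / 2)) = ln (real x + 1 / 2)"
        unfolding Gamma_half_Suc by (subst ln_mult_pos) auto
    qed
    finally have "(?p has_real_derivative (log_gap m - 1 / (50 * m))) (at m)" by (simp add: log_gap_def)
    moreover have "log_gap m - 1 / (50 * m) < 0" using log_gap_less[OF m] m by (simp add: field_simps)
    ultimately show "\<exists>y. (?p has_real_derivative y) (at m) \<and> y < 0" by blast
  qed
  then show ?thesis using assms by (simp add: ln_div)
qed

section \<open>Lebesgue measure on real vectors\<close>

lemma prod_Basis_vec:
  fixes f :: "real ^ 'd \<Rightarrow> 'b::comm_monoid_mult"
  shows "(\<Prod>b\<in>Basis. f b) = (\<Prod>i\<in>UNIV. f (axis i 1))"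
proof -
  have 1: "(Basis :: (real ^ 'd) set) = (\<lambda>i. axis i 1) ` UNIV"
    by (auto simp: Basis_vec_def)
  have 2: "inj (\<lambda>i::'d. axis i (1::real))"
    by (auto simp: inj_def axis_eq_axis)
  have "prod f Basis = prod f ((\<lambda>i::'d. axis i (1::real)) ` UNIV)"
    by (subst 1) (rule refl)
  also have "\<dots> = (\<Prod>i\<in>UNIV. f (axis i 1))" by (subst prod.reindex[OF 2]) (simp add: o_def)
  finally show ?thesis .
qed

lemma nn_integral_lborel_vec_prod:
  fixes f :: "'d::finite \<Rightarrow> real \<Rightarrow> ennreal"
  assumes [measurable]: "\<And>i. f i \<in> borel_measurable borel"
  shows "(\<integral>\<^sup>+x. (\<Prod>i\<in>UNIV. f i (x $ i)) \<partial>(lborel :: (real ^ 'd) measure)) = (\<Prod>i\<in>UNIV. \<integral>\<^sup>+x. f i x \<partial>lborel)"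
proof -
  define g where "g b = f (THE i. b = axis i 1)" for b :: "real ^ 'd"
  have g: "g (axis i 1) = f i" for i
    by (simp add: g_def axis_eq_axis)
  have "(\<integral>\<^sup>+x. (\<Prod>b\<in>Basis. g b (x \<bullet> b)) \<partial>(lborel :: (real ^ 'd) measure)) = (\<Prod>b\<in>Basis. (\<integral>\<^sup>+x. g b x \<partial>lborel))"
    by (rule nn_integral_lborel_prod) (auto simp: g_def)
  then show ?thesis by (simp add: prod_Basis_vec g inner_axis)
qed

lemma borel_measurable_vec_lambda' [measurable (raw)]:
  fixes f :: "'a \<Rightarrow> 'd::finite \<Rightarrow> real"
  assumes "\<And>i. (\<lambda>x. f x i) \<in> borel_measurable M"
  shows "(\<lambda>x. \<chi> i. f x i) \<in> borel_measurable M"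
proof (subst borel_measurable_euclidean_space, safe)
  fix b :: "real ^ 'd" assume "b \<in> Basis"
  then obtain i where "b = axis i 1" by (auto simp: Basis_vec_def)
  then show "(\<lambda>x. (\<chi> i. f x i) \<bullet> b) \<in> borel_measurable M"
    using assms by (simp add: inner_axis)
qed

lemma measurable_vec_lambda:
  "vec_lambda \<in> (\<Pi>\<^sub>M i\<in>(UNIV :: 'd::finite set). (borel :: real measure)) \<rightarrow>\<^sub>M borel"
  by (rule borel_measurable_vec_lambda') (simp add: measurable_component_singleton)

text \<open>Both measures give each box its volume. The product form lets the change of variables in
  \<open>nn_integral_square_subst\<close> be verified one coordinate at a time.\<close>

lemma lborel_vec_eq:
  "(lborel :: (real ^ 'd::finite) measure) = distr (\<Pi>\<^sub>M i\<in>UNIV. lborel) borel vec_lambda"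
proof (rule lborel_eqI)
  interpret product_sigma_finite "\<lambda>_::'d. lborel :: real measure" by standard
  have m: "vec_lambda \<in> (\<Pi>\<^sub>M i\<in>(UNIV :: 'd::finite set). (lborel :: real measure)) \<rightarrow>\<^sub>M borel"
  proof -
    have "sets (\<Pi>\<^sub>M i\<in>(UNIV :: 'd set). (lborel :: real measure)) = sets (\<Pi>\<^sub>M i\<in>(UNIV :: 'd set). (borel :: real measure))"
      by (intro sets_PiM_cong) auto
    from measurable_cong_sets[OF this refl] show ?thesis using measurable_vec_lambda by blast
  qed
  fix l u :: "real ^ 'd" assume le: "\<And>b. b \<in> Basis \<Longrightarrow> l \<bullet> b \<le> u \<bullet> b"
  have le': "l $ i \<le> u $ i" for i using le[of "axis i 1"] by (force simp add: inner_axis Basis_vec_def)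
  have "vec_lambda -` box l u \<inter> space (\<Pi>\<^sub>M i\<in>UNIV. lborel) = (\<Pi>\<^sub>E i\<in>UNIV. {l $ i<..<u $ i})"
    by (auto simp: mem_box_cart space_PiM PiE_def Pi_def)
  then have "emeasure (distr (\<Pi>\<^sub>M i\<in>UNIV. lborel) borel vec_lambda) (box l u) = emeasure (\<Pi>\<^sub>M i\<in>UNIV. lborel) (\<Pi>\<^sub>E i\<in>UNIV. {l $ i<..<u $ i})"
    by (subst emeasure_distr[OF m]) auto
  also have "\<dots> = (\<Prod>i\<in>UNIV. ennreal (u $ i - l $ i))"
    using le' by (subst emeasure_PiM) auto
  also have "\<dots> = ennreal (\<Prod>b\<in>Basis. (u - l) \<bullet> b)"
    using le' by (simp add: prod_Basis_vec inner_axis prod_ennreal)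
  finally show "emeasure (distr (\<Pi>\<^sub>M i\<in>UNIV. lborel) borel vec_lambda) (box l u) = ennreal (\<Prod>b\<in>Basis. (u - l) \<bullet> b)" .
qed simp

lemma nn_integral_lborel_shift:
  fixes c :: "'a::euclidean_space"
  assumes [measurable]: "f \<in> borel_measurable borel"
  shows "(\<integral>\<^sup>+x. f (c + x) \<partial>lborel) = (\<integral>\<^sup>+x. f x \<partial>lborel)"
proof -
  have "(\<integral>\<^sup>+x. f x \<partial>distr lborel borel ((+) c)) = (\<integral>\<^sup>+x. f (c + x) \<partial>lborel)"
    by (rule nn_integral_distr) auto
  then show ?thesis by (simp add: lborel_distr_plus)
qed

lemma nn_integral_exp_square:
  assumes "0 < c"
  shows "(\<integral>\<^sup>+x. ennreal (exp (- c * x^2)) \<partial>lborel) = ennreal (sqrt (pi / c))"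
proof -
  let ?s = "1 / sqrt (2 * c)"
  have n: "normal_density 0 ?s x = exp (- c * x^2) / sqrt (pi / c)" for x
    using assms by (simp add: normal_density_def power_divide field_simps)
  have "(\<integral>\<^sup>+x. ennreal (normal_density 0 ?s x) \<partial>lborel) = 1"
    using assms by (subst nn_integral_eq_integral) auto
  then have "(\<integral>\<^sup>+x. ennreal (sqrt (pi / c)) * ennreal (normal_density 0 ?s x) \<partial>lborel) = ennreal (sqrt (pi / c))"
    by (subst nn_integral_cmult) auto
  moreover have "ennreal (sqrt (pi / c)) * ennreal (normal_density 0 ?s x) = ennreal (exp (- c * x^2))" for x
    using assms by (subst ennreal_mult[symmetric]) (auto simp: n)
  ultimately show ?thesis by simp
qed

lemma norm_vec_power2: "(norm (x :: real ^ 'd))^2 = (\<Sum>i\<in>UNIV. (x $ i)^2)"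
  by (simp add: norm_vec_def L2_set_def sum_nonneg)

lemma nn_integral_exp_norm_square:
  assumes "0 < c"
  shows "(\<integral>\<^sup>+x. ennreal (exp (- c * (norm x)^2)) \<partial>(lborel :: (real ^ 'd) measure)) = ennreal (sqrt (pi / c) ^ CARD('d))"
proof -
  have "ennreal (exp (- c * (norm x)^2)) = (\<Prod>i\<in>UNIV. ennreal (exp (- c * (x $ i)^2)))" for x :: "real ^ 'd"
    by (simp add: norm_vec_power2 sum_distrib_left exp_sum prod_ennreal flip: sum_negf)
  then have "(\<integral>\<^sup>+x. ennreal (exp (- c * (norm x)^2)) \<partial>(lborel :: (real ^ 'd) measure))
     = (\<Prod>i\<in>(UNIV::'d set). \<integral>\<^sup>+x. ennreal (exp (- c * x^2)) \<partial>lborel)"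
    by (simp only:) (rule nn_integral_lborel_vec_prod, measurable)
  also have "\<dots> = ennreal (sqrt (pi / c)) ^ CARD('d)"
    unfolding nn_integral_exp_square[OF assms] by simp
  finally show ?thesis using assms by (simp add: ennreal_power)
qed

text \<open>By translation invariance the integral of \<open>g y * f (T x)\<close> over \<open>x\<close> and \<open>y\<close>, with a Gaussian \<open>g\<close>, equals
  that of \<open>g (y - T x) * f y\<close>, and the rotation invariance of \<open>g\<close> lets one integrate over \<open>x\<close> first.\<close>

lemma nn_integral_lborel_orthogonal:
  fixes T :: "real ^ 'd \<Rightarrow> real ^ 'd"
  assumes T: "orthogonal_transformation T" and [measurable]: "f \<in> borel_measurable borel"
  shows "(\<integral>\<^sup>+x. f (T x) \<partial>lborel) = (\<integral>\<^sup>+x. f x \<partial>lborel)"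
proof -
  define g where "g x = ennreal (exp (- 1 * (norm x)^2))" for x :: "real ^ 'd"
  have [measurable]: "g \<in> borel_measurable borel" unfolding g_def by measurable
  have lin: "linear T" using T by (rule orthogonal_transformation_linear)
  then have m[measurable]: "T \<in> borel_measurable borel"
    by (intro borel_measurable_continuous_onI linear_continuous_on) (simp only: linear_conv_bounded_linear)
  define S where "S = inv T"
  have TS: "T (S y) = y" for y
    using orthogonal_transformation_surj[OF T] by (simp add: S_def surj_f_inv_f)
  define I where "I = (\<integral>\<^sup>+x. g x \<partial>lborel)"
  have "I = ennreal (sqrt (pi / 1) ^ CARD('d))"
    unfolding I_def g_def by (rule nn_integral_exp_norm_square) simp
  then have I: "I \<noteq> 0" "I \<noteq> \<top>" by simp_all
  have "I * (\<integral>\<^sup>+x. f (T x) \<partial>lborel) = (\<integral>\<^sup>+y. g y * (\<integral>\<^sup>+x. f (T x) \<partial>lborel) \<partial>lborel)"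
    unfolding I_def by (simp add: nn_integral_multc)
  also have "\<dots> = (\<integral>\<^sup>+y. (\<integral>\<^sup>+x. g y * f (y + T x) \<partial>lborel) \<partial>lborel)"
  proof (rule nn_integral_cong, goal_cases)
    case (1 y)
    have "(\<integral>\<^sup>+x. f (T x) \<partial>lborel) = (\<integral>\<^sup>+x. f (T (S y + x)) \<partial>lborel)"
      by (rule nn_integral_lborel_shift[symmetric]) measurable
    also have "\<dots> = (\<integral>\<^sup>+x. f (y + T x) \<partial>lborel)"
      by (simp add: linear_add[OF lin] TS)
    finally show ?case
      by (simp add: nn_integral_cmult)
  qed
  also have "\<dots> = (\<integral>\<^sup>+x. (\<integral>\<^sup>+y. g y * f (y + T x) \<partial>lborel) \<partial>lborel)"
    by (rule lborel_pair.Fubini') measurable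
  also have "\<dots> = (\<integral>\<^sup>+x. (\<integral>\<^sup>+y. g (y - T x) * f y \<partial>lborel) \<partial>lborel)"
  proof (rule nn_integral_cong, goal_cases)
    case (1 x)
    have "(\<integral>\<^sup>+y. g y * f (y + T x) \<partial>lborel) = (\<integral>\<^sup>+y. (\<lambda>y. g (y - T x) * f y) (T x + y) \<partial>lborel)"
      by (simp add: add.commute)
    also have "\<dots> = (\<integral>\<^sup>+y. g (y - T x) * f y \<partial>lborel)"
      by (rule nn_integral_lborel_shift) measurable
    finally show ?case .
  qed
  also have "\<dots> = (\<integral>\<^sup>+y. (\<integral>\<^sup>+x. g (y - T x) * f y \<partial>lborel) \<partial>lborel)"
    by (rule lborel_pair.Fubini'[symmetric]) measurable
  also have "\<dots> = (\<integral>\<^sup>+y. I * f y \<partial>lborel)"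
  proof (rule nn_integral_cong)
    fix y
    have "(\<integral>\<^sup>+x. g (y - T x) \<partial>lborel) = (\<integral>\<^sup>+x. g (- S y + x) \<partial>lborel)"
    proof (rule nn_integral_cong, goal_cases)
      case (1 x)
      have "norm (y - T x) = norm (T (- S y + x))"
        by (simp add: linear_diff[OF lin] TS norm_minus_commute)
      then show ?case
        using orthogonal_transformation_norm[OF T] by (simp add: g_def)
    qed
    also have "\<dots> = I" unfolding I_def by (rule nn_integral_lborel_shift) measurable
    finally show "(\<integral>\<^sup>+x. g (y - T x) * f y \<partial>lborel) = I * f y" by (simp add: nn_integral_multc)
  qed
  also have "\<dots> = I * (\<integral>\<^sup>+x. f x \<partial>lborel)" by (simp add: nn_integral_cmult)
  finally show ?thesis using I by (simp add: ennreal_mult_cancel_left)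
qed

section \<open>The change of variables from rates to square roots\<close>

definition sqrt_density :: "real \<Rightarrow> real \<Rightarrow> real" where
  "sqrt_density \<gamma> l = indicator {0<..} l * l powr (- 1 / 2) / sqrt \<gamma>"

lemma sqrt_density_nonneg [simp]: "0 < \<gamma> \<Longrightarrow> 0 \<le> sqrt_density \<gamma> l"
  by (simp add: sqrt_density_def)

lemma borel_measurable_sqrt_density [measurable]: "sqrt_density \<gamma> \<in> borel_measurable borel"
  unfolding sqrt_density_def by measurable

text \<open>For \<open>a\<close> at least 0 the value is the length of the set where \<gamma> x^2 <=
  a. The factor 2 counts both square roots, so no constant is lost when a half-line in the rate
  becomes a whole line in \<theta>.\<close>

lemma nn_integral_sqrt_density:
  assumes g: "0 < \<gamma>"
  shows "(\<integral>\<^sup>+l. ennreal (sqrt_density \<gamma> l) * indicator {..a} l \<partial>lborel) = ennreal (2 * sqrt (max 0 a / \<gamma>))"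
proof (cases "a \<le> 0")
  case True
  then have "(\<lambda>l. ennreal (sqrt_density \<gamma> l) * indicator {..a} l) = (\<lambda>_. 0)"
    by (auto simp: sqrt_density_def fun_eq_iff split: split_indicator)
  then show ?thesis using True by simp
next
  case False
  define b where "b = sqrt (a / \<gamma>)"
  let ?f = "\<lambda>l. sqrt_density \<gamma> (\<gamma> * l^2) * (2 * \<gamma> * l)"
  have b: "0 < b" "\<gamma> * b^2 = a" using False g by (auto simp: b_def)
  have "(\<integral>\<^sup>+l. ennreal (sqrt_density \<gamma> l) * indicator {..a} l \<partial>lborel)
      = (\<integral>\<^sup>+l. ennreal (sqrt_density \<gamma> l * indicator {\<gamma> * 0^2..\<gamma> * b^2} l) \<partial>lborel)"
    by (intro nn_integral_cong) (auto simp: b sqrt_density_def split: split_indicator)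
  also have "\<dots> = (\<integral>\<^sup>+l. ennreal (?f l * indicator {0..b} l) \<partial>lborel)"
    using b g by (intro nn_integral_substitution)
      (auto intro!: derivative_eq_intros continuous_intros simp: set_borel_measurable_def)
  also have "\<dots> = (\<integral>\<^sup>+l. 2 * indicator {0<..b} l \<partial>lborel)"
  proof (intro nn_integral_cong)
    fix l :: real
    have "(?f l) = 2" if "0 < l"
    proof -
      have "(\<gamma> * l^2) powr (- 1 / 2) = 1 / (sqrt \<gamma> * l)"
        using that g by (simp add: powr_minus_divide powr_half_sqrt real_sqrt_mult)
      then show ?thesis using that g by (simp add: sqrt_density_def)
    qed
    then have "ennreal (?f l) = 2" if "0 < l"
      using that by (simp only:) simp
    then show "ennreal (?f l * indicator {0..b} l) = 2 * indicator {0<..b} l"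
      by (cases "l = 0") (auto simp del: ennreal_mult split: split_indicator)
  qed
  also have "\<dots> = 2 * ennreal b"
    using b by (subst nn_integral_cmult) auto
  also have "\<dots> = ennreal (2 * b)"
    using b by (simp add: ennreal_mult)
  finally show ?thesis using False by (simp add: b_def)
qed

lemma distr_lborel_square:
  assumes g: "0 < \<gamma>"
  shows "distr lborel borel (\<lambda>x. \<gamma> * x^2) = density lborel (\<lambda>l. ennreal (sqrt_density \<gamma> l))"
proof (rule measure_eqI_generator_eq)
  let ?M = "(distr lborel borel (\<lambda>x. \<gamma> * x^2))"
  let ?sq = "(\<lambda>x. \<gamma> * x^2)"
  let ?N = "(density lborel (\<lambda>l. ennreal (sqrt_density \<gamma> l)))"
  let ?E = "range (\<lambda>a::real. {..a})"
  show "Int_stable ?E" by (auto simp: Int_stable_def)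
  show "?E \<subseteq> Pow UNIV" by auto
  show "sets ?M = sigma_sets UNIV ?E"
    "sets ?N = sigma_sets UNIV ?E"
    by (simp_all add: borel_eq_atMost)
  have e: "emeasure ?M {..a} = ennreal (2 * sqrt (max 0 a / \<gamma>))" for a
  proof -
    have "emeasure ?M {..a} = emeasure lborel (?sq -` {..a})"
      by (subst emeasure_distr) auto
    also have "?sq -` {..a} = (if a < 0 then {} else {- sqrt (a / \<gamma>)..sqrt (a / \<gamma>)})"
    proof -
      have "\<gamma> * x^2 \<le> a \<longleftrightarrow> \<bar>x\<bar> \<le> sqrt (a / \<gamma>)" if "0 \<le> a" for x
      proof -
        have "\<gamma> * x^2 \<le> a \<longleftrightarrow> x^2 \<le> a / \<gamma>" using g by (simp add: field_simps)
        also have "\<dots> \<longleftrightarrow> sqrt (x^2) \<le> sqrt (a / \<gamma>)" by (simp only: real_sqrt_le_iff)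
        finally show ?thesis by simp
      qed
      moreover have "\<not> \<gamma> * x^2 \<le> a" if "a < 0" for x
      proof -
        have "0 \<le> \<gamma> * x^2" using g by simp
        with that show ?thesis by linarith
      qed
      ultimately show ?thesis by (auto simp: abs_le_iff)
    qed
    also have "emeasure lborel \<dots> = ennreal (2 * sqrt (max 0 a / \<gamma>))"
      using g by (auto simp: max_def)
    finally show ?thesis .
  qed
  show "emeasure ?M X = emeasure ?N X"
    if "X \<in> ?E" for X
  proof -
    from that obtain a where X: "X = {..a}" by auto
    show ?thesis unfolding X e
      by (subst emeasure_density) (auto simp: nn_integral_sqrt_density[OF g])
  qed
  show "range (\<lambda>n. {..real n}) \<subseteq> ?E" by auto
  show "(\<Union>n. {..real n}) = UNIV" using real_arch_simple by auto
  show "emeasure ?M {..real n} \<noteq> \<infinity>" for n by (simp add: e)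
qed

text \<open>Coordinatewise squaring sends Lebesgue measure to a product of measures with density
  \<open>sqrt_density\<close>, a multiple of the Jeffreys prior. The density and the image measure
  are both identified with \<open>PiM UNIV N\<close> by their values on product sets.\<close>

lemma nn_integral_square_subst:
  fixes \<gamma> :: "'d::finite \<Rightarrow> real" and F :: "real ^ 'd \<Rightarrow> ennreal"
  assumes g: "\<And>i. 0 < \<gamma> i" and [measurable]: "F \<in> borel_measurable borel"
  shows "(\<integral>\<^sup>+l. F l * (\<Prod>i\<in>UNIV. ennreal (sqrt_density (\<gamma> i) (l $ i))) \<partial>lborel) = (\<integral>\<^sup>+x. F (\<chi> i. \<gamma> i * (x $ i)^2) \<partial>lborel)"
proof -
  let ?P = "\<Pi>\<^sub>M i\<in>(UNIV :: 'd set). (lborel :: real measure)"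
  define N where "N i = density lborel (\<lambda>l. ennreal (sqrt_density (\<gamma> i) l))" for i
  let ?sq = "(\<lambda>x i. \<gamma> i * (x i)^2)"
  let ?Di = "(\<lambda>x. \<Prod>i\<in>UNIV. ennreal (sqrt_density (\<gamma> i) (x i)))"
  let ?sqi = "\<lambda>i. (\<lambda>x. \<gamma> i * x^2)"
  let ?E = "\<lambda>A. (\<Prod>i\<in>UNIV. emeasure (N i) (A i))"
  let ?D = "\<lambda>x. (\<Prod>i\<in>UNIV. ennreal (sqrt_density (\<gamma> i) (x i)))"
  interpret L: product_sigma_finite "\<lambda>_::'d. lborel :: real measure" by standard
  have sets_N [measurable_cong]: "sets (N i) = sets borel" for i by (simp add: N_def)
  interpret N: product_sigma_finite N
  proof (rule product_sigma_finite.intro)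
    show "sigma_finite_measure (N i)" for i
      unfolding N_def by (subst sigma_finite_measure.sigma_finite_iff_density_finite'[OF sigma_finite_lborel]) auto
  qed
  have sP: "sets ?P = sets (PiM UNIV N)" "sets ?P = sets (\<Pi>\<^sub>M i\<in>(UNIV :: 'd set). (borel :: real measure))"
    by (intro sets_PiM_cong; simp add: sets_N)+
  have vl[measurable]: "vec_lambda \<in> ?P \<rightarrow>\<^sub>M borel"
    using measurable_cong_sets[OF sP(2) refl] measurable_vec_lambda by blast
  have comp[measurable]: "(\<lambda>x. x i) \<in> ?P \<rightarrow>\<^sub>M borel" for i
    using measurable_component_singleton[of i UNIV "\<lambda>_. lborel :: real measure"] by simp
  have sq[measurable]: "?sq \<in> ?P \<rightarrow>\<^sub>M ?P"
    by (rule measurable_PiM_single') (auto simp: space_PiM)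
  have 1: "density ?P ?Di = PiM UNIV N"
  proof (rule N.PiM_eqI)
    fix A :: "'d \<Rightarrow> real set" assume A: "\<And>i. i \<in> UNIV \<Longrightarrow> A i \<in> sets (N i)"
    then have A': "A i \<in> sets borel" for i by (simp add: sets_N)
    then have AP: "Pi\<^sub>E UNIV A \<in> sets ?P" by (intro sets_PiM_I_finite) auto
    have ind: "indicator (Pi\<^sub>E UNIV A) x = (\<Prod>i\<in>UNIV. indicator (A i) (x i) :: ennreal)" for x
    proof (cases "\<forall>i. x i \<in> A i")
      case False
      then obtain i where "x i \<notin> A i" by auto
      then have "indicator (A i) (x i) = (0 :: ennreal)" by simp
      then have "(\<Prod>i\<in>UNIV. indicator (A i) (x i) :: ennreal) = 0"
        by (intro prod_zero) auto
      with False show ?thesis by (auto simp: indicator_def)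
    qed (auto simp: indicator_def)
    have "emeasure (density ?P ?Di) (Pi\<^sub>E UNIV A)
        = (\<integral>\<^sup>+x. (?D x) * indicator (Pi\<^sub>E UNIV A) x \<partial>?P)"
      by (rule emeasure_density[OF _ AP]) measurable
    also have "\<dots> = (\<integral>\<^sup>+x. (\<Prod>i\<in>UNIV. ennreal (sqrt_density (\<gamma> i) (x i)) * indicator (A i) (x i)) \<partial>?P)"
      by (simp only: ind prod.distrib)
    also have "\<dots> = (\<Prod>i\<in>UNIV. \<integral>\<^sup>+x. ennreal (sqrt_density (\<gamma> i) x) * indicator (A i) x \<partial>lborel)"
      using A' by (intro L.product_nn_integral_prod) auto
    also have "\<dots> = (?E A)"
      using A' by (intro prod.cong refl) (simp add: N_def emeasure_density)
    finally show "emeasure (density ?P ?Di) (Pi\<^sub>E UNIV A) = (?E A)" .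
  qed (simp_all add: sP(1))
  have 2: "distr ?P ?P ?sq = PiM UNIV N"
  proof (rule N.PiM_eqI)
    fix A :: "'d \<Rightarrow> real set" assume A: "\<And>i. i \<in> UNIV \<Longrightarrow> A i \<in> sets (N i)"
    then have A': "A i \<in> sets borel" for i by (simp add: sets_N)
    then have AP: "Pi\<^sub>E UNIV A \<in> sets ?P" by (intro sets_PiM_I_finite) auto
    have pre: "(?sqi i) -` A i \<in> sets borel" for i
      using measurable_sets[of "\<lambda>x. \<gamma> i * x^2" borel borel "A i"] A' by simp
    have "emeasure (distr ?P ?P ?sq) (Pi\<^sub>E UNIV A)
        = emeasure ?P (Pi\<^sub>E UNIV (\<lambda>i. (?sqi i) -` A i))"
      using AP by (subst emeasure_distr[OF sq]) (auto intro!: arg_cong[where f="emeasure ?P"] simp: space_PiM PiE_def Pi_def)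
    also have "\<dots> = (\<Prod>i\<in>UNIV. emeasure lborel (?sqi i -` A i))"
      using pre by (intro L.emeasure_PiM) auto
    also have "\<dots> = (?E A)"
    proof (intro prod.cong refl)
      fix i
      have "emeasure (N i) (A i) = emeasure (distr lborel borel (?sqi i)) (A i)"
        by (simp only: N_def distr_lborel_square[OF g])
      also have "\<dots> = emeasure lborel (?sqi i -` A i)"
        using A' by (subst emeasure_distr) auto
      finally show "emeasure lborel (?sqi i -` A i) = emeasure (N i) (A i)" by simp
    qed
    finally show "emeasure (distr ?P ?P ?sq) (Pi\<^sub>E UNIV A) = (?E A)" .
  qed (simp_all add: sP(1))
  have "(\<integral>\<^sup>+l. F l * (\<Prod>i\<in>UNIV. ennreal (sqrt_density (\<gamma> i) (l $ i))) \<partial>lborel)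
      = (\<integral>\<^sup>+x. F (vec_lambda x) * (?D x) \<partial>?P)"
    unfolding lborel_vec_eq
    by (subst nn_integral_distr[OF vl]) (simp_all, measurable)
  also have "\<dots> = (\<integral>\<^sup>+x. F (vec_lambda x) \<partial>density ?P ?Di)"
    by (subst nn_integral_density) (measurable, simp add: mult.commute)
  also have "\<dots> = (\<integral>\<^sup>+x. F (vec_lambda x) \<partial>distr ?P ?P ?sq)"
    by (simp only: 1 2)
  also have "\<dots> = (\<integral>\<^sup>+x. F (\<chi> i. \<gamma> i * (x i)^2) \<partial>?P)"
    by (subst nn_integral_distr) measurable
  also have "\<dots> = (\<integral>\<^sup>+x. F (\<chi> i. \<gamma> i * (x $ i)^2) \<partial>lborel)"
    unfolding lborel_vec_eq by (subst nn_integral_distr[OF vl]) (simp_all, measurable)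
  finally show ?thesis .
qed

section \<open>Gaussian averages of powers of the distance to a subspace\<close>

lemma infdist_subspace_decomp:
  fixes V :: "'a::euclidean_space set"
  assumes V: "subspace V" and v: "v \<in> V" and w: "\<And>x. x \<in> V \<Longrightarrow> orthogonal x w"
  shows "infdist (v + w) V = norm w"
proof (rule antisym)
  have ne: "V \<noteq> {}" using v by auto
  have "infdist (v + w) V \<le> dist (v + w) v" using v by (rule infdist_le)
  then show "infdist (v + w) V \<le> norm w" by (simp add: dist_norm)
  show "norm w \<le> infdist (v + w) V"
    unfolding infdist_notempty[OF ne]
  proof (rule cINF_greatest[OF ne])
    fix x assume x: "x \<in> V"
    have "orthogonal (v - x) w" using V v x w by (simp add: subspace_diff)
    then have "(norm ((v - x) + w))^2 = (norm (v - x))^2 + (norm w)^2"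
      by (rule norm_add_Pythagorean)
    then have "(norm w)^2 \<le> (norm ((v - x) + w))^2" by simp
    then have "norm w \<le> norm ((v - x) + w)" by (rule power2_le_imp_le) simp
    then show "norm w \<le> dist (v + w) x" by (simp add: dist_norm algebra_simps)
  qed
qed

text \<open>A coordinate subspace of dimension k is mapped isometrically onto V, and the
  complementary one onto the orthogonal complement of V. Glued together the two maps form a rotation
  \<open>T\<close>, after which only the coordinates in \<open>S\<close> are seen by the
  distance.\<close>

lemma sq_dist_coordinates:
  fixes V :: "(real ^ 'd) set"
  assumes V: "subspace V" and k: "dim V = k"
  obtains T and S :: "'d set" where "orthogonal_transformation T" "card S = CARD('d) - k"
    "\<And>x. sq_dist V (T x) = (\<Sum>i\<in>S. (x $ i)^2)"
proof -
  have kd: "k \<le> CARD('d)" using dim_subset_UNIV_cart[of V] k by simp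
  obtain S :: "'d set" where S: "card S = CARD('d) - k"
    by (metis (no_types) diff_le_self obtain_subset_with_card_n)
  define A where "A = {x :: real ^ 'd. \<forall>i. i \<notin> - S \<longrightarrow> x $ i = 0}"
  define C where "C = {x :: real ^ 'd. \<forall>i. i \<notin> S \<longrightarrow> x $ i = 0}"
  define W where "W = {y \<in> (UNIV :: (real ^ 'd) set). \<forall>x\<in>V. orthogonal x y}"
  have W: "subspace W" unfolding W_def using subspace_orthogonal_to_vectors[of V] by simp
  have A: "subspace A" "subspace C"
    by (auto simp: A_def C_def subspace_def)
  have "dim A = card (- S)" "dim C = card S"
    unfolding A_def C_def dim_vec_eq[symmetric] by (rule dim_substandard_cart)+
  moreover have "card (- S) = k" using S kd by (simp add: Compl_eq_Diff_UNIV card_Diff_subset)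
  moreover have "dim W + dim V = dim (UNIV :: (real ^ 'd) set)"
    unfolding W_def by (rule dim_subspace_orthogonal_to_vectors) (auto simp: V)
  ultimately have dims: "dim A = dim V" "dim C = dim W" using k S by simp_all
  obtain f where f: "linear f" "f ` A = V" "\<And>x. x \<in> A \<Longrightarrow> norm (f x) = norm x"
    using isometry_subspaces[OF A(1) V dims(1)] by metis
  obtain g where g: "linear g" "g ` C = W" "\<And>x. x \<in> C \<Longrightarrow> norm (g x) = norm x"
    using isometry_subspaces[OF A(2) W dims(2)] by metis
  define a :: "real ^ 'd \<Rightarrow> real ^ 'd" where "a x = (\<chi> i. if i \<in> S then 0 else x $ i)" for x
  define c :: "real ^ 'd \<Rightarrow> real ^ 'd" where "c x = (\<chi> i. if i \<in> S then x $ i else 0)" for x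
  have ac: "a x \<in> A" "c x \<in> C" for x by (auto simp: a_def c_def A_def C_def)
  have lin: "linear a" "linear c"
    by (rule linearI; simp add: a_def c_def vec_eq_iff)+
  define T where "T x = f (a x) + g (c x)" for x
  have "linear T"
    unfolding T_def using f(1) g(1) lin linear_compose[of a f] linear_compose[of c g]
    by (intro linear_compose_add) (simp_all add: o_def)
  have fg: "f (a x) \<in> V" "g (c x) \<in> W" for x using f g ac by blast+
  have orth: "orthogonal v (g (c x))" if "v \<in> V" for v x
    using fg(2)[of x] that by (simp add: W_def)
  have "norm (T x) = norm x" for x
  proof -
    have "(norm (T x))^2 = (norm (f (a x)))^2 + (norm (g (c x)))^2"
      unfolding T_def by (rule norm_add_Pythagorean) (rule orth[OF fg(1)])
    also have "\<dots> = (norm (a x))^2 + (norm (c x))^2" using f g ac by simp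
    also have "\<dots> = (norm (a x + c x))^2"
      by (rule norm_add_Pythagorean[symmetric]) (auto simp: orthogonal_def inner_vec_def a_def c_def intro!: sum.neutral)
    also have "a x + c x = x" by (simp add: a_def c_def vec_eq_iff)
    finally show ?thesis by simp
  qed
  with \<open>linear T\<close> have "orthogonal_transformation T" by (simp add: orthogonal_transformation)
  moreover have "sq_dist V (T x) = (\<Sum>i\<in>S. (x $ i)^2)" for x
  proof -
    have "sq_dist V (T x) = (norm (g (c x)))^2"
      unfolding sq_dist_def T_def by (subst infdist_subspace_decomp[OF V fg(1) orth]) auto
    also have "\<dots> = (norm (c x))^2" using g ac by simp
    also have "\<dots> = (\<Sum>i\<in>UNIV. if i \<in> S then (x $ i)^2 else 0)"
      unfolding norm_vec_power2 by (intro sum.cong) (auto simp: c_def)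
    also have "\<dots> = (\<Sum>i\<in>S. (x $ i)^2)" by (simp add: sum.If_cases)
    finally show ?thesis .
  qed
  ultimately show ?thesis using S that by blast
qed

lemma sq_dist_scaleR:
  fixes V :: "(real ^ 'd) set"
  assumes "subspace V"
  shows "sq_dist V (c *\<^sub>R \<theta>) = c^2 * sq_dist V \<theta>"
proof -
  obtain T and S :: "'d set" where T: "orthogonal_transformation T"
    and sq: "\<And>x. sq_dist V (T x) = (\<Sum>i\<in>S. (x $ i)^2)"
    using sq_dist_coordinates[OF assms refl] by metis
  obtain t where t: "\<theta> = T t" using orthogonal_transformation_surj[OF T] by (metis surjD)
  have "c *\<^sub>R \<theta> = T (c *\<^sub>R t)" by (simp add: t orthogonal_transformation_scaleR[OF T])
  then show ?thesis by (simp add: t sq power_mult_distrib sum_distrib_left)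
qed

lemma sq_dist_nonneg [simp]: "0 \<le> sq_dist V x"
  by (simp add: sq_dist_def)

lemma borel_measurable_sq_dist [measurable]: "sq_dist V \<in> borel_measurable borel"
  unfolding sq_dist_def[abs_def]
  by (intro borel_measurable_continuous_onI continuous_intros)

lemma nn_integral_exp_two_squares:
  assumes c: "0 < c" and p: "0 \<le> p"
  shows "(\<integral>\<^sup>+x. ennreal (exp (- c * x^2 - p * (t - x)^2)) \<partial>lborel) = ennreal (sqrt (pi / (c + p)) * exp (- (c * p / (c + p)) * t^2))"
proof -
  let ?e = "exp (- (c * p / (c + p)) * t^2)"
  let ?d = "\<lambda>x. exp (- (c + p) * (- (p * t / (c + p)) + x)^2)"
  let ?f = "\<lambda>x. exp (- c * x^2 - p * (t - x)^2)"
  have cp: "0 < c + p" using c p by simp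
  have "- c * x^2 - p * (t - x)^2 = - (c * p / (c + p)) * t^2 + (- (c + p) * (- (p * t / (c + p)) + x)^2)" for x
    using cp by (simp add: divide_simps) (simp add: power2_eq_square algebra_simps)
  then have "ennreal (?f x) = ennreal ?e * ennreal (?d x)" for x
    by (simp only: exp_add) (rule ennreal_mult', simp)
  then have "(\<integral>\<^sup>+x. ennreal (?f x) \<partial>lborel)
    = ennreal ?e * (\<integral>\<^sup>+x. ennreal (?d x) \<partial>lborel)"
    by (simp only:) (rule nn_integral_cmult, measurable)
  also have "(\<integral>\<^sup>+x. ennreal (?d x) \<partial>lborel) = (\<integral>\<^sup>+x. ennreal (exp (- (c + p) * x^2)) \<partial>lborel)"
    by (rule nn_integral_lborel_shift[of "\<lambda>x. ennreal (exp (- (c + p) * x^2))"]) measurable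
  also have "\<dots> = ennreal (sqrt (pi / (c + p)))" by (rule nn_integral_exp_square[OF cp])
  finally show ?thesis using cp by (simp add: ennreal_mult'[symmetric] mult.commute)
qed

text \<open>After the rotation the integral factorises, and each of the \<open>CARD('d) - k\<close>
  coordinates transverse to V contributes \<open>sqrt (c / (c + p))\<close>. This power is where the
  codimension of V enters.\<close>

lemma nn_integral_exp_sq_dist:
  fixes V :: "(real ^ 'd) set"
  assumes V: "subspace V" and k: "dim V = k" and c: "0 < c" and p: "0 \<le> p"
  shows "(\<integral>\<^sup>+x. ennreal (exp (- c * (norm x)^2 - p * sq_dist V (\<theta> - x))) \<partial>lborel)
     = ennreal (sqrt (pi / c) ^ CARD('d) * sqrt (c / (c + p)) ^ (CARD('d) - k) * exp (- (c * p / (c + p)) * sq_dist V \<theta>))"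
proof -
  obtain T and S :: "'d set" where T: "orthogonal_transformation T" and S: "card S = CARD('d) - k"
    and sq: "\<And>x. sq_dist V (T x) = (\<Sum>i\<in>S. (x $ i)^2)"
    using sq_dist_coordinates[OF V k] by metis
  have lin: "linear T" using T by (rule orthogonal_transformation_linear)
  obtain t where t: "\<theta> = T t" using orthogonal_transformation_surj[OF T] by (metis surjD)
  \<comment> \<open>Weight 0 along V lets one product formula cover both kinds of
    coordinates.\<close>
  define P where "P i = (if i \<in> S then p else 0)" for i
  let ?e = "\<lambda>x i. exp (- c * (x $ i)^2 - P i * (t $ i - x $ i)^2)"
  let ?g = "\<lambda>i. - (c * P i / (c + P i)) * (t $ i)^2"
  let ?k = "\<lambda>x. exp (- c * (norm (T x))^2 - p * sq_dist V (\<theta> - T x))"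
  have PS: "p * (\<Sum>i\<in>S. f i) = (\<Sum>i\<in>UNIV. P i * f i)" for f :: "'d \<Rightarrow> real"
    by (simp add: P_def sum_distrib_left if_distrib[of "\<lambda>x. x * _"] sum.If_cases cong: if_cong)
  have P0: "0 \<le> P i" for i using p by (simp add: P_def)
  have "(\<integral>\<^sup>+x. ennreal (exp (- c * (norm x)^2 - p * sq_dist V (\<theta> - x))) \<partial>lborel)
     = (\<integral>\<^sup>+x. ennreal (?k x) \<partial>lborel)"
    by (rule nn_integral_lborel_orthogonal[OF T, symmetric]) measurable
  also have "\<dots> = (\<integral>\<^sup>+x. (\<Prod>i\<in>UNIV. ennreal (?e x i)) \<partial>lborel)"
  proof (rule nn_integral_cong, goal_cases)
    case (1 x)
    have "sq_dist V (\<theta> - T x) = (\<Sum>i\<in>S. (t $ i - x $ i)^2)"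
      using sq[of "t - x"] by (simp add: t linear_diff[OF lin])
    then have "- c * (norm (T x))^2 - p * sq_dist V (\<theta> - T x) = (\<Sum>i\<in>UNIV. - c * (x $ i)^2 - P i * (t $ i - x $ i)^2)"
      unfolding orthogonal_transformation_norm[OF T] norm_vec_power2 PS[of "\<lambda>i. (t $ i - x $ i)^2", symmetric]
      by (simp add: sum_subtractf sum_negf sum_distrib_left PS[symmetric])
    then show ?case
      by (simp only: exp_sum finite_code prod_ennreal exp_ge_zero)
  qed
  also have "\<dots> = (\<Prod>i\<in>UNIV. ennreal (sqrt (pi / (c + P i)) * exp (?g i)))"
    by (subst nn_integral_lborel_vec_prod[of "\<lambda>i x. ennreal (exp (- c * x^2 - P i * (t $ i - x)^2))"])
       (measurable, simp only: nn_integral_exp_two_squares[OF c P0])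
  also have "\<dots> = ennreal ((\<Prod>i\<in>UNIV. sqrt (pi / (c + P i))) * (\<Prod>i\<in>UNIV. exp (?g i)))"
    using c P0 by (subst prod_ennreal) (simp_all add: prod.distrib add_nonneg_nonneg less_imp_le)
  also have "(\<Prod>i\<in>UNIV. exp (?g i)) = exp (\<Sum>i\<in>UNIV. (?g i))"
    by (simp add: exp_sum)
  also have "(\<Sum>i\<in>UNIV. (?g i)) = (\<Sum>i\<in>UNIV. if i \<in> S then - (c * p / (c + p)) * (t $ i)^2 else 0)"
    by (intro sum.cong) (auto simp: P_def)
  also have "\<dots> = - (c * p / (c + p)) * sq_dist V \<theta>"
    by (simp add: t sq sum.If_cases sum_distrib_left)
  also have "(\<Prod>i\<in>UNIV. sqrt (pi / (c + P i))) = (\<Prod>i\<in>UNIV. sqrt (pi / c) * (if i \<in> S then sqrt (c / (c + p)) else 1))"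
    using c by (intro prod.cong) (auto simp: P_def real_sqrt_mult[symmetric])
  also have "\<dots> = sqrt (pi / c) ^ CARD('d) * sqrt (c / (c + p)) ^ (CARD('d) - k)"
    by (simp add: prod.distrib prod.If_cases S)
  finally show ?thesis .
qed

section \<open>Negative powers of the squared distance as Gamma integrals\<close>

lemma nn_integral_Gamma_powr:
  assumes a: "0 < \<alpha>" and s: "0 < s"
  shows "(\<integral>\<^sup>+p. ennreal (indicator {0..} p * p powr (\<alpha> - 1) * exp (- p * s)) \<partial>lborel) = ennreal (Gamma \<alpha> * s powr (- \<alpha>))"
proof -
  let ?f = "\<lambda>t. ennreal (indicator {0..} t * t powr (\<alpha> - 1) / exp t)"
  let ?g = "\<lambda>p. ennreal (indicator {0..} p * p powr (\<alpha> - 1) * exp (- p * s))"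
  have e: "ennreal (s powr \<alpha>) * (?g p) = ennreal s * ?f (0 + s * p)" for p
  proof (cases "0 \<le> p")
    case True
    have "s powr \<alpha> * (p powr (\<alpha> - 1) * exp (- p * s)) = s * ((s * p) powr (\<alpha> - 1) / exp (s * p))"
    proof (cases "p = 0")
      case False
      have "s powr \<alpha> = s * s powr (\<alpha> - 1)" using s by (simp add: powr_diff)
      then show ?thesis using True s False by (simp add: powr_mult exp_minus field_simps)
    qed simp
    then show ?thesis using True s by (simp add: ennreal_mult'[symmetric] mult.assoc)
  qed (use s in \<open>auto simp: zero_le_mult_iff\<close>)
  have "ennreal (Gamma \<alpha>) = (\<integral>\<^sup>+t. ?f t \<partial>lborel)"
    by (rule Gamma_conv_nn_integral_real[OF a])
  also have "\<dots> = ennreal \<bar>s\<bar> * (\<integral>\<^sup>+p. ?f (0 + s * p) \<partial>lborel)"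
    using s by (intro nn_integral_real_affine) auto
  also have "\<dots> = ennreal (s powr \<alpha>) * (\<integral>\<^sup>+p. ?g p \<partial>lborel)"
  proof -
    have "ennreal s * (\<integral>\<^sup>+p. ?f (0 + s * p) \<partial>lborel) = (\<integral>\<^sup>+p. ennreal s * ?f (0 + s * p) \<partial>lborel)"
      by (rule nn_integral_cmult[symmetric]) measurable
    also have "\<dots> = (\<integral>\<^sup>+p. ennreal (s powr \<alpha>) * (?g p) \<partial>lborel)"
      by (simp only: e)
    also have "\<dots> = ennreal (s powr \<alpha>) * (\<integral>\<^sup>+p. ?g p \<partial>lborel)"
      by (rule nn_integral_cmult) measurable
    finally show ?thesis using s by simp
  qed
  finally have "ennreal (s powr (- \<alpha>)) * ennreal (Gamma \<alpha>) = ennreal (s powr (- \<alpha>)) * ennreal (s powr \<alpha>) * (\<integral>\<^sup>+p. ?g p \<partial>lborel)"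
    by (simp add: mult.assoc)
  also have "ennreal (s powr (- \<alpha>)) * ennreal (s powr \<alpha>) = 1"
    using s by (simp add: ennreal_mult'[symmetric] powr_add[symmetric])
  finally show ?thesis using a Gamma_real_pos[of \<alpha>] by (simp add: ennreal_mult'[symmetric] mult.commute)
qed

abbreviation trunc_Gamma :: "real \<Rightarrow> real \<Rightarrow> real \<Rightarrow> ennreal" where
  "trunc_Gamma \<alpha> c s \<equiv> \<integral>\<^sup>+q. ennreal (indicator {0..c} q * q powr (\<alpha> - 1) * exp (- q * s)) \<partial>lborel"

lemma nn_integral_truncated_Gamma_finite:
  assumes a: "0 < \<alpha>" and s: "0 \<le> s" and c: "0 \<le> c"
  shows "trunc_Gamma \<alpha> c s < \<infinity>"
proof -
  have "trunc_Gamma \<alpha> c s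
     \<le> (\<integral>\<^sup>+q. ennreal (exp c) * ennreal (indicator {0..} q * q powr (\<alpha> - 1) * exp (- q * 1)) \<partial>lborel)"
  proof (rule nn_integral_mono, goal_cases)
    case (1 q)
    have "exp (- q * s) \<le> exp c * exp (- q)" if "0 \<le> q" "q \<le> c"
    proof -
      have "exp (- q * s) \<le> 1" using that s by simp
      also have "1 \<le> exp (c - q)" using that by simp
      finally show ?thesis by (simp add: exp_diff exp_minus field_simps)
    qed
    then have "q powr (\<alpha> - 1) * exp (- q * s) \<le> q powr (\<alpha> - 1) * (exp c * exp (- q))" if "0 \<le> q" "q \<le> c"
      using that by (intro mult_left_mono) auto
    then have "indicator {0..c} q * q powr (\<alpha> - 1) * exp (- q * s) \<le> exp c * (indicator {0..} q * q powr (\<alpha> - 1) * exp (- q * 1))"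
      by (auto split: split_indicator simp: mult_ac)
    then show ?case
      by (simp add: ennreal_mult'[symmetric] ennreal_leI)
  qed
  also have "\<dots> = ennreal (exp c) * ennreal (Gamma \<alpha> * 1 powr (- \<alpha>))"
    by (subst nn_integral_cmult, measurable, subst nn_integral_Gamma_powr[OF a]) auto
  also have "\<dots> < \<infinity>" by (simp add: ennreal_mult_less_top)
  finally show ?thesis .
qed

text \<open>Strict because the full integrand is positive on \<open>{c<..<2 * c}\<close>, an
  interval of positive length beyond the truncation. All strictness in the domination result
  originates here.\<close>

lemma nn_integral_truncated_Gamma_less:
  assumes a: "0 < \<alpha>" and s: "0 < s" and c: "0 < c"
  shows "trunc_Gamma \<alpha> c s < ennreal (Gamma \<alpha> * s powr (- \<alpha>))"
  unfolding nn_integral_Gamma_powr[OF a s, symmetric]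
proof (rule nn_integral_less)
  let ?f = "\<lambda>q. indicator {0..c} q * q powr (\<alpha> - 1) * exp (- q * s)"
  let ?g = "\<lambda>q. indicator {0..} q * q powr (\<alpha> - 1) * exp (- q * s)"
  show "(\<integral>\<^sup>+q. ennreal (?f q) \<partial>lborel) \<noteq> \<infinity>"
    using nn_integral_truncated_Gamma_finite[OF a, of s c] s c by simp
  show "AE q in lborel. ennreal (?f q) \<le> ennreal (?g q)"
    by (auto split: split_indicator)
  show "\<not> (AE q in lborel. ennreal (?g q) \<le> ennreal (?f q))"
  proof
    assume "AE q in lborel. ennreal (?g q) \<le> ennreal (?f q)"
    then have "AE q in lborel. q \<notin> {c<..<2 * c}"
    proof (rule AE_mp, intro AE_I2 impI notI)
      fix q assume *: "ennreal (?g q) \<le> ennreal (?f q)" and q: "q \<in> {c<..<2 * c}"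
      then have "?g q \<le> 0" using c by (auto simp: ennreal_eq_0_iff)
      moreover have "?g q > 0" using q c by auto
      ultimately show False by simp
    qed
    then have "emeasure lborel {c<..<2 * c} = 0"
      by (subst (asm) AE_iff_measurable[of "{c<..<2 * c}"]) auto
    then show False using c by simp
  qed
qed auto

text \<open>Monotone convergence: a substitution performed on compact intervals, with a bound
  uniform in \<open>n\<close>, carries over to the half-line.\<close>

lemma nn_integral_Icc_limit_le:
  assumes [measurable]: "f \<in> borel_measurable borel"
    and le: "\<And>n::nat. (\<integral>\<^sup>+x. f x * indicator {0..real n} x \<partial>lborel) \<le> C"
  shows "(\<integral>\<^sup>+x. f x * indicator {0..} x \<partial>lborel) \<le> C"
proof -
  have "(\<integral>\<^sup>+x. f x * indicator {0..} x \<partial>lborel) = (\<integral>\<^sup>+x. (SUP n. f x * indicator {0..real n} x) \<partial>lborel)"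
  proof (rule nn_integral_cong, goal_cases)
    case (1 x)
    show ?case
    proof (cases "0 \<le> x")
      case True
      obtain n where n: "x \<le> real n" using real_arch_simple by blast
      have "f x \<le> (SUP n. f x * indicator {0..real n} x)"
        by (rule SUP_upper2[of n]) (use n True in auto)
      moreover have "(SUP n. f x * indicator {0..real n} x) \<le> f x"
        by (rule SUP_least) (auto split: split_indicator)
      ultimately show ?thesis using True by simp
    qed simp
  qed
  also have "\<dots> = (SUP n. \<integral>\<^sup>+x. f x * indicator {0..real n} x \<partial>lborel)"
    by (rule nn_integral_monotone_convergence_SUP)
       (auto simp: incseq_def le_fun_def split: split_indicator)
  also have "\<dots> \<le> C" by (intro SUP_least le)
  finally show ?thesis .
qed

text \<open>The substitution \<open>q = c p / (c + p)\<close>.\<close>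

lemma nn_integral_resolvent_subst:
  assumes c: "0 < c"
  shows "(\<integral>\<^sup>+p. ennreal (p powr (\<alpha> - 1) * (c / (c + p)) powr (\<alpha> + 1) * exp (- (c * p / (c + p)) * s)) * indicator {0..} p \<partial>lborel)
    \<le> trunc_Gamma \<alpha> c s"
proof (rule nn_integral_Icc_limit_le)
  let ?F = "\<lambda>p. ennreal (p powr (\<alpha> - 1) * (c / (c + p)) powr (\<alpha> + 1) * exp (- (c * p / (c + p)) * s))"
  fix n :: nat
  let ?g = "\<lambda>p. c * p / (c + p)"
  let ?f = "\<lambda>q. q powr (\<alpha> - 1) * exp (- q * s)"
  have "(\<integral>\<^sup>+p. ?F p * indicator {0..real n} p \<partial>lborel)
      = (\<integral>\<^sup>+p. ennreal (?f (?g p) * (c / (c + p))^2 * indicator {0..real n} p) \<partial>lborel)"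
  proof (rule nn_integral_cong, goal_cases)
    case (1 p)
    show ?case
    proof (cases "0 \<le> p")
      case True
      then have cp: "0 < c / (c + p)" using c by simp
      have "(?g p) powr (\<alpha> - 1) = p powr (\<alpha> - 1) * (c / (c + p)) powr (\<alpha> - 1)"
      proof -
        have "?g p = p * (c / (c + p))" by simp
        then show ?thesis using True cp by (simp only: powr_mult less_imp_le)
      qed
      moreover have "(c / (c + p)) powr (\<alpha> - 1) * (c / (c + p))^2 = (c / (c + p)) powr (\<alpha> + 1)"
      proof -
        have "(c / (c + p))^2 = (c / (c + p)) powr 2" using cp by (rule powr_numeral[symmetric, OF less_imp_le])
        then show ?thesis by (simp only: powr_add[symmetric]) (simp add: add.commute)
      qed
      ultimately have "p powr (\<alpha> - 1) * (c / (c + p)) powr (\<alpha> + 1) * exp (- (c * p / (c + p)) * s) = ?f (?g p) * (c / (c + p))^2"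
        by (simp add: mult_ac)
      then show ?thesis by (auto split: split_indicator)
    qed auto
  qed
  also have "\<dots> = (\<integral>\<^sup>+q. ennreal (?f q * indicator {?g 0..?g (real n)} q) \<partial>lborel)"
  proof (rule nn_integral_substitution[symmetric])
    fix p :: real assume p: "p \<in> {0..real n}"
    then have "c + p \<noteq> 0" using c by auto
    then show "(?g has_real_derivative (c / (c + p))^2) (at p)"
      using c by (auto intro!: derivative_eq_intros simp: power2_eq_square field_simps)
  next
    show "continuous_on {0..real n} (\<lambda>p. (c / (c + p))^2)"
      using c by (intro continuous_intros) auto
  qed (auto simp: set_borel_measurable_def)
  also have "\<dots> \<le> trunc_Gamma \<alpha> c s"
  proof (intro nn_integral_mono ennreal_leI)
    fix q :: real
    have "?g (real n) \<le> c" using c by (simp add: divide_le_eq algebra_simps)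
    then show "?f q * indicator {?g 0..?g (real n)} q \<le> indicator {0..c} q * q powr (\<alpha> - 1) * exp (- q * s)"
      by (auto split: split_indicator)
  qed
  finally show "(\<integral>\<^sup>+p. ?F p * indicator {0..real n} p \<partial>lborel)
    \<le> trunc_Gamma \<alpha> c s" .
qed measurable

abbreviation gauss_integral :: "(real ^ 'd) set \<Rightarrow> real \<Rightarrow> real \<Rightarrow> real ^ 'd \<Rightarrow> ennreal" where
  "gauss_integral V \<alpha> c \<theta> \<equiv> \<integral>\<^sup>+x. ennreal (exp (- c * (norm x)^2) * sq_dist V (\<theta> - x) powr (- \<alpha>)) \<partial>lborel"

locale shrinkage_setup =
  fixes V :: "(real ^ 'd) set" and k :: nat and \<alpha> :: real
  assumes V: "subspace V" and k: "dim V = k"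
    and \<alpha>: "0 < \<alpha>" "\<alpha> \<le> (real CARD('d) - real k - 2) / 2"
begin

lemma k_less: "dim V < CARD('d)"
  using \<alpha> k by simp

text \<open>The Gamma representation, Fubini and \<open>nn_integral_exp_sq_dist\<close> yield an
  integral over p with the power (d - k) / 2 of c / (c + p). Replacing this exponent by \<alpha> + 1
  leaves precisely the integrand that q = c p / (c + p) maps to a Gamma integrand, on a range
  bounded by \<open>c\<close>.\<close>

lemma heat_sq_dist_powr_le:
  assumes c: "0 < c"
  shows "ennreal (Gamma \<alpha>) * gauss_integral V \<alpha> c \<theta>
     \<le> ennreal (sqrt (pi / c) ^ CARD('d)) * trunc_Gamma \<alpha> c (sq_dist V \<theta>)"
proof -
  let ?K = "sqrt (pi / c) ^ CARD('d)"
  let ?n = "CARD('d) - k"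
  let ?f = "\<lambda>p x. ennreal (indicator {0..} p * p powr (\<alpha> - 1) * exp (- c * (norm x)^2 - p * sq_dist V (\<theta> - x)))"
  let ?g = "\<lambda>p. ennreal (p powr (\<alpha> - 1) * sqrt (c / (c + p)) ^ ?n * exp (- (c * p / (c + p)) * sq_dist V \<theta>))"
  let ?j = "\<lambda>p. ennreal (p powr (\<alpha> - 1) * (c / (c + p)) powr (\<alpha> + 1) * exp (- (c * p / (c + p)) * sq_dist V \<theta>))"
  have "ennreal (Gamma \<alpha>) * gauss_integral V \<alpha> c \<theta>
     = (\<integral>\<^sup>+x. ennreal (Gamma \<alpha>) * ennreal (exp (- c * (norm x)^2) * sq_dist V (\<theta> - x) powr (- \<alpha>)) \<partial>lborel)"
    by (rule nn_integral_cmult[symmetric]) measurable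
  \<comment> \<open>An inequality, because on V the power has the value 0 while the Gamma integral
    on the right has not.\<close>
  also have "\<dots> \<le> (\<integral>\<^sup>+x. \<integral>\<^sup>+p. ?f p x \<partial>lborel \<partial>lborel)"
  proof (rule nn_integral_mono, goal_cases)
    case (1 x)
    let ?s = "sq_dist V (\<theta> - x)"
    show ?case
    proof (cases "?s = 0")
      case False
      then have s: "0 < ?s" using sq_dist_nonneg[of V "\<theta> - x"] by linarith
      have "ennreal (Gamma \<alpha>) * ennreal (exp (- c * (norm x)^2) * ?s powr (- \<alpha>))
        = ennreal (exp (- c * (norm x)^2)) * ennreal (Gamma \<alpha> * ?s powr (- \<alpha>))"
        using \<alpha> Gamma_real_pos[of \<alpha>] by (simp add: ennreal_mult'[symmetric] mult_ac)
      also have "\<dots> = (\<integral>\<^sup>+p. ennreal (exp (- c * (norm x)^2)) * ennreal (indicator {0..} p * p powr (\<alpha> - 1) * exp (- p * ?s)) \<partial>lborel)"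
        unfolding nn_integral_Gamma_powr[OF \<alpha>(1) s, symmetric] by (rule nn_integral_cmult[symmetric]) measurable
      also have "\<dots> = (\<integral>\<^sup>+p. ennreal (indicator {0..} p * p powr (\<alpha> - 1) * exp (- c * (norm x)^2 - p * ?s)) \<partial>lborel)"
        by (intro nn_integral_cong) (simp add: ennreal_mult'[symmetric] exp_diff exp_minus field_simps)
      finally show ?thesis by simp
    qed simp
  qed
  also have "\<dots> = (\<integral>\<^sup>+p. \<integral>\<^sup>+x. ?f p x \<partial>lborel \<partial>lborel)"
    by (rule lborel_pair.Fubini'[symmetric]) measurable
  also have "\<dots> = (\<integral>\<^sup>+p. ennreal ?K * (?g p * indicator {0..} p) \<partial>lborel)"
  proof (rule nn_integral_cong, goal_cases)
    case (1 p)
    show ?case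
    proof (cases "0 \<le> p")
      case True
      have "(\<integral>\<^sup>+x. ?f p x \<partial>lborel)
         = (\<integral>\<^sup>+x. ennreal (p powr (\<alpha> - 1)) * ennreal (exp (- c * (norm x)^2 - p * sq_dist V (\<theta> - x))) \<partial>lborel)"
        using True by (intro nn_integral_cong) (simp add: ennreal_mult')
      also have "\<dots> = ennreal (p powr (\<alpha> - 1)) * (\<integral>\<^sup>+x. ennreal (exp (- c * (norm x)^2 - p * sq_dist V (\<theta> - x))) \<partial>lborel)"
        by (rule nn_integral_cmult) measurable
      also have "\<dots> = ennreal (p powr (\<alpha> - 1)) * ennreal (?K * sqrt (c / (c + p)) ^ ?n * exp (- (c * p / (c + p)) * sq_dist V \<theta>))"
        by (simp only: nn_integral_exp_sq_dist[OF V k c True])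
      also have "\<dots> = ennreal ?K * (?g p)"
        using c by (subst (1 2) ennreal_mult'[symmetric]) (auto simp: mult_ac)
      finally show ?thesis using True by simp
    qed simp
  qed
  also have "\<dots> = ennreal ?K * (\<integral>\<^sup>+p. ?g p * indicator {0..} p \<partial>lborel)"
    by (rule nn_integral_cmult) measurable
  also have "\<dots> \<le> ennreal ?K * (\<integral>\<^sup>+p. (?j p) * indicator {0..} p \<partial>lborel)"
  proof (intro mult_left_mono nn_integral_mono)
    fix p :: real
    show "?g p * indicator {0..} p
      \<le> (?j p) * indicator {0..} p"
    proof (cases "0 \<le> p")
      case True
      then have cp: "0 < c / (c + p)" "c / (c + p) \<le> 1" using c by (simp_all add: divide_le_eq)
      have "real ?n = real CARD('d) - real k" using \<alpha> by simp
      \<comment> \<open>The upper bound on \<alpha> is used here: the base c / (c + p) is at most 1,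
        so the smaller exponent gives the larger power.\<close>
      then have n: "\<alpha> + 1 \<le> real ?n / 2" using \<alpha> by simp
      have "sqrt (c / (c + p)) ^ ?n = (c / (c + p)) powr (real ?n / 2)"
        proof -
        have "sqrt (c / (c + p)) = (c / (c + p)) powr (1 / 2)" using cp by (simp only: powr_half_sqrt less_imp_le)
        moreover have "((c / (c + p)) powr (1 / 2)) ^ ?n = (c / (c + p)) powr (real ?n * (1 / 2))"
          using cp by (intro powr_power) linarith
        ultimately show ?thesis by simp
      qed
      also have "\<dots> \<le> (c / (c + p)) powr (\<alpha> + 1)"
        using cp n by (intro powr_mono') auto
      finally show ?thesis
        by (intro mult_right_mono ennreal_leI mult_left_mono) auto
    qed simp
  qed simp
  also have "\<dots> \<le> ennreal ?K * trunc_Gamma \<alpha> c (sq_dist V \<theta>)"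
    by (intro mult_left_mono nn_integral_resolvent_subst[OF c]) simp
  finally show ?thesis .
qed

lemma heat_sq_dist_powr_finite:
  assumes c: "0 < c"
  shows "gauss_integral V \<alpha> c \<theta> < \<infinity>"
proof -
  note heat_sq_dist_powr_le[OF c, of \<theta>]
  also have "ennreal (sqrt (pi / c) ^ CARD('d)) * trunc_Gamma \<alpha> c (sq_dist V \<theta>) < \<infinity>"
    using nn_integral_truncated_Gamma_finite[OF \<alpha>(1), of "sq_dist V \<theta>" c] c
    by (simp only: infinity_ennreal_def ennreal_mult_less_top) simp
  finally have "ennreal (Gamma \<alpha>) * gauss_integral V \<alpha> c \<theta> < \<top>" by simp
  moreover have "ennreal (Gamma \<alpha>) \<noteq> 0" using Gamma_real_pos[OF \<alpha>(1)] by simp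
  ultimately show ?thesis
    unfolding ennreal_mult_less_top infinity_ennreal_def by (elim disjE conjE) (simp_all only: ennreal_zero_less_top simp_thms)
qed

text \<open>Truncating the Gamma integral at \<open>c\<close> loses mass. In substance this is
  superharmonicity of the negative power of the norm in the d - k directions orthogonal to
  V.\<close>

lemma heat_sq_dist_powr_less:
  assumes c: "0 < c" and s: "0 < sq_dist V \<theta>"
  shows "gauss_integral V \<alpha> c \<theta>
    < ennreal (sqrt (pi / c) ^ CARD('d) * sq_dist V \<theta> powr (- \<alpha>))"
proof -
  let ?K = "sqrt (pi / c) ^ CARD('d)"
  have K: "0 < ?K" using c by simp
  have "ennreal (Gamma \<alpha>) * gauss_integral V \<alpha> c \<theta>
    < ennreal ?K * ennreal (Gamma \<alpha> * sq_dist V \<theta> powr (- \<alpha>))"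
    using heat_sq_dist_powr_le[OF c, of \<theta>]
  proof (rule le_less_trans)
    show "ennreal ?K * trunc_Gamma \<alpha> c (sq_dist V \<theta>)
      < ennreal ?K * ennreal (Gamma \<alpha> * sq_dist V \<theta> powr (- \<alpha>))"
      using K by (intro ennreal_mult_strict_left_mono nn_integral_truncated_Gamma_less \<alpha>(1) s c) auto
  qed
  also have "ennreal ?K * ennreal (Gamma \<alpha> * sq_dist V \<theta> powr (- \<alpha>)) = ennreal (Gamma \<alpha>) * ennreal (?K * sq_dist V \<theta> powr (- \<alpha>))"
    using K Gamma_real_pos[OF \<alpha>(1)] by (simp add: ennreal_mult'[symmetric] mult_ac)
  finally show ?thesis
    by (meson mult_left_mono not_le zero_le)
qed

end

section \<open>Posterior densities\<close>

text \<open>Expressing Gamma by factorials is what lets the coefficients 2 z choose 2 x of a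
  Gaussian moment expansion collapse to z choose x in
  \<open>nn_integral_exp_post_dens\<close>.\<close>

lemma Gamma_half_nat: "Gamma (real n + 1 / 2) = sqrt pi * fact (2 * n) / (4 ^ n * fact n)"
proof (induction n)
  case 0
  then show ?case by (simp add: Gamma_one_half_real)
next
  case (Suc n)
  have "fact (2 * Suc n) = (2 * real n + 2) * (2 * real n + 1) * fact (2 * n)"
    by (simp add: algebra_simps)
  then show ?case
    unfolding Gamma_half_Suc Suc by (simp add: divide_simps) (simp add: algebra_simps)
qed

text \<open>Normalised on the whole real line, hence even in \<open>t\<close>. In use,
  \<open>\<tau>\<close> is a duration times \<gamma>.\<close>

definition post_dens :: "real \<Rightarrow> nat \<Rightarrow> real \<Rightarrow> real" where
  "post_dens \<tau> x t = sqrt \<tau> * \<tau> ^ x * t ^ (2 * x) * exp (- \<tau> * t^2) / Gamma (real x + 1 / 2)"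

lemma post_dens_nonneg [simp]: "0 \<le> \<tau> \<Longrightarrow> 0 \<le> post_dens \<tau> x t"
  unfolding post_dens_def by (intro divide_nonneg_pos mult_nonneg_nonneg Gamma_real_pos) auto

lemma post_dens_pos: "0 < \<tau> \<Longrightarrow> t \<noteq> 0 \<Longrightarrow> 0 < post_dens \<tau> x t"
  unfolding post_dens_def power_mult by (intro divide_pos_pos mult_pos_pos Gamma_real_pos) auto

lemma borel_measurable_post_dens [measurable]: "post_dens \<tau> x \<in> borel_measurable borel"
  unfolding post_dens_def by measurable

lemma sum_even_terms:
  fixes f :: "nat \<Rightarrow> 'a::comm_monoid_add"
  assumes "\<And>j. odd j \<Longrightarrow> f j = 0"
  shows "(\<Sum>j\<le>2 * z. f j) = (\<Sum>i\<le>z. f (2 * i))"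
  by (induction z) (auto simp: assms)

text \<open>Expand the power of the sum binomially: the odd central moments vanish, so only even
  powers of \<open>b\<close> survive.\<close>

lemma has_bochner_integral_normal_shift_power:
  assumes s: "0 < \<sigma>"
  shows "has_bochner_integral lborel (\<lambda>x. normal_density \<mu> \<sigma> x * ((x - \<mu>) + b) ^ (2 * z))
     (\<Sum>x\<le>z. real ((2 * z) choose (2 * x)) * b ^ (2 * x) * (fact (2 * (z - x)) / ((2 / \<sigma>^2) ^ (z - x) * fact (z - x))))"
proof -
  define M where "M j = (if even j then fact j / ((2 / \<sigma>^2) ^ (j div 2) * fact (j div 2)) else 0)" for j
  let ?t = "\<lambda>j. (real ((2 * z) choose j) * b ^ j) * M (2 * z - j)"
  let ?n = "\<lambda>j x. (real ((2 * z) choose j) * b ^ j) * (normal_density \<mu> \<sigma> x * (x - \<mu>) ^ (2 * z - j))"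
  let ?u = "\<lambda>x. (real ((2 * z) choose (2 * x)) * b ^ (2 * x)) * M (2 * z - 2 * x)"
  have M: "has_bochner_integral lborel (\<lambda>x. normal_density \<mu> \<sigma> x * (x - \<mu>) ^ j) (M j)" for j
  proof (cases "even j")
    case True
    then obtain i where "j = 2 * i" by (auto elim: evenE)
    then show ?thesis using normal_moment_even[OF s, of \<mu> i] by (simp add: M_def)
  next
    case False
    then obtain i where "j = 2 * i + 1" by (auto elim: oddE)
    then show ?thesis using normal_moment_odd[OF s, of \<mu> i] by (simp add: M_def)
  qed
  have "has_bochner_integral lborel (\<lambda>x. \<Sum>j\<le>2 * z. (?n j x))
      (\<Sum>j\<le>2 * z. (?t j))"
    by (intro has_bochner_integral_sum has_bochner_integral_mult_right M)
  also have "(\<lambda>x. \<Sum>j\<le>2 * z. (?n j x))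
      = (\<lambda>x. normal_density \<mu> \<sigma> x * ((x - \<mu>) + b) ^ (2 * z))"
  proof
    fix x
    have "((x - \<mu>) + b) ^ (2 * z) = (\<Sum>j\<le>2 * z. real ((2 * z) choose j) * b ^ j * (x - \<mu>) ^ (2 * z - j))"
      by (subst add.commute, subst binomial_ring) simp
    then show "(\<Sum>j\<le>2 * z. (?n j x))
       = normal_density \<mu> \<sigma> x * ((x - \<mu>) + b) ^ (2 * z)"
      by (simp add: sum_distrib_left mult_ac)
  qed
  also have "(\<Sum>j\<le>2 * z. (?t j)) = (\<Sum>x\<le>z. (?u x))"
  proof (cases "z = 0")
    case False
    have "(\<Sum>j\<le>2 * z. if even j then (?t j) else 0)
       = (\<Sum>x\<le>z. if even (2 * x) then (?u x) else 0)"
      by (rule sum_even_terms) auto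
    moreover have "(\<Sum>j\<le>2 * z. if even j then (?t j) else 0)
       = (\<Sum>j\<le>2 * z. (?t j))"
      by (intro sum.cong) (auto simp: M_def)
    ultimately show ?thesis by simp
  qed simp
  also have "\<dots> = (\<Sum>x\<le>z. real ((2 * z) choose (2 * x)) * b ^ (2 * x) * (fact (2 * (z - x)) / ((2 / \<sigma>^2) ^ (z - x) * fact (z - x))))"
    by (intro sum.cong) (auto simp: M_def diff_mult_distrib2[symmetric])
  finally show ?thesis .
qed

text \<open>Completing the square turns y^2 + \<tau>' (t + y)^2 into \<tau> t^2 + (y - \<mu>)^2 / p,
  and t + y equals (y - \<mu>) + p t. The moments of the centred Gaussian variable then produce the
  binomial weights with success probability \<open>p\<close>, one for each even power of
  \<open>t\<close>.\<close>

lemma nn_integral_exp_post_dens: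
  assumes t': "0 < \<tau>'" and t: "\<tau> = \<tau>' / (1 + \<tau>')" and p: "p = 1 / (1 + \<tau>')"
  shows "(\<integral>\<^sup>+y. ennreal (exp (- y\<^sup>2) * post_dens \<tau>' z (t + y)) \<partial>lborel)
    = ennreal (sqrt pi * (\<Sum>x\<le>z. real (z choose x) * p ^ x * (1 - p) ^ (z - x) * post_dens \<tau> x t))"
proof -
  define \<sigma> where "\<sigma> = 1 / sqrt (2 * (1 + \<tau>'))"
  define \<mu> where "\<mu> = - \<tau> * t"
  define C where "C = sqrt \<tau>' * \<tau>' ^ z / Gamma (real z + 1 / 2) * exp (- \<tau> * t^2) * sqrt (pi * p)"
  have pos: "0 < p" "0 < \<tau>" "0 < \<sigma>" using t' by (auto simp: p t \<sigma>_def)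
  have \<tau>p: "\<tau> = \<tau>' * p" "1 - p = \<tau>' * p" using t' by (auto simp: t p field_simps)
  have s2: "\<sigma>^2 = p / 2" using t' by (simp add: \<sigma>_def p power_divide)
  have nd: "exp (- y\<^sup>2) * post_dens \<tau>' z (t + y) = C * (normal_density \<mu> \<sigma> y * ((y - \<mu>) + p * t) ^ (2 * z))" for y
  proof -
    have e1: "(y - \<mu>) + p * t = t + y"
    proof -
      have "\<tau> + p = 1" using \<tau>p by simp
      then have "(\<tau> + p) * t = t" by simp
      then show ?thesis by (simp add: \<mu>_def algebra_simps)
    qed
    have e2: "normal_density \<mu> \<sigma> y = exp (- (y - \<mu>)\<^sup>2 / p) / sqrt (pi * p)"
      unfolding normal_density_def s2 by simp
    have e3: "exp (- y\<^sup>2) * exp (- \<tau>' * (t + y)^2) = exp (- \<tau> * t^2) * exp (- (y - \<mu>)\<^sup>2 / p)"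
    proof -
      have "- y\<^sup>2 + (- \<tau>' * (t + y)^2) = - \<tau> * t^2 + (- (y - \<mu>)\<^sup>2 / p)"
        unfolding \<mu>_def t p using t' by (simp add: divide_simps) (simp add: power2_eq_square algebra_simps)
      then show ?thesis by (simp only: exp_add[symmetric])
    qed
    have "exp (- y\<^sup>2) * post_dens \<tau>' z (t + y)
      = sqrt \<tau>' * \<tau>' ^ z / Gamma (real z + 1 / 2) * (t + y) ^ (2 * z) * (exp (- y\<^sup>2) * exp (- \<tau>' * (t + y)^2))"
      by (simp add: post_dens_def)
    then show ?thesis unfolding e1 e2 e3 C_def using pos by simp
  qed
  define R where "R = (\<Sum>x\<le>z. real ((2 * z) choose (2 * x)) * (p * t) ^ (2 * x) * (fact (2 * (z - x)) / ((2 / \<sigma>^2) ^ (z - x) * fact (z - x))))"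
  let ?a = "\<lambda>x. real ((2 * z) choose (2 * x)) * (p * t) ^ (2 * x) * (fact (2 * (z - x)) / ((2 / \<sigma>^2) ^ (z - x) * fact (z - x)))"
  let ?b = "\<lambda>x. real (z choose x) * p ^ x * (1 - p) ^ (z - x) * post_dens \<tau> x t"
  have hb: "has_bochner_integral lborel (\<lambda>y. exp (- y\<^sup>2) * post_dens \<tau>' z (t + y)) (C * R)"
    unfolding nd R_def by (intro has_bochner_integral_mult_right has_bochner_integral_normal_shift_power pos)
  have "(\<integral>\<^sup>+y. ennreal (exp (- y\<^sup>2) * post_dens \<tau>' z (t + y)) \<partial>lborel) = ennreal (C * R)"
    using hb t' by (subst nn_integral_eq_integral) (auto simp: has_bochner_integral_iff)
  also have "C * R = sqrt pi * (\<Sum>x\<le>z. (?b x))"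
    unfolding R_def sum_distrib_left
  proof (rule sum.cong[OF refl])
    fix x assume "x \<in> {..z}"
    then have "x \<le> z" by simp
    then obtain w where z: "z = x + w" using le_Suc_ex by blast
    have g: "Gamma (real z + 1 / 2) = sqrt pi * fact (2 * z) / (4 ^ z * fact z)"
      "Gamma (real x + 1 / 2) = sqrt pi * fact (2 * x) / (4 ^ x * fact x)" by (rule Gamma_half_nat)+
    have b: "real ((2 * z) choose (2 * x)) = fact (2 * z) / (fact (2 * x) * fact (2 * w))"
      "real (z choose x) = fact z / (fact x * fact w)"
      by (simp_all add: z binomial_fact)
    have s: "(2 / \<sigma>^2) ^ w = 4 ^ w / p ^ w" by (simp add: s2 power_divide)
    have sq: "sqrt \<tau> = sqrt \<tau>' * sqrt p" unfolding \<tau>p by (rule real_sqrt_mult)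
    have pi2: "sqrt pi * (sqrt pi * a) = pi * a" for a
      by (simp add: mult.assoc[symmetric])
    have "C * (?a x)
       = sqrt \<tau>' * \<tau>' ^ z * (4 ^ z * fact z) / (sqrt pi * fact (2 * z)) * exp (- \<tau> * t^2) * (sqrt pi * sqrt p)
          * (fact (2 * z) / (fact (2 * x) * fact (2 * w)) * (p ^ (2 * x) * t ^ (2 * x)) * (fact (2 * w) / (4 ^ w / p ^ w * fact w)))"
      unfolding C_def g b by (simp add: z s[unfolded z] real_sqrt_mult power_mult_distrib)
    also have "\<dots> = exp (- \<tau> * t^2) * sqrt \<tau>' * sqrt p * \<tau>' ^ z * (4 ^ x * fact z) * p ^ (2 * x) * t ^ (2 * x) * p ^ w / (fact (2 * x) * fact w)"
      by (simp add: z power_add field_simps)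
    also have "\<dots> = sqrt pi * (fact z / (fact x * fact w) * p ^ x * (\<tau>' * p) ^ w * ((sqrt \<tau>' * sqrt p) * (\<tau>' * p) ^ x * t ^ (2 * x) * exp (- \<tau> * t^2) / (sqrt pi * fact (2 * x) / (4 ^ x * fact x))))"
      by (simp add: z power_add power_mult_distrib power_mult power2_eq_square field_simps)
    also have "\<dots> = sqrt pi * (?b x)"
      unfolding post_dens_def g b sq[symmetric] \<tau>p(1)[symmetric] \<tau>p(2) by (simp add: z)
    finally show "C * (?a x)
       = sqrt pi * (?b x)" .
  qed
  finally show ?thesis .
qed

lemma nn_integral_post_dens:
  assumes t: "0 < \<tau>"
  shows "(\<integral>\<^sup>+t. ennreal (post_dens \<tau> x t) \<partial>lborel) = 1"
proof -
  define \<sigma> where "\<sigma> = 1 / sqrt (2 * \<tau>)"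
  have s: "0 < \<sigma>" "\<sigma>^2 = 1 / (2 * \<tau>)" using t by (auto simp: \<sigma>_def power_divide)
  define C where "C = \<tau> ^ x * (4 ^ x * fact x) / fact (2 * x)"
  have "post_dens \<tau> x t = C * (normal_density 0 \<sigma> t * (t - 0) ^ (2 * x))" for t
  proof -
    have "normal_density 0 \<sigma> t = sqrt \<tau> / sqrt pi * exp (- \<tau> * t^2)"
      unfolding normal_density_def s using t by (simp add: real_sqrt_divide mult.commute)
    then show ?thesis
      unfolding post_dens_def C_def Gamma_half_nat by (simp add: field_simps)
  qed
  moreover have "has_bochner_integral lborel (\<lambda>t. C * (normal_density 0 \<sigma> t * (t - 0) ^ (2 * x))) (C * (fact (2 * x) / ((2 / \<sigma>^2) ^ x * fact x)))"
    by (intro has_bochner_integral_mult_right normal_moment_even s)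
  moreover have "C * (fact (2 * x) / ((2 / \<sigma>^2) ^ x * fact x)) = 1"
    using t by (simp add: C_def s power_mult_distrib)
  ultimately have "has_bochner_integral lborel (post_dens \<tau> x) 1"
    by (metis (no_types, lifting) ext)
  then show ?thesis
    using t by (subst nn_integral_eq_integral) (auto simp: has_bochner_integral_iff)
qed

text \<open>Exponential tilting stays within the family and leaves a constant that is geometric in
  \<open>x\<close>. It evaluates the lower bound on the posterior means in closed form.\<close>

lemma post_dens_mult_exp:
  assumes "0 < \<tau>" "0 < a"
  shows "post_dens \<tau> x t * exp (- a * t^2) = sqrt (\<tau> / (\<tau> + a)) * (\<tau> / (\<tau> + a)) ^ x * post_dens (\<tau> + a) x t"
proof -
  let ?G = "Gamma (real x + 1 / 2)"
  have e1: "exp (- \<tau> * t^2) * exp (- a * t^2) = exp (- (\<tau> + a) * t^2)"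
    by (simp add: exp_add[symmetric] algebra_simps)
  have e2: "sqrt \<tau> * \<tau> ^ x = sqrt (\<tau> / (\<tau> + a)) * (\<tau> / (\<tau> + a)) ^ x * (sqrt (\<tau> + a) * (\<tau> + a) ^ x)"
    using assms by (simp add: real_sqrt_divide power_divide)
  have "post_dens \<tau> x t * exp (- a * t^2) = (sqrt \<tau> * \<tau> ^ x) * t ^ (2 * x) * (exp (- \<tau> * t^2) * exp (- a * t^2)) / ?G"
    by (simp add: post_dens_def)
  also have "\<dots> = sqrt (\<tau> / (\<tau> + a)) * (\<tau> / (\<tau> + a)) ^ x * (sqrt (\<tau> + a) * (\<tau> + a) ^ x) * t ^ (2 * x) * exp (- (\<tau> + a) * t^2) / ?G"
    by (simp only: e1 e2)
  also have "\<dots> = sqrt (\<tau> / (\<tau> + a)) * (\<tau> / (\<tau> + a)) ^ x * post_dens (\<tau> + a) x t"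
    by (simp only: post_dens_def times_divide_eq_right mult.assoc)
  finally show ?thesis .
qed

text \<open>Half of the Gaussian is spent on the power of \<open>t\<close>, by u^x / fact x <= exp u
  with u = \<tau> t^2 / 2. The base 8 is the 4 of the duplication formula times the 2 in \<tau> t^2
  = 2 u.\<close>

lemma post_dens_le:
  assumes t: "0 < \<tau>"
  shows "post_dens \<tau> x t \<le> sqrt (\<tau> / pi) * 8 ^ x * exp (- (\<tau> / 2) * t^2)"
proof -
  define u where "u = \<tau> * t^2 / 2"
  have u: "0 \<le> u" using t by (simp add: u_def)
  have f: "fact x * fact x \<le> (fact (2 * x) :: real)"
  proof -
    have "fact x * fact x dvd (fact (x + x) :: nat)" by (rule fact_fact_dvd_fact)
    then have "fact x * fact x \<le> (fact (x + x) :: nat)" by (rule dvd_imp_le) simp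
    then have "real (fact x * fact x) \<le> real (fact (2 * x))" by (simp only: mult_2 of_nat_le_iff)
    then show ?thesis by simp
  qed
  have "post_dens \<tau> x t = sqrt (\<tau> / pi) * ((8 * u) ^ x * (fact x / fact (2 * x))) * exp (- 2 * u)"
  proof -
    have "8 * u = 4 * \<tau> * t^2" by (simp add: u_def)
    then have e1: "(8 * u) ^ x = 4 ^ x * \<tau> ^ x * t ^ (2 * x)" by (simp only: power_mult_distrib power_mult)
    have e2: "exp (- 2 * u) = exp (- \<tau> * t^2)" by (simp add: u_def)
    have "post_dens \<tau> x t = sqrt \<tau> * \<tau> ^ x * t ^ (2 * x) * exp (- \<tau> * t^2) / (sqrt pi * fact (2 * x) / (4 ^ x * fact x))"
      by (simp only: post_dens_def Gamma_half_nat)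
    also have "\<dots> = sqrt \<tau> / sqrt pi * (4 ^ x * \<tau> ^ x * t ^ (2 * x) * (fact x / fact (2 * x))) * exp (- \<tau> * t^2)"
      by simp
    finally show ?thesis by (simp only: e1 e2 real_sqrt_divide)
  qed
  also have "\<dots> \<le> sqrt (\<tau> / pi) * ((8 * u) ^ x * (1 / fact x)) * exp (- 2 * u)"
    using t u f by (intro mult_right_mono mult_left_mono) (auto simp: divide_simps)
  also have "\<dots> = sqrt (\<tau> / pi) * 8 ^ x * (u ^ x / fact x * exp (- 2 * u))"
    by (simp add: power_mult_distrib)
  also have "\<dots> \<le> sqrt (\<tau> / pi) * 8 ^ x * (exp u * exp (- 2 * u))"
  proof (intro mult_left_mono mult_right_mono)
    have "(\<Sum>n\<in>{x}. u ^ n /\<^sub>R fact n) \<le> exp u"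
      unfolding exp_def using u by (intro sum_le_suminf summable_exp_generic) auto
    then show "u ^ x / fact x \<le> exp u" by (simp add: divide_inverse mult.commute)
  qed (use t in auto)
  also have "exp u * exp (- 2 * u) = exp (- (\<tau> / 2) * t^2)"
    by (simp add: exp_add[symmetric] u_def)
  finally show ?thesis .
qed

section \<open>Posterior means of the prior factor\<close>

definition post_density :: "real ^ 'd \<Rightarrow> nat ^ 'd \<Rightarrow> real ^ 'd \<Rightarrow> real" where
  "post_density \<tau> x \<theta> = (\<Prod>i\<in>UNIV. post_dens (\<tau> $ i) (x $ i) (\<theta> $ i))"

lemma post_density_nonneg [simp]: "(\<And>i. 0 < \<tau> $ i) \<Longrightarrow> 0 \<le> post_density \<tau> x \<theta>"
  unfolding post_density_def by (intro prod_nonneg) (simp add: less_imp_le)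

lemma borel_measurable_post_density [measurable]: "post_density \<tau> x \<in> borel_measurable borel"
  unfolding post_density_def[abs_def]
  by (intro borel_measurable_prod measurable_compose[OF borel_measurable_nth]) measurable

abbreviation post_integral :: "(real ^ 'd) set \<Rightarrow> real \<Rightarrow> real ^ 'd \<Rightarrow> nat ^ 'd \<Rightarrow> ennreal" where
  "post_integral V \<alpha> \<tau> x \<equiv> \<integral>\<^sup>+\<theta>. ennreal (sq_dist V \<theta> powr (- \<alpha>) * post_density \<tau> x \<theta>) \<partial>lborel"

text \<open>The prior factor here is a single power of the distance; the sum over sign vectors
  reduces to it in \<open>nn_integral_shrinkage_fun\<close>. An infinite integral would be turned
  into 0, which \<open>ennreal_post_mean\<close> excludes.\<close>

definition post_mean :: "(real ^ 'd) set \<Rightarrow> real \<Rightarrow> real ^ 'd \<Rightarrow> nat ^ 'd \<Rightarrow> real" where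
  "post_mean V \<alpha> \<tau> x = enn2real (post_integral V \<alpha> \<tau> x)"

lemma AE_lborel_vec_nonzero: "AE \<theta> in (lborel :: (real ^ 'd) measure). \<forall>i. \<theta> $ i \<noteq> 0"
proof (subst AE_all_countable, intro allI)
  fix i :: 'd
  have "negligible {x :: real ^ 'd. x $ i = 0}" by (rule negligible_standard_hyperplane_cart)
  then have "{x :: real ^ 'd. x $ i = 0} \<in> null_sets lborel"
    by (simp add: negligible_iff_null_sets null_sets_completion_iff)
  then show "AE \<theta> in (lborel :: (real ^ 'd) measure). \<theta> $ i \<noteq> 0"
    by (rule AE_I') auto
qed

lemma sq_dist_eq_0_iff:
  assumes "subspace V"
  shows "sq_dist V \<theta> = 0 \<longleftrightarrow> \<theta> \<in> V"
proof -
  have "V \<noteq> {}" using assms by (auto simp: subspace_def)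
  then show ?thesis using assms in_closed_iff_infdist_zero[of V \<theta>]
    by (simp add: sq_dist_def closed_subspace)
qed

lemma AE_sq_dist_pos:
  fixes V :: "(real ^ 'd) set"
  assumes V: "subspace V" and k: "dim V < CARD('d)"
  shows "AE \<theta> in lborel. 0 < sq_dist V \<theta>"
proof -
  have "negligible V" using k by (intro negligible_lowdim) simp
  moreover have "V \<in> sets lborel" using closed_subspace[OF V] by simp
  ultimately have "V \<in> null_sets lborel"
    by (simp add: negligible_iff_null_sets null_sets_completion_iff)
  then show ?thesis
  proof (rule AE_I')
    show "{\<theta> \<in> space lborel. \<not> 0 < sq_dist V \<theta>} \<subseteq> V"
    proof
      fix \<theta> assume "\<theta> \<in> {\<theta> \<in> space lborel. \<not> 0 < sq_dist V \<theta>}"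
      then have "sq_dist V \<theta> = 0" using sq_dist_nonneg[of V \<theta>] by (simp add: not_less)
      then show "\<theta> \<in> V" by (simp add: sq_dist_eq_0_iff[OF V])
    qed
  qed
qed

lemma sq_dist_le_norm:
  assumes V: "subspace V"
  shows "sq_dist V \<theta> \<le> (norm \<theta>)^2"
proof -
  have "infdist \<theta> V \<le> dist \<theta> 0" using V by (intro infdist_le) (simp add: subspace_0)
  then show ?thesis unfolding sq_dist_def by (intro power_mono) (auto simp: infdist_nonneg)
qed

text \<open>With p = r / (r + s) this is the conditional probability of \<open>x\<close> given x + y
  = \<open>z\<close>.\<close>

definition binom_weight :: "real ^ 'd \<Rightarrow> nat ^ 'd \<Rightarrow> nat ^ 'd \<Rightarrow> real" where
  "binom_weight p z x = (\<Prod>i\<in>UNIV. real (z $ i choose x $ i) * (p $ i) ^ (x $ i) * (1 - p $ i) ^ (z $ i - x $ i))"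

lemma binom_weight_nonneg:
  "(\<And>i. 0 < p $ i) \<Longrightarrow> (\<And>i. p $ i < 1) \<Longrightarrow> 0 \<le> binom_weight p z x"
  unfolding binom_weight_def
  by (intro prod_nonneg mult_nonneg_nonneg zero_le_power) (simp_all add: less_imp_le)

lemma sum_atMost_vec_prod:
  fixes g :: "'d::finite \<Rightarrow> nat \<Rightarrow> 'b::comm_semiring_1"
  shows "(\<Sum>x\<in>{..z}. \<Prod>i\<in>UNIV. g i (x $ i)) = (\<Prod>i\<in>UNIV. \<Sum>j\<le>z $ i. g i j)"
proof -
  have "(\<Prod>i\<in>UNIV. \<Sum>j\<le>z $ i. g i j) = (\<Sum>f\<in>Pi\<^sub>E UNIV (\<lambda>i. {..z $ i}). \<Prod>i\<in>UNIV. g i (f i))"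
    by (rule prod_sum_PiE) auto
  also have "\<dots> = (\<Sum>x\<in>{..z}. \<Prod>i\<in>UNIV. g i (x $ i))"
    by (rule sum.reindex_bij_witness[of _ vec_nth vec_lambda]) (auto simp: less_eq_vec_def PiE_def Pi_def)
  finally show ?thesis ..
qed

lemma finite_vec_components:
  fixes A :: "'d::finite \<Rightarrow> 'b set"
  assumes "\<And>i. finite (A i)"
  shows "finite {x. \<forall>i. x $ i \<in> A i}"
proof (rule finite_subset)
  show "{x. \<forall>i. x $ i \<in> A i} \<subseteq> vec_lambda ` Pi\<^sub>E UNIV A"
  proof
    fix x assume "x \<in> {x. \<forall>i. x $ i \<in> A i}"
    then have "vec_nth x \<in> Pi\<^sub>E UNIV A" by auto
    then show "x \<in> vec_lambda ` Pi\<^sub>E UNIV A" by (metis imageI vec_nth_inverse)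
  qed
qed (intro finite_imageI finite_PiE; simp add: assms)

lemma finite_atMost_vec [simp]: "finite {..z :: nat ^ 'd}"
  using finite_vec_components[of "\<lambda>i. {..z $ i}"] by (simp add: atMost_def less_eq_vec_def)

lemma sum_binom_weight: "(\<Sum>x\<in>{..z}. binom_weight p z x) = 1"
  unfolding binom_weight_def
  by (subst sum_atMost_vec_prod[of "\<lambda>i j. real (z $ i choose j) * (p $ i) ^ j * (1 - p $ i) ^ (z $ i - j)"])
     (simp add: binomial_ring[of "p $ _" "1 - p $ _", symmetric])

lemma nn_integral_exp_post_density:
  fixes \<tau> \<tau>' p :: "real ^ 'd"
  assumes t': "\<And>i. 0 < \<tau>' $ i" and t: "\<And>i. \<tau> $ i = \<tau>' $ i / (1 + \<tau>' $ i)" and p: "\<And>i. p $ i = 1 / (1 + \<tau>' $ i)"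
  shows "(\<integral>\<^sup>+y. ennreal (exp (- (norm y)\<^sup>2) * post_density \<tau>' z (\<theta> + y)) \<partial>lborel)
    = ennreal (sqrt pi ^ CARD('d) * (\<Sum>x\<in>{..z}. binom_weight p z x * post_density \<tau> x \<theta>))"
proof -
  have t0: "0 < \<tau> $ i" for i using t[of i] t'[of i] by simp
  have p0: "0 < p $ i" "p $ i < 1" for i using p[of i] t'[of i] by simp_all
  let ?S = "\<lambda>i. (\<Sum>x\<le>z $ i. real (z $ i choose x) * (p $ i) ^ x * (1 - p $ i) ^ (z $ i - x) * post_dens (\<tau> $ i) x (\<theta> $ i))"
  have "(\<integral>\<^sup>+y. ennreal (exp (- (norm y)\<^sup>2) * post_density \<tau>' z (\<theta> + y)) \<partial>lborel)
     = (\<integral>\<^sup>+y. (\<Prod>i\<in>UNIV. ennreal (exp (- (y $ i)\<^sup>2) * post_dens (\<tau>' $ i) (z $ i) (\<theta> $ i + y $ i))) \<partial>lborel)"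
    using t' by (intro nn_integral_cong)
       (subst prod_ennreal, simp_all add: less_imp_le post_density_def prod.distrib norm_vec_power2 exp_sum flip: sum_negf)
  also have "\<dots> = (\<Prod>i\<in>UNIV. ennreal (sqrt pi * (?S i)))"
    by (subst nn_integral_lborel_vec_prod[of "\<lambda>i y. ennreal (exp (- y\<^sup>2) * post_dens (\<tau>' $ i) (z $ i) (\<theta> $ i + y))"])
       (measurable, simp only: nn_integral_exp_post_dens[OF t' t p])
  also have "\<dots> = ennreal (\<Prod>i\<in>UNIV. sqrt pi * (?S i))"
    using t0 p0 by (intro prod_ennreal mult_nonneg_nonneg sum_nonneg) (simp_all add: less_imp_le)
  also have "(\<Prod>i\<in>UNIV. sqrt pi * (?S i))
     = sqrt pi ^ CARD('d) * (\<Sum>x\<in>{..z}. binom_weight p z x * post_density \<tau> x \<theta>)"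
    unfolding prod.distrib binom_weight_def post_density_def
    by (simp add: sum_atMost_vec_prod[of "\<lambda>i x. real (z $ i choose x) * (p $ i) ^ x * (1 - p $ i) ^ (z $ i - x) * post_dens (\<tau> $ i) x (\<theta> $ i)", symmetric] prod.distrib)
  finally show ?thesis .
qed

context shrinkage_setup
begin

text \<open>Since ln s_V <= s_V - 1 <= |\<theta>|^2, the prior factor is at least exp (- \<alpha>
  |\<theta>|^2), and against this Gaussian the posterior integrates explicitly. The bound decays
  only geometrically in \<open>x\<close>, which keeps the logarithm integrable.\<close>

lemma nn_integral_post_mean_lower:
  assumes t: "\<And>i. 0 < \<tau> $ i"
  shows "ennreal (\<Prod>i\<in>UNIV. sqrt (\<tau> $ i / (\<tau> $ i + \<alpha>)) * (\<tau> $ i / (\<tau> $ i + \<alpha>)) ^ (x $ i))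
    \<le> post_integral V \<alpha> \<tau> x"
proof -
  let ?c = "\<lambda>i. sqrt (\<tau> $ i / (\<tau> $ i + \<alpha>)) * (\<tau> $ i / (\<tau> $ i + \<alpha>)) ^ (x $ i)"
  let ?e = "\<lambda>i s. ennreal (post_dens (\<tau> $ i) (x $ i) s * exp (- \<alpha> * s^2))"
  let ?d = "\<lambda>i s. ennreal (post_dens (\<tau> $ i + \<alpha>) (x $ i) s)"
  let ?k = "\<lambda>\<theta>. (\<Prod>i\<in>UNIV. ennreal (post_dens (\<tau> $ i) (x $ i) (\<theta> $ i) * exp (- \<alpha> * (\<theta> $ i)^2)))"
  have ta: "0 < \<tau> $ i + \<alpha>" for i using t[of i] \<alpha> by simp
  have c0: "0 \<le> ?c i" for i using t[of i] ta[of i] by simp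
  have "ennreal (\<Prod>i\<in>UNIV. ?c i) = (\<Prod>i\<in>UNIV. ennreal (?c i) * (\<integral>\<^sup>+t. ennreal (post_dens (\<tau> $ i + \<alpha>) (x $ i) t) \<partial>lborel))"
    using c0 by (simp only: nn_integral_post_dens[OF ta] prod_ennreal mult_1_right)
  also have "\<dots> = (\<Prod>i\<in>UNIV. \<integral>\<^sup>+s. ?e i s \<partial>lborel)"
  proof (rule prod.cong[OF refl], goal_cases)
    case (1 i)
    have "(\<integral>\<^sup>+s. ?e i s \<partial>lborel) = (\<integral>\<^sup>+s. ennreal (?c i) * (?d i s) \<partial>lborel)"
      using c0[of i] by (simp only: post_dens_mult_exp[OF t \<alpha>(1)] ennreal_mult')
    also have "\<dots> = ennreal (?c i) * (\<integral>\<^sup>+s. ?d i s \<partial>lborel)"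
      by (rule nn_integral_cmult) measurable
    finally show ?case ..
  qed
  also have "\<dots> = (\<integral>\<^sup>+\<theta>. ?k \<theta> \<partial>lborel)"
    by (rule nn_integral_lborel_vec_prod[of "\<lambda>i s. (?e i s)", symmetric]) measurable
  also have "\<dots> \<le> post_integral V \<alpha> \<tau> x"
  proof (rule nn_integral_mono_AE, rule AE_mp[OF AE_sq_dist_pos[OF V k_less]], intro AE_I2 impI)
    fix \<theta> assume s: "0 < sq_dist V \<theta>"
    have "(?k \<theta>)
       = ennreal (post_density \<tau> x \<theta> * exp (- \<alpha> * (norm \<theta>)^2))"
      using t by (subst prod_ennreal)
        (simp_all add: less_imp_le post_density_def prod.distrib norm_vec_power2 sum_distrib_left exp_sum flip: sum_negf)
    also have "\<dots> \<le> ennreal (sq_dist V \<theta> powr (- \<alpha>) * post_density \<tau> x \<theta>)"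
    proof (rule ennreal_leI)
      have "ln (sq_dist V \<theta>) \<le> sq_dist V \<theta> - 1" using s by (rule ln_le_minus_one)
      also have "\<dots> \<le> (norm \<theta>)^2" using sq_dist_le_norm[OF V, of \<theta>] by simp
      finally have "- \<alpha> * (norm \<theta>)^2 \<le> - \<alpha> * ln (sq_dist V \<theta>)" using \<alpha> by simp
      then have "exp (- \<alpha> * (norm \<theta>)^2) \<le> sq_dist V \<theta> powr (- \<alpha>)" using s by (simp add: powr_def)
      then show "post_density \<tau> x \<theta> * exp (- \<alpha> * (norm \<theta>)^2) \<le> sq_dist V \<theta> powr (- \<alpha>) * post_density \<tau> x \<theta>"
        using t by (subst mult.commute) (intro mult_right_mono post_density_nonneg)
    qed
    finally show "(?k \<theta>)
       \<le> ennreal (sq_dist V \<theta> powr (- \<alpha>) * post_density \<tau> x \<theta>)" .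
  qed
  finally show ?thesis .
qed

text \<open>All coordinate densities are dominated by Gaussians with the common precision
  \<open>c\<close>, the least of the \<tau> / 2. The singular prior factor is then integrable by
  \<open>heat_sq_dist_powr_finite\<close> at the origin.\<close>

lemma nn_integral_post_mean_upper:
  assumes t: "\<And>i. 0 < \<tau> $ i"
  shows "\<exists>C>0. \<forall>x. post_integral V \<alpha> \<tau> x \<le> ennreal (C * 8 ^ (\<Sum>i\<in>UNIV. x $ i))"
proof -
  define c where "c = Min (range (\<lambda>i. \<tau> $ i / 2))"
  have "c \<in> range (\<lambda>i. \<tau> $ i / 2)" unfolding c_def by (rule Min_in) auto
  then obtain j where "c = \<tau> $ j / 2" by blast
  then have c: "0 < c" using t[of j] by simp
  have cle: "c \<le> \<tau> $ i / 2" for i unfolding c_def by (rule Min_le) auto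
  define D where "D = (\<Prod>i\<in>UNIV. sqrt (\<tau> $ i / pi))"
  let ?e = "\<lambda>\<theta>. exp (- c * (norm \<theta>)^2) * sq_dist V (0 - \<theta>) powr (- \<alpha>)"
  let ?s = "\<lambda>x. 8 ^ (\<Sum>i\<in>UNIV. x $ i)"
  let ?g = "\<lambda>\<theta>. exp (- c * (norm \<theta>)^2)"
  let ?f = "\<lambda>x \<theta>. sq_dist V \<theta> powr (- \<alpha>) * post_density \<tau> x \<theta>"
  have D: "0 < D" unfolding D_def using t by (intro prod_pos) simp
  define I where "I = (\<integral>\<^sup>+x. ennreal (exp (- c * (norm x)^2) * sq_dist V (0 - x) powr (- \<alpha>)) \<partial>lborel)"
  have I: "I < \<infinity>" unfolding I_def by (rule heat_sq_dist_powr_finite[OF c])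
  have bound: "post_integral V \<alpha> \<tau> x \<le> ennreal (D * (?s x)) * I" for x
  proof -
    let ?E = "D * (?s x)"
    have "post_integral V \<alpha> \<tau> x
       \<le> (\<integral>\<^sup>+\<theta>. ennreal ?E * ennreal (?e \<theta>) \<partial>lborel)"
    proof (rule nn_integral_mono)
      fix \<theta> :: "real ^ 'd"
      have "post_density \<tau> x \<theta> \<le> (\<Prod>i\<in>UNIV. sqrt (\<tau> $ i / pi) * 8 ^ (x $ i) * exp (- c * (\<theta> $ i)^2))"
        unfolding post_density_def
      proof (intro prod_mono conjI)
        fix i
        show "0 \<le> post_dens (\<tau> $ i) (x $ i) (\<theta> $ i)" using t by (simp add: less_imp_le)
        have "post_dens (\<tau> $ i) (x $ i) (\<theta> $ i) \<le> sqrt (\<tau> $ i / pi) * 8 ^ (x $ i) * exp (- (\<tau> $ i / 2) * (\<theta> $ i)^2)"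
          using t by (rule post_dens_le)
        also have "\<dots> \<le> sqrt (\<tau> $ i / pi) * 8 ^ (x $ i) * exp (- c * (\<theta> $ i)^2)"
          using mult_right_mono[OF cle[of i], of "(\<theta> $ i)^2"] t[of i] by (intro mult_left_mono) auto
        finally show "post_dens (\<tau> $ i) (x $ i) (\<theta> $ i) \<le> sqrt (\<tau> $ i / pi) * 8 ^ (x $ i) * exp (- c * (\<theta> $ i)^2)" .
      qed
      also have "\<dots> = ?E * (?g \<theta>)"
        by (simp add: prod.distrib D_def power_sum norm_vec_power2 sum_distrib_left exp_sum flip: sum_negf)
      finally have "(?f x \<theta>) \<le> sq_dist V \<theta> powr (- \<alpha>) * (?E * (?g \<theta>))"
        by (rule mult_left_mono) simp
      \<comment> \<open>Scaling by - 1 shows that the distance is even, which matches the argument 0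
        - \<theta> in the Gaussian integral at the origin.\<close>
      also have "\<dots> = ?E * (?e \<theta>)"
        using sq_dist_scaleR[OF V, of "- 1" \<theta>] by (simp add: mult_ac)
      finally show "ennreal (?f x \<theta>) \<le> ennreal ?E * ennreal (?e \<theta>)"
        using D by (subst ennreal_mult'[symmetric]) (auto intro: ennreal_leI)
    qed
    also have "\<dots> = ennreal ?E * I" unfolding I_def by (rule nn_integral_cmult) measurable
    finally show ?thesis .
  qed
  show ?thesis
  proof (intro exI[of _ "D * (enn2real I + 1)"] conjI allI)
    show "0 < D * (enn2real I + 1)" using D enn2real_nonneg[of I] by (intro mult_pos_pos add_nonneg_pos) auto
    fix x :: "nat ^ 'd"
    have Ir: "ennreal (enn2real I) = I" using I by simp
    have "ennreal (D * (?s x)) * I = ennreal (D * (?s x) * enn2real I)"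
      by (subst ennreal_mult''[OF enn2real_nonneg]) (simp only: Ir)
    also have "\<dots> \<le> ennreal (D * (enn2real I + 1) * (?s x))"
      using D by (intro ennreal_leI) (simp add: algebra_simps)
    finally show "post_integral V \<alpha> \<tau> x \<le> ennreal (D * (enn2real I + 1) * (?s x))"
      using bound[of x] by (rule order_trans[rotated])
  qed
qed

lemma ennreal_post_mean:
  assumes t: "\<And>i. 0 < \<tau> $ i"
  shows "ennreal (post_mean V \<alpha> \<tau> x) = post_integral V \<alpha> \<tau> x"
proof -
  obtain C where "\<forall>x. post_integral V \<alpha> \<tau> x \<le> ennreal (C * 8 ^ (\<Sum>i\<in>UNIV. x $ i))"
    using nn_integral_post_mean_upper[OF t] by metis
  then have "post_integral V \<alpha> \<tau> x \<le> ennreal (C * 8 ^ (\<Sum>i\<in>UNIV. x $ i))" by blast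
  also have "\<dots> < \<top>" by simp
  finally show ?thesis unfolding post_mean_def by simp
qed

lemma post_mean_ge:
  assumes t: "\<And>i. 0 < \<tau> $ i"
  shows "(\<Prod>i\<in>UNIV. sqrt (\<tau> $ i / (\<tau> $ i + \<alpha>)) * (\<tau> $ i / (\<tau> $ i + \<alpha>)) ^ (x $ i)) \<le> post_mean V \<alpha> \<tau> x"
  using nn_integral_post_mean_lower[OF t, of x]
  unfolding ennreal_post_mean[OF t, symmetric] by (subst (asm) ennreal_le_iff) (auto simp: post_mean_def)

lemma post_mean_pos:
  assumes t: "\<And>i. 0 < \<tau> $ i"
  shows "0 < post_mean V \<alpha> \<tau> x"
proof -
  have "0 < (\<Prod>i\<in>UNIV. sqrt (\<tau> $ i / (\<tau> $ i + \<alpha>)) * (\<tau> $ i / (\<tau> $ i + \<alpha>)) ^ (x $ i))"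
    using t \<alpha> by (intro prod_pos) (simp add: add_pos_pos)
  also note post_mean_ge[OF t]
  finally show ?thesis .
qed

text \<open>Two-sided geometric bounds become linear under the logarithm, and a linear function of a
  Poisson vector is integrable.\<close>

lemma abs_ln_post_mean_le:
  assumes t: "\<And>i. 0 < \<tau> $ i"
  shows "\<exists>C. \<forall>x. \<bar>ln (post_mean V \<alpha> \<tau> x)\<bar> \<le> C * (1 + (\<Sum>i\<in>UNIV. real (x $ i)))"
proof -
  let ?h = "\<lambda>x. post_mean V \<alpha> \<tau> x"
  obtain C where C: "C > 0" "\<And>x. post_integral V \<alpha> \<tau> x \<le> ennreal (C * 8 ^ (\<Sum>i\<in>UNIV. x $ i))"
    using nn_integral_post_mean_upper[OF t] by metis
  have up: "ln (?h x) \<le> (\<bar>ln C\<bar> + ln 8) * (1 + (\<Sum>i\<in>UNIV. real (x $ i)))" for x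
  proof -
    let ?S = "\<Sum>i\<in>UNIV. real (x $ i)"
    have S: "0 \<le> ?S" by (intro sum_nonneg) auto
    have "(?h x) \<le> C * 8 ^ (\<Sum>i\<in>UNIV. x $ i)"
      using C(2)[of x] C(1) unfolding ennreal_post_mean[OF t, symmetric] by (subst (asm) ennreal_le_iff) auto
    then have "ln (?h x) \<le> ln (C * 8 ^ (\<Sum>i\<in>UNIV. x $ i))"
      using post_mean_pos[OF t, of x] C(1) by (subst ln_le_cancel_iff) auto
    also have "\<dots> = ln C + ?S * ln 8"
      using C(1) by (simp add: ln_mult_pos ln_realpow)
    also have "\<dots> \<le> \<bar>ln C\<bar> + ?S * ln 8 + ln 8 + \<bar>ln C\<bar> * ?S"
    proof -
      have "0 \<le> \<bar>ln C\<bar> * ?S" "0 \<le> ln (8::real)" using S by simp_all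
      then show ?thesis by linarith
    qed
    also have "\<dots> = (\<bar>ln C\<bar> + ln 8) * (1 + ?S)" by (simp add: algebra_simps)
    finally show ?thesis .
  qed
  define L where "L i = - ln (\<tau> $ i / (\<tau> $ i + \<alpha>))" for i
  let ?f = "\<lambda>x i. sqrt (\<tau> $ i / (\<tau> $ i + \<alpha>)) * (\<tau> $ i / (\<tau> $ i + \<alpha>)) ^ (x $ i)"
  let ?q = "\<lambda>i. \<tau> $ i / (\<tau> $ i + \<alpha>)"
  have q: "0 < (?q i)" "(?q i) \<le> 1" for i
    using t[of i] \<alpha> by (auto simp: divide_le_eq add_pos_pos)
  have L0: "0 \<le> L i" for i using q[of i] by (simp add: L_def)
  define M where "M = (\<Sum>i\<in>UNIV. L i)"
  have LM: "L i \<le> M" for i unfolding M_def using L0 by (intro member_le_sum) auto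
  have low: "- ln (?h x) \<le> (M * CARD('d)) * (1 + (\<Sum>i\<in>UNIV. real (x $ i)))" for x
  proof -
    let ?S = "\<Sum>i\<in>UNIV. real (x $ i)"
    let ?P = "\<Prod>i\<in>UNIV. (?f x i)"
    have S: "0 \<le> ?S" by (intro sum_nonneg) auto
    have M0: "0 \<le> M" unfolding M_def using L0 by (intro sum_nonneg) auto
    have f: "0 < (?f x i)" for i
      using q by (intro mult_pos_pos zero_less_power) auto
    then have "0 < ?P" by (intro prod_pos) auto
    then have "ln ?P \<le> ln (?h x)"
      using post_mean_ge[OF t, of x] post_mean_pos[OF t, of x] by (subst ln_le_cancel_iff) auto
    moreover have "ln ?P = (\<Sum>i\<in>UNIV. ln (?f x i))"
      by (intro ln_prod finite) (metis f less_irrefl)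
    moreover have "\<dots> = (\<Sum>i\<in>UNIV. - ((1 / 2 + real (x $ i)) * L i))"
    proof (rule sum.cong[OF refl], goal_cases)
      case (1 i)
      have "ln (?f x i)
        = ln (sqrt (?q i)) + ln ((?q i) ^ (x $ i))"
        using q[of i] by (intro ln_mult_pos zero_less_power) auto
      also have "\<dots> = ln (?q i) / 2 + real (x $ i) * ln (?q i)"
        using q[of i] by (simp only: ln_sqrt ln_realpow)
      finally show ?case
        by (simp add: L_def algebra_simps)
    qed
    ultimately have "- ln (?h x) \<le> (\<Sum>i\<in>UNIV. (1 / 2 + real (x $ i)) * L i)"
      unfolding sum_negf by linarith
    also have "\<dots> \<le> (\<Sum>i\<in>UNIV. (1 + real (x $ i)) * M)"
      using L0 LM by (intro sum_mono mult_mono) auto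
    also have "\<dots> = M * (CARD('d) + ?S)"
      by (subst sum_distrib_right[symmetric]) (simp add: sum.distrib mult.commute)
    also have "\<dots> \<le> M * (CARD('d) * (1 + ?S))"
    proof (intro mult_left_mono M0)
      have "1 * ?S \<le> CARD('d) * ?S" using S by (intro mult_right_mono) (auto simp: Suc_le_eq)
      then show "CARD('d) + ?S \<le> CARD('d) * (1 + ?S)" by (simp add: algebra_simps)
    qed
    finally show ?thesis by simp
  qed
  show ?thesis
  proof (intro exI allI)
    fix x :: "nat ^ 'd"
    let ?S = "\<Sum>i\<in>UNIV. real (x $ i)"
    have S: "0 \<le> ?S" by (intro sum_nonneg) auto
    show "\<bar>ln (?h x)\<bar> \<le> max (\<bar>ln C\<bar> + ln 8) (M * CARD('d)) * (1 + ?S)"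
    proof -
      have "(\<bar>ln C\<bar> + ln 8) * (1 + ?S) \<le> max (\<bar>ln C\<bar> + ln 8) (M * CARD('d)) * (1 + ?S)"
        "(M * CARD('d)) * (1 + ?S) \<le> max (\<bar>ln C\<bar> + ln 8) (M * CARD('d)) * (1 + ?S)"
        using S by (intro mult_right_mono; simp)+
      with up[of x] low[of x] show ?thesis by linarith
    qed
  qed
qed

text \<open>Up to the factor sqrt pi ^ d the left side is a double integral of the prior factor
  against the smoothed posterior. Fubini and a translation make the smoothing act on the prior
  factor instead, where \<open>heat_sq_dist_powr_less\<close> with c = 1 applies.\<close>

lemma sum_binom_weight_post_mean_less:
  fixes \<tau> \<tau>' p :: "real ^ 'd"
  assumes t': "\<And>i. 0 < \<tau>' $ i" and t: "\<And>i. \<tau> $ i = \<tau>' $ i / (1 + \<tau>' $ i)" and p: "\<And>i. p $ i = 1 / (1 + \<tau>' $ i)"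
  shows "(\<Sum>x\<in>{..z}. binom_weight p z x * post_mean V \<alpha> \<tau> x) < post_mean V \<alpha> \<tau>' z"
proof -
  have t0: "0 < \<tau> $ i" for i using t[of i] t'[of i] by simp
  have p0: "0 < p $ i" "p $ i < 1" for i using p[of i] t'[of i] by simp_all
  have bw: "0 \<le> binom_weight p z x" for x
    by (rule binom_weight_nonneg[OF p0])
  let ?K = "sqrt pi ^ CARD('d)"
  let ?s = "\<lambda>\<theta>. sq_dist V \<theta> powr (- \<alpha>)"
  have K: "0 < ?K" by simp
  define H where "H \<theta> = (\<integral>\<^sup>+y. ennreal (exp (- (norm y)\<^sup>2) * ?s (\<theta> - y)) \<partial>lborel)" for \<theta>
  have Hm[measurable]: "H \<in> borel_measurable borel" unfolding H_def by measurable
  let ?u = "\<lambda>\<theta> y. ennreal (?s \<theta>) * ennreal (exp (- (norm y)\<^sup>2) * post_density \<tau>' z (\<theta> + y))"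
  let ?v = "\<lambda>\<theta> y. ennreal (post_density \<tau>' z \<theta>) * ennreal (exp (- (norm y)\<^sup>2) * ?s (\<theta> - y))"
  let ?a = "\<lambda>\<theta> x. ennreal (binom_weight p z x) * ennreal (?s \<theta> * post_density \<tau> x \<theta>)"
  let ?w = "\<lambda>\<theta>. ennreal ?K * (\<Sum>x\<in>{..z}. (?a \<theta> x))"
  let ?q = "\<lambda>\<theta>. ennreal (post_density \<tau>' z \<theta>) * ennreal (?K * ?s \<theta>)"
  let ?H = "\<lambda>\<theta>. ennreal (post_density \<tau>' z \<theta>) * H \<theta>"
  have pm: "(\<integral>\<^sup>+\<theta>. ?q \<theta> \<partial>lborel) = ennreal (?K * post_mean V \<alpha> \<tau>' z)"
  proof -
    have "(\<integral>\<^sup>+\<theta>. ?q \<theta> \<partial>lborel) = (\<integral>\<^sup>+\<theta>. ennreal ?K * ennreal (?s \<theta> * post_density \<tau>' z \<theta>) \<partial>lborel)"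
      using t' by (intro nn_integral_cong) (simp add: ennreal_mult'[symmetric] mult_ac)
    also have "\<dots> = ennreal ?K * ennreal (post_mean V \<alpha> \<tau>' z)"
      unfolding ennreal_post_mean[OF t'] by (rule nn_integral_cmult) measurable
    finally show ?thesis by (simp add: ennreal_mult')
  qed
  have "ennreal (?K * (\<Sum>x\<in>{..z}. binom_weight p z x * post_mean V \<alpha> \<tau> x))
     = ennreal ?K * (\<Sum>x\<in>{..z}. ennreal (binom_weight p z x) * (\<integral>\<^sup>+\<theta>. ennreal (?s \<theta> * post_density \<tau> x \<theta>) \<partial>lborel))"
    unfolding ennreal_post_mean[OF t0, symmetric] using bw post_mean_pos[OF t0]
    by (simp add: ennreal_mult' sum_ennreal[symmetric] less_imp_le del: sum_ennreal)
  also have "\<dots> = ennreal ?K * (\<Sum>x\<in>{..z}. (\<integral>\<^sup>+\<theta>. ?a \<theta> x \<partial>lborel))"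
    by (subst nn_integral_cmult) auto
  also have "\<dots> = ennreal ?K * (\<integral>\<^sup>+\<theta>. (\<Sum>x\<in>{..z}. (?a \<theta> x)) \<partial>lborel)"
    by (subst nn_integral_sum) auto
  also have "\<dots> = (\<integral>\<^sup>+\<theta>. ?w \<theta> \<partial>lborel)"
    by (subst nn_integral_cmult) auto
  also have "\<dots> = (\<integral>\<^sup>+\<theta>. \<integral>\<^sup>+y. ?u \<theta> y \<partial>lborel \<partial>lborel)"
  proof (rule nn_integral_cong, goal_cases)
    case (1 \<theta>)
    have "(?w \<theta>)
      = ennreal (?K * (\<Sum>x\<in>{..z}. binom_weight p z x * (?s \<theta> * post_density \<tau> x \<theta>)))"
      using bw t0 by (simp add: ennreal_mult' sum_ennreal[symmetric] del: sum_ennreal)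
    also have "?K * (\<Sum>x\<in>{..z}. binom_weight p z x * (?s \<theta> * post_density \<tau> x \<theta>)) = ?s \<theta> * (?K * (\<Sum>x\<in>{..z}. binom_weight p z x * post_density \<tau> x \<theta>))"
      by (simp add: sum_distrib_left mult_ac)
    also have "ennreal \<dots> = ennreal (?s \<theta>) * (\<integral>\<^sup>+y. ennreal (exp (- (norm y)\<^sup>2) * post_density \<tau>' z (\<theta> + y)) \<partial>lborel)"
      unfolding nn_integral_exp_post_density[OF t' t p] by (rule ennreal_mult') simp
    also have "\<dots> = (\<integral>\<^sup>+y. ?u \<theta> y \<partial>lborel)"
      by (rule nn_integral_cmult[symmetric]) measurable
    finally show ?case .
  qed
  also have "\<dots> = (\<integral>\<^sup>+y. \<integral>\<^sup>+\<theta>. ?u \<theta> y \<partial>lborel \<partial>lborel)"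
    by (rule lborel_pair.Fubini') measurable
  \<comment> \<open>For fixed \<open>y\<close> the variable \<theta> is translated by
    \<open>y\<close>, which moves the perturbation from the posterior density to the
    distance.\<close>
  also have "\<dots> = (\<integral>\<^sup>+y. \<integral>\<^sup>+\<theta>. ?v \<theta> y \<partial>lborel \<partial>lborel)"
  proof (rule nn_integral_cong, goal_cases)
    case (1 y)
    have "(\<integral>\<^sup>+\<theta>. ?u \<theta> y \<partial>lborel)
      = (\<integral>\<^sup>+\<theta>. (\<lambda>\<theta>. ?v \<theta> y) (y + \<theta>) \<partial>lborel)"
      using t' by (intro nn_integral_cong) (simp add: ennreal_mult'[symmetric] mult_ac add.commute)
    also have "\<dots> = (\<integral>\<^sup>+\<theta>. ?v \<theta> y \<partial>lborel)"
      by (rule nn_integral_lborel_shift) measurable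
    finally show ?case .
  qed
  also have "\<dots> = (\<integral>\<^sup>+\<theta>. \<integral>\<^sup>+y. ?v \<theta> y \<partial>lborel \<partial>lborel)"
    by (rule lborel_pair.Fubini'[symmetric]) measurable
  also have "\<dots> = (\<integral>\<^sup>+\<theta>. ?H \<theta> \<partial>lborel)"
    unfolding H_def by (subst nn_integral_cmult) auto
  \<comment> \<open>The pointwise inequality is strict except possibly where \<theta> lies in V or
    has a vanishing coordinate, and both sets are null.\<close>
  also have "\<dots> < (\<integral>\<^sup>+\<theta>. ?q \<theta> \<partial>lborel)"
  proof (rule nn_integral_less)
    have less: "AE \<theta> in lborel. (?H \<theta>) < (?q \<theta>)"
      using AE_sq_dist_pos[OF V k_less] AE_lborel_vec_nonzero
    proof eventually_elim
      case (elim \<theta>)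
      have "H \<theta> < ennreal (?K * ?s \<theta>)"
        using heat_sq_dist_powr_less[OF zero_less_one elim(1)] by (simp add: H_def)
      moreover have "0 < post_density \<tau>' z \<theta>"
        unfolding post_density_def using elim(2) t' by (intro prod_pos) (simp add: post_dens_pos)
      ultimately show ?case by (intro ennreal_mult_strict_left_mono) auto
    qed
    then show "AE \<theta> in lborel. (?H \<theta>) \<le> (?q \<theta>)"
      by (rule AE_mp) (auto intro: less_imp_le)
    from this have "(\<integral>\<^sup>+\<theta>. ?H \<theta> \<partial>lborel) \<le> ennreal (?K * post_mean V \<alpha> \<tau>' z)"
      unfolding pm[symmetric] by (rule nn_integral_mono_AE)
    then show "(\<integral>\<^sup>+\<theta>. ?H \<theta> \<partial>lborel) \<noteq> \<infinity>"
      by (auto simp: top_unique)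
    show "\<not> (AE \<theta> in lborel. (?q \<theta>) \<le> (?H \<theta>))"
    proof
      assume "AE \<theta> in lborel. (?q \<theta>) \<le> (?H \<theta>)"
      with less have "AE \<theta> in (lborel :: (real ^ 'd) measure). False" by eventually_elim auto
      then have "emeasure (lborel :: (real ^ 'd) measure) UNIV = 0"
        by (subst (asm) AE_iff_measurable[of UNIV]) auto
      then show False by simp
    qed
  qed measurable
  also note pm
  finally have "?K * (\<Sum>x\<in>{..z}. binom_weight p z x * post_mean V \<alpha> \<tau> x) < ?K * post_mean V \<alpha> \<tau>' z"
    by (subst (asm) ennreal_less_iff) (use bw post_mean_pos[OF t0] in \<open>auto intro!: mult_nonneg_nonneg sum_nonneg simp: less_imp_le\<close>)
  then show ?thesis using K by (simp add: mult_less_cancel_left_pos del: mult_less_cancel_left)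
qed

end

section \<open>Poisson vectors and Kullback-Leibler risk\<close>

text \<open>The bridge from the power series to the measure: the absolute value of \<open>g\<close>
  is again \<open>exp_bounded\<close>, so the series converges absolutely.\<close>

lemma integrable_poisson_pmf:
  assumes m: "0 < m" and g: "exp_bounded g"
  shows "integrable (poisson_pmf m) g" and "measure_pmf.expectation (poisson_pmf m) g = pois m g"
proof -
  let ?p = "\<lambda>x. pmf (poisson_pmf m) x * g x"
  have eq: "(?p x) = exp (- m) * (g x / fact x * m ^ x)" for x
    using m by (simp add: mult_ac)
  have "exp_bounded (\<lambda>x. \<bar>g x\<bar>)" by (rule exp_bounded_mono[OF g]) simp
  then have "summable (\<lambda>x. exp (- m) * (\<bar>g x\<bar> / fact x * m ^ x))" by (intro summable_mult summable_pois)
  then have "summable (\<lambda>x. norm (?p x))"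
    unfolding eq using m by (simp add: abs_mult)
  then have int: "integrable (count_space UNIV) (\<lambda>x. ?p x)"
    by (simp only: integrable_count_space_nat_iff)
  then show "integrable (poisson_pmf m) g"
    unfolding measure_pmf_eq_density by (subst integrable_density) auto
  have "measure_pmf.expectation (poisson_pmf m) g = (\<integral>x. (?p x) \<partial>count_space UNIV)"
    unfolding measure_pmf_eq_density by (subst integral_density) auto
  also have "\<dots> = (\<Sum>x. (?p x))"
    by (rule sums_unique[OF sums_integral_count_space_nat[OF int]])
  also have "\<dots> = pois m g"
    unfolding eq pois_def by (rule suminf_mult[OF summable_pois[OF g]])
  finally show "measure_pmf.expectation (poisson_pmf m) g = pois m g" .
qed

definition poisson_vec :: "real ^ 'd \<Rightarrow> real ^ 'd \<Rightarrow> (nat ^ 'd) pmf" where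
  "poisson_vec t l = map_pmf vec_lambda (Pi_pmf UNIV 0 (\<lambda>i. poisson_pmf (t $ i * l $ i)))"

lemma inj_vec_lambda: "inj vec_lambda"
  by (metis injI vec_lambda_inverse UNIV_I)

lemma pmf_poisson_vec:
  assumes "\<And>i. 0 < t $ i" "\<And>i. 0 < l $ i"
  shows "pmf (poisson_vec t l) x = poisson_prob t l x"
proof -
  have "pmf (poisson_vec t l) x = pmf (poisson_vec t l) (vec_lambda (vec_nth x))" by simp
  also have "\<dots> = pmf (Pi_pmf UNIV 0 (\<lambda>i. poisson_pmf (t $ i * l $ i))) (vec_nth x)"
    unfolding poisson_vec_def by (rule pmf_map_inj'[OF inj_vec_lambda])
  also have "\<dots> = (\<Prod>i\<in>UNIV. pmf (poisson_pmf (t $ i * l $ i)) (x $ i))"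
    by (rule pmf_Pi') auto
  also have "\<dots> = poisson_prob t l x"
    unfolding poisson_prob_def using assms by (intro prod.cong) auto
  finally show ?thesis .
qed

lemma poisson_prob_pos:
  assumes "\<And>i. 0 < t $ i" "\<And>i. 0 < l $ i"
  shows "0 < poisson_prob t l x"
  unfolding poisson_prob_def using assms by (intro prod_pos) auto

abbreviation vec_expect :: "real ^ 'd \<Rightarrow> real ^ 'd \<Rightarrow> (nat ^ 'd \<Rightarrow> real) \<Rightarrow> real" where
  "vec_expect t l \<equiv> measure_pmf.expectation (poisson_vec t l)"

lemma map_poisson_vec_component: "map_pmf (\<lambda>x. x $ i) (poisson_vec t l) = poisson_pmf (t $ i * l $ i)"
  unfolding poisson_vec_def by (simp add: map_pmf_comp Pi_pmf_component)

lemma integrable_poisson_vec_component: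
  assumes "0 < t $ i" "0 < l $ i" and g: "exp_bounded g"
  shows "integrable (poisson_vec t l) (\<lambda>x. g (x $ i))"
    and "vec_expect t l (\<lambda>x. g (x $ i)) = pois (t $ i * l $ i) g"
proof -
  have m: "0 < t $ i * l $ i" using assms by simp
  show "integrable (poisson_vec t l) (\<lambda>x. g (x $ i))"
    using integrable_poisson_pmf(1)[OF m g] unfolding map_poisson_vec_component[symmetric] integrable_map_pmf_eq .
  show "vec_expect t l (\<lambda>x. g (x $ i)) = pois (t $ i * l $ i) g"
    using integrable_poisson_pmf(2)[OF m g] unfolding map_poisson_vec_component[symmetric] integral_map_pmf .
qed

section \<open>Independent pairs and the risk as an expectation\<close>

lemma measure_pair_pmf:
  fixes A :: "('a::countable) pmf" and B :: "('b::countable) pmf"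
  shows "measure_pmf (pair_pmf A B) = measure_pmf A \<Otimes>\<^sub>M measure_pmf B"
proof (rule measure_eqI_countable[of _ UNIV])
  have "sets (measure_pmf A \<Otimes>\<^sub>M measure_pmf B) = sets (count_space UNIV \<Otimes>\<^sub>M count_space UNIV)"
    by (intro sets_pair_measure_cong) auto
  also have "count_space UNIV \<Otimes>\<^sub>M count_space UNIV = (count_space UNIV :: ('a \<times> 'b) measure)"
    by (subst pair_measure_countable) auto
  finally show "sets (measure_pmf A \<Otimes>\<^sub>M measure_pmf B) = Pow UNIV" by simp
  fix z :: "'a \<times> 'b"
  obtain x y where z: "z = (x, y)" by (cases z)
  have "emeasure (measure_pmf A \<Otimes>\<^sub>M measure_pmf B) ({x} \<times> {y}) = emeasure A {x} * emeasure B {y}"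
    by (rule measure_pmf.emeasure_pair_measure_Times) auto
  then show "emeasure (pair_pmf A B) {z} = emeasure (measure_pmf A \<Otimes>\<^sub>M measure_pmf B) {z}"
    by (simp add: z emeasure_pmf_single pmf_pair ennreal_mult')
qed auto

lemma pair_pmf_Fubini:
  fixes A :: "('a::countable) pmf" and B :: "('b::countable) pmf" and f :: "'a \<times> 'b \<Rightarrow> real"
  assumes f: "integrable (pair_pmf A B) f"
  shows "x \<in> set_pmf A \<Longrightarrow> integrable B (\<lambda>y. f (x, y))"
    and "integrable A (\<lambda>x. measure_pmf.expectation B (\<lambda>y. f (x, y)))"
    and "measure_pmf.expectation A (\<lambda>x. measure_pmf.expectation B (\<lambda>y. f (x, y))) = measure_pmf.expectation (pair_pmf A B) f"
proof -
  interpret P: pair_sigma_finite "measure_pmf A" "measure_pmf B" ..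
  have f': "integrable (measure_pmf A \<Otimes>\<^sub>M measure_pmf B) f" using f by (simp only: measure_pair_pmf)
  show "x \<in> set_pmf A \<Longrightarrow> integrable B (\<lambda>y. f (x, y))"
    using P.AE_integrable_fst'[OF f'] by (auto simp: AE_measure_pmf_iff)
  show "integrable A (\<lambda>x. measure_pmf.expectation B (\<lambda>y. f (x, y)))"
    by (rule P.integrable_fst'[OF f'])
  show "measure_pmf.expectation A (\<lambda>x. measure_pmf.expectation B (\<lambda>y. f (x, y))) = measure_pmf.expectation (pair_pmf A B) f"
    unfolding measure_pair_pmf by (rule P.integral_fst'[OF f'])
qed

text \<open>Integrability makes the positive and negative parts finite, so the difference in
  \<open>ext_sum\<close> is an ordinary one and equals the Bochner integral.\<close>

lemma ext_sum_pmf: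
  fixes p :: "'a pmf"
  assumes g: "integrable p g"
  shows "ext_sum (\<lambda>x. ereal (pmf p x) * ereal (g x)) = ereal (measure_pmf.expectation p g)"
proof -
  let ?f = "\<lambda>x. pmf p x * g x"
  let ?p = "(\<integral>\<^sup>+x. ennreal (?f x) \<partial>count_space UNIV)"
  let ?n = "(\<integral>\<^sup>+x. ennreal (- ?f x) \<partial>count_space UNIV)"
  have int: "integrable (count_space UNIV) ?f"
    using g unfolding measure_pmf_eq_density by (subst (asm) integrable_density) auto
  have E: "measure_pmf.expectation p g = (\<integral>x. ?f x \<partial>count_space UNIV)"
    unfolding measure_pmf_eq_density by (subst integral_density) auto
  have fin: "?p < \<infinity>" "?n < \<infinity>"
    using int unfolding real_integrable_def by (simp_all add: less_top)
  have "ext_sum (\<lambda>x. ereal (pmf p x) * ereal (g x))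
     = enn2ereal ?p - enn2ereal ?n"
    unfolding ext_sum_def by (simp add: e2ennreal_ereal)
  also have "\<dots> = ereal (enn2real ?p) - ereal (enn2real ?n)"
    using fin by (cases "\<integral>\<^sup>+x. ennreal (?f x) \<partial>count_space UNIV"; cases "\<integral>\<^sup>+x. ennreal (- ?f x) \<partial>count_space UNIV") auto
  also have "\<dots> = ereal (measure_pmf.expectation p g)"
    unfolding E by (subst real_lebesgue_integral_def[OF int]) simp
  finally show ?thesis .
qed

text \<open>Positivity of \<open>q\<close> keeps \<open>log_ratio\<close> away from its infinite
  branch. Every \<open>x\<close> has positive probability, so Fubini gives integrability of the
  inner sum for each single \<open>x\<close> and not merely for almost all.\<close>

lemma KL_risk_expectation:
  assumes r: "\<And>i. 0 < r $ i" and s: "\<And>i. 0 < s $ i" and l: "\<And>i. 0 < l $ i"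
    and q: "\<And>x y. 0 < q x y"
    and int: "integrable (pair_pmf (poisson_vec r l) (poisson_vec s l)) (\<lambda>(x, y). ln (poisson_prob s l y / q x y))"
  shows "KL_risk r s q l = ereal (measure_pmf.expectation (pair_pmf (poisson_vec r l) (poisson_vec s l)) (\<lambda>(x, y). ln (poisson_prob s l y / q x y)))"
proof -
  let ?X = "poisson_vec r l" and ?Y = "poisson_vec s l"
  let ?L = "\<lambda>x y. ln (poisson_prob s l y / q x y)"
  have q0: "q x y \<noteq> 0" for x y using q[of x y] by simp
  have X: "pmf ?X x = poisson_prob r l x" for x by (rule pmf_poisson_vec[OF r l])
  have Y: "pmf ?Y x = poisson_prob s l x" for x by (rule pmf_poisson_vec[OF s l])
  have supp: "x \<in> set_pmf ?X" for x
    using poisson_prob_pos[OF r l, of x] by (simp add: set_pmf_iff X)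
  have "ext_sum (\<lambda>y. ereal (poisson_prob s l y) * log_ratio (poisson_prob s l y) (q x y)) = ereal (measure_pmf.expectation ?Y (?L x))" for x
    using ext_sum_pmf[of ?Y "?L x"] pair_pmf_Fubini(1)[OF int supp, of x] q0 by (simp add: log_ratio_def Y)
  then have "KL_risk r s q l = ext_sum (\<lambda>x. ereal (pmf ?X x) * ereal (measure_pmf.expectation ?Y (?L x)))"
    unfolding KL_risk_def by (simp add: X)
  also have "\<dots> = ereal (measure_pmf.expectation ?X (\<lambda>x. measure_pmf.expectation ?Y (?L x)))"
    using pair_pmf_Fubini(2)[OF int] by (intro ext_sum_pmf) simp
  also have "measure_pmf.expectation ?X (\<lambda>x. measure_pmf.expectation ?Y (?L x)) = measure_pmf.expectation (pair_pmf ?X ?Y) (\<lambda>(x, y). ?L x y)"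
    using pair_pmf_Fubini(3)[OF int] by simp
  finally show ?thesis .
qed

section \<open>Superposition and thinning of Poisson vectors\<close>

lemma poisson_prob_mult:
  assumes r: "\<And>i. 0 < r $ i" and s: "\<And>i. 0 < s $ i"
  shows "poisson_prob r l x * poisson_prob s l y
    = binom_weight (\<chi> i. r $ i / (r $ i + s $ i)) (x + y) x * poisson_prob (r + s) l (x + y)"
  unfolding poisson_prob_def binom_weight_def prod.distrib[symmetric]
proof (rule prod.cong[OF refl], goal_cases)
  case (1 i)
  let ?r = "r $ i" and ?s = "s $ i" and ?l = "l $ i" and ?x = "x $ i" and ?y = "y $ i"
  have rs: "?r + ?s \<noteq> 0" "0 < ?r + ?s" using r[of i] s[of i] by simp_all
  have q: "1 - ?r / (?r + ?s) = ?s / (?r + ?s)" using rs by (simp add: field_simps)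
  have b: "real (?x + ?y choose ?x) = fact (?x + ?y) / (fact ?x * fact ?y)"
    by (simp add: binomial_fact)
  have e: "exp (- ((?r + ?s) * ?l)) = exp (- (?r * ?l)) * exp (- (?s * ?l))"
    by (simp add: exp_add[symmetric] algebra_simps)
  have pw: "(?r / (?r + ?s)) ^ ?x * (?s / (?r + ?s)) ^ ?y * ((?r + ?s) * ?l) ^ (?x + ?y) = (?r * ?l) ^ ?x * (?s * ?l) ^ ?y"
  proof -
    have "(?r / (?r + ?s)) ^ ?x * (?s / (?r + ?s)) ^ ?y * ((?r + ?s) * ?l) ^ (?x + ?y)
      = (?r / (?r + ?s) * ((?r + ?s) * ?l)) ^ ?x * (?s / (?r + ?s) * ((?r + ?s) * ?l)) ^ ?y"
      by (simp only: power_add power_mult_distrib mult_ac)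
    also have "\<dots> = (?r * ?l) ^ ?x * (?s * ?l) ^ ?y" using rs by simp
    finally show ?thesis .
  qed
  have "real (?x + ?y choose ?x) * (?r / (?r + ?s)) ^ ?x * (?s / (?r + ?s)) ^ ?y * (((?r + ?s) * ?l) ^ (?x + ?y) * exp (- ((?r + ?s) * ?l)) / fact (?x + ?y))
    = ((?r / (?r + ?s)) ^ ?x * (?s / (?r + ?s)) ^ ?y * ((?r + ?s) * ?l) ^ (?x + ?y)) * (exp (- (?r * ?l)) * exp (- (?s * ?l))) / (fact ?x * fact ?y)"
    unfolding b e by simp
  also have "\<dots> = ((?r * ?l) ^ ?x * exp (- (?r * ?l)) / fact ?x) * ((?s * ?l) ^ ?y * exp (- (?s * ?l)) / fact ?y)"
    unfolding pw by simp
  finally show ?case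
    by (simp add: q)
qed

definition marginal :: "real ^ 'd \<Rightarrow> (real ^ 'd \<Rightarrow> real) \<Rightarrow> nat ^ 'd \<Rightarrow> real" where
  "marginal t \<pi> x = (LINT l:positive_orthant|lborel. poisson_prob t l x * \<pi> l)"

locale poisson_pair =
  fixes r s l :: "real ^ 'd"
  assumes r: "\<And>i. 0 < r $ i" and s: "\<And>i. 0 < s $ i" and l: "\<And>i. 0 < l $ i"
begin

abbreviation thinning :: "real ^ 'd" where
  "thinning \<equiv> \<chi> i. r $ i / (r $ i + s $ i)"

lemma rs: "0 < (r + s) $ i"
  using r[of i] s[of i] by simp

lemma binom_weight_thinning_nonneg: "0 \<le> binom_weight thinning z x"
  by (rule binom_weight_nonneg) (use r s in \<open>simp_all add: add_pos_pos\<close>)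

text \<open>Disintegration along the sum: the map from (x, y) to (x + y, x) is a bijection onto the
  pairs with x <= z, and for those the natural subtraction z - x recovers y.\<close>

lemma nn_integral_pair_poisson_vec:
  "(\<integral>\<^sup>+w. F (fst w) (snd w) \<partial>pair_pmf (poisson_vec r l) (poisson_vec s l))
    = (\<integral>\<^sup>+z. (\<Sum>x\<in>{..z}. ennreal (binom_weight thinning z x) * F x (z - x)) \<partial>poisson_vec (r + s) l)"
proof -
  let ?B = "\<lambda>z. (\<Sum>x\<in>{..z}. ennreal (binom_weight thinning z x) * F x (z - x))"
  let ?XY = "(pair_pmf (poisson_vec r l) (poisson_vec s l))"
  define f where "f = (\<lambda>(z, x). ennreal (poisson_prob (r + s) l z) * (ennreal (binom_weight thinning z x) * F x (z - x)))"
  define S where "S = {(z :: nat ^ 'd, x). x \<le> z}"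
  have "(\<integral>\<^sup>+w. F (fst w) (snd w) \<partial>pair_pmf (poisson_vec r l) (poisson_vec s l))
    = (\<integral>\<^sup>+w. ennreal (pmf ?XY w) * F (fst w) (snd w) \<partial>count_space UNIV)"
    by (rule nn_integral_measure_pmf)
  also have "\<dots> = (\<integral>\<^sup>+w. f ((\<lambda>(x, y). (x + y, x)) w) \<partial>count_space UNIV)"
  proof (rule nn_integral_cong, goal_cases)
    case (1 w)
    obtain x y where w: "w = (x, y)" by (cases w)
    have "pmf ?XY w = poisson_prob (r + s) l (x + y) * binom_weight thinning (x + y) x"
      using poisson_prob_mult[OF r s, of l x y]
      by (simp add: w pmf_pair pmf_poisson_vec[OF r l] pmf_poisson_vec[OF s l] mult.commute)
    then show ?case
      using binom_weight_thinning_nonneg poisson_prob_pos[OF rs l] by (simp add: w f_def ennreal_mult less_imp_le mult.assoc)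
  qed
  also have "\<dots> = (\<integral>\<^sup>+w. f w \<partial>count_space S)"
  proof (rule nn_integral_bij_count_space)
    show "bij_betw (\<lambda>(x, y). (x + y, x)) UNIV S"
    proof (rule bij_betw_byWitness[where f' = "\<lambda>(z, x). (x, z - x)"])
      show "\<forall>a\<in>S. (\<lambda>(x, y). (x + y, x)) ((\<lambda>(z, x). (x, z - x)) a) = a"
        by (auto simp: S_def less_eq_vec_def vec_eq_iff)
    qed (auto simp: S_def less_eq_vec_def vec_eq_iff)
  qed
  also have "\<dots> = (\<integral>\<^sup>+w. f w * indicator S w \<partial>count_space UNIV)"
    by (simp add: nn_integral_count_space_indicator)
  also have "\<dots> = (\<integral>\<^sup>+z. \<integral>\<^sup>+x. f (z, x) * indicator S (z, x) \<partial>count_space UNIV \<partial>count_space UNIV)"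
    by (rule nn_integral_fst_count_space[symmetric])
  also have "\<dots> = (\<integral>\<^sup>+z. ennreal (pmf (poisson_vec (r + s) l) z) * (?B z) \<partial>count_space UNIV)"
  proof (rule nn_integral_cong, goal_cases)
    case (1 z)
    have "(\<integral>\<^sup>+x. f (z, x) * indicator S (z, x) \<partial>count_space UNIV) = (\<integral>\<^sup>+x. f (z, x) * indicator {..z} x \<partial>count_space UNIV)"
      by (intro nn_integral_cong) (auto simp: S_def split: split_indicator)
    also have "\<dots> = (\<integral>\<^sup>+x. f (z, x) \<partial>count_space {..z})"
      by (simp add: nn_integral_count_space_indicator)
    also have "\<dots> = (\<Sum>x\<in>{..z}. f (z, x))"
      by (rule nn_integral_count_space_finite) simp
    finally show ?case
      by (simp add: f_def sum_distrib_left pmf_poisson_vec[OF rs l])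
  qed
  also have "\<dots> = (\<integral>\<^sup>+z. ?B z \<partial>poisson_vec (r + s) l)"
    by (rule nn_integral_measure_pmf[symmetric])
  finally show ?thesis .
qed

lemma map_add_pair_poisson_vec:
  "map_pmf (\<lambda>(x, y). x + y) (pair_pmf (poisson_vec r l) (poisson_vec s l)) = poisson_vec (r + s) l"
proof (rule pmf_eqI)
  fix z
  let ?P = "(pair_pmf (poisson_vec r l) (poisson_vec s l))"
  let ?i = "\<lambda>u. (\<Sum>x\<in>{..u}. ennreal (binom_weight thinning u x) * indicator {z} (x + (u - x)))"
  have "ennreal (pmf (map_pmf (\<lambda>(x, y). x + y) ?P) z)
    = (\<integral>\<^sup>+u. indicator {z} u \<partial>map_pmf (\<lambda>(x, y). x + y) ?P)"
    unfolding emeasure_pmf_single[symmetric] by (rule nn_integral_indicator[symmetric]) simp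
  also have "\<dots> = (\<integral>\<^sup>+w. indicator {z} (fst w + snd w) \<partial>pair_pmf (poisson_vec r l) (poisson_vec s l))"
    by (simp add: case_prod_beta)
  also have "\<dots> = (\<integral>\<^sup>+u. (?i u) \<partial>poisson_vec (r + s) l)"
    by (rule nn_integral_pair_poisson_vec)
  also have "\<dots> = (\<integral>\<^sup>+u. indicator {z} u \<partial>poisson_vec (r + s) l)"
  proof (rule nn_integral_cong, goal_cases)
    case (1 u)
    have "x + (u - x) = u" if "x \<le> u" for x using that by (auto simp: less_eq_vec_def vec_eq_iff)
    then have "(?i u) = (\<Sum>x\<in>{..u}. ennreal (binom_weight thinning u x)) * indicator {z} u"
      by (simp add: sum_distrib_right)
    also have "(\<Sum>x\<in>{..u}. ennreal (binom_weight thinning u x)) = 1"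
      using binom_weight_thinning_nonneg by (subst sum_ennreal) (simp_all add: sum_binom_weight)
    finally show ?case by simp
  qed
  also have "\<dots> = ennreal (pmf (poisson_vec (r + s) l) z)" by (simp add: emeasure_pmf_single)
  finally show "pmf (map_pmf (\<lambda>(x, y). x + y) ?P) z = pmf (poisson_vec (r + s) l) z" by simp
qed

lemma expectation_pair_diff:
  fixes A B :: "nat ^ 'd \<Rightarrow> real"
  assumes A: "integrable (poisson_vec (r + s) l) A" and B: "integrable (poisson_vec r l) B"
  shows "integrable (pair_pmf (poisson_vec r l) (poisson_vec s l)) (\<lambda>(x, y). A (x + y) - B x)"
    and "measure_pmf.expectation (pair_pmf (poisson_vec r l) (poisson_vec s l)) (\<lambda>(x, y). A (x + y) - B x)
      = vec_expect (r + s) l A - vec_expect r l B"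
proof -
  let ?P = "pair_pmf (poisson_vec r l) (poisson_vec s l)"
  have A': "integrable ?P (\<lambda>w. A (fst w + snd w))"
    using A unfolding map_add_pair_poisson_vec[symmetric] integrable_map_pmf_eq by (simp add: case_prod_beta)
  have EA: "measure_pmf.expectation ?P (\<lambda>w. A (fst w + snd w)) = vec_expect (r + s) l A"
    unfolding map_add_pair_poisson_vec[symmetric] integral_map_pmf by (simp add: case_prod_beta)
  have B': "integrable ?P (\<lambda>w. B (fst w))"
  proof -
    have "integrable (map_pmf fst ?P) B" using B by (simp only: map_fst_pair_pmf)
    then show ?thesis by (simp only: integrable_map_pmf_eq)
  qed
  show "integrable ?P (\<lambda>(x, y). A (x + y) - B x)"
    using Bochner_Integration.integrable_diff[OF A' B'] by (simp only: case_prod_beta')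
  show "measure_pmf.expectation ?P (\<lambda>(x, y). A (x + y) - B x)
      = vec_expect (r + s) l A - vec_expect r l B"
    using Bochner_Integration.integral_diff[OF A' B'] EA by (simp add: case_prod_beta')
qed

text \<open>The binomial factor of \<open>poisson_prob_mult\<close> does not depend on the rates, so
  it leaves the integral over the prior.\<close>

lemma predictive_eq_marginal:
  shows "predictive r s \<pi> x y = binom_weight thinning (x + y) x * marginal (r + s) \<pi> (x + y) / marginal r \<pi> x"
proof -
  have "(LINT l:positive_orthant|lborel. poisson_prob r l x * poisson_prob s l y * \<pi> l)
    = (LINT l:positive_orthant|lborel. binom_weight thinning (x + y) x * (poisson_prob (r + s) l (x + y) * \<pi> l))"
    by (simp only: poisson_prob_mult[OF r s] mult.assoc)
  also have "\<dots> = binom_weight thinning (x + y) x * marginal (r + s) \<pi> (x + y)"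
    unfolding marginal_def by (rule set_integral_mult_right)
  finally show ?thesis by (simp add: predictive_def marginal_def)
qed

text \<open>The chain rule for relative entropy. The binomial factors cancel in the log ratio, which
  splits into a function of x + y minus a function of x: the risk is the divergence of the true law
  from the marginal at durations r + s, less the one at r.\<close>

lemma KL_risk_predictive:
  assumes m: "\<And>x. 0 < marginal r \<pi> x" and m': "\<And>x. 0 < marginal (r + s) \<pi> x"
    and A: "integrable (poisson_vec (r + s) l) (\<lambda>z. ln (poisson_prob (r + s) l z / marginal (r + s) \<pi> z))"
    and B: "integrable (poisson_vec r l) (\<lambda>x. ln (poisson_prob r l x / marginal r \<pi> x))"
  shows "KL_risk r s (predictive r s \<pi>) l = ereal
    (vec_expect (r + s) l (\<lambda>z. ln (poisson_prob (r + s) l z / marginal (r + s) \<pi> z))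
      - vec_expect r l (\<lambda>x. ln (poisson_prob r l x / marginal r \<pi> x)))"
proof -
  let ?L = "\<lambda>x y. ln (poisson_prob s l y / predictive r s \<pi> x y)"
  note pos = poisson_prob_pos[OF r l] poisson_prob_pos[OF s l] poisson_prob_pos[OF rs l]
  have bw: "0 < binom_weight thinning (x + y) x" for x y
    using poisson_prob_mult[OF r s, of l x y] mult_pos_pos[OF pos(1)[of x] pos(2)[of y]] pos(3)[of "x + y"]
    by (metis less_asym mult_neg_pos mult_zero_left not_less_iff_gr_or_eq)
  have q: "0 < predictive r s \<pi> x y" for x y
    unfolding predictive_eq_marginal using bw m m' by simp
  have L: "(?L x y)
    = ln (poisson_prob (r + s) l (x + y) / marginal (r + s) \<pi> (x + y)) - ln (poisson_prob r l x / marginal r \<pi> x)" for x y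
  proof -
    let ?a = "poisson_prob (r + s) l (x + y) / marginal (r + s) \<pi> (x + y)"
    let ?b = "poisson_prob r l x / marginal r \<pi> x"
    have ab: "0 < ?a" "0 < ?b" using pos m m' by simp_all
    have "poisson_prob s l y = binom_weight thinning (x + y) x * poisson_prob (r + s) l (x + y) / poisson_prob r l x"
      using poisson_prob_mult[OF r s, of l x y] pos(1)[of x] by (simp add: field_simps)
    then have "poisson_prob s l y / predictive r s \<pi> x y = ?a / ?b"
      unfolding predictive_eq_marginal
      using bw[of x y] pos(1)[of x] m[of x] m'[of "x + y"] by (simp add: field_simps)
    then show ?thesis using ab by (simp only: ln_divide_pos)
  qed
  have "integrable (pair_pmf (poisson_vec r l) (poisson_vec s l)) (\<lambda>(x, y). (?L x y))"
    unfolding L using expectation_pair_diff(1)[OF A B] .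
  then have "KL_risk r s (predictive r s \<pi>) l = ereal (measure_pmf.expectation (pair_pmf (poisson_vec r l) (poisson_vec s l)) (\<lambda>(x, y). (?L x y)))"
    by (intro KL_risk_expectation r s l q)
  then show ?thesis unfolding L expectation_pair_diff(2)[OF A B] .
qed

end

section \<open>Marginals and domination\<close>

lemma borel_measurable_poisson_prob [measurable]: "(\<lambda>l. poisson_prob t l x) \<in> borel_measurable borel"
  unfolding poisson_prob_def
  by (intro borel_measurable_prod measurable_compose[OF borel_measurable_nth, of "\<lambda>u. (_ * u) ^ _ * exp (- (_ * u)) / fact _"]) measurable

lemma borel_measurable_jeffreys_prior [measurable]: "jeffreys_prior \<in> borel_measurable borel"
  unfolding jeffreys_prior_def[abs_def]
  by (intro borel_measurable_prod measurable_compose[OF borel_measurable_nth]) measurable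

lemma positive_orthant_borel [measurable]: "positive_orthant \<in> sets (borel :: (real ^ 'd) measure)"
proof -
  have "open (\<Inter>i::'d. {l :: real ^ 'd. 0 < l $ i})"
    by (intro open_INT ballI open_Collect_less continuous_intros) auto
  moreover have "positive_orthant = (\<Inter>i::'d. {l :: real ^ 'd. 0 < l $ i})"
    by (auto simp: positive_orthant_def)
  ultimately show ?thesis by simp
qed

definition jeffreys_marginal :: "real ^ 'd \<Rightarrow> nat ^ 'd \<Rightarrow> real" where
  "jeffreys_marginal t x = (\<Prod>i\<in>UNIV. Gamma (real (x $ i) + 1 / 2) / (fact (x $ i) * sqrt (t $ i)))"

lemma jeffreys_marginal_pos: "(\<And>i. 0 < t $ i) \<Longrightarrow> 0 < jeffreys_marginal t x"
  unfolding jeffreys_marginal_def by (intro prod_pos) (simp add: Gamma_real_pos)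

lemma poisson_prob_square:
  assumes t: "\<And>i. 0 < t $ i" and g: "\<And>i. 0 < \<gamma> $ i"
  shows "(\<Prod>i\<in>UNIV. sqrt (\<gamma> $ i)) * poisson_prob t (\<chi> i. \<gamma> $ i * (\<theta> $ i)^2) x
    = jeffreys_marginal t x * post_density (\<chi> i. t $ i * \<gamma> $ i) x \<theta>"
  unfolding poisson_prob_def jeffreys_marginal_def post_density_def prod.distrib[symmetric]
proof (rule prod.cong[OF refl], goal_cases)
  case (1 i)
  have "0 < Gamma (real (x $ i) + 1 / 2)" by (rule Gamma_real_pos) simp
  then have G: "Gamma (real (x $ i) + 1 / 2) \<noteq> 0" by (metis less_irrefl)
  have p: "(\<theta> $ i) ^ (2 * x $ i) = ((\<theta> $ i)^2) ^ (x $ i)" by (rule power_mult)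
  have "Gamma (real (x $ i) + 1 / 2) / (fact (x $ i) * sqrt (t $ i)) * post_dens (t $ i * \<gamma> $ i) (x $ i) (\<theta> $ i)
    = sqrt (\<gamma> $ i) * ((t $ i * \<gamma> $ i) ^ (x $ i) * ((\<theta> $ i)^2) ^ (x $ i) * exp (- (t $ i * \<gamma> $ i) * (\<theta> $ i)^2) / fact (x $ i))"
    unfolding post_dens_def p real_sqrt_mult using G t[of i] by (simp add: field_simps)
  also have "(t $ i * \<gamma> $ i) ^ (x $ i) * ((\<theta> $ i)^2) ^ (x $ i) = (t $ i * (\<gamma> $ i * (\<theta> $ i)^2)) ^ (x $ i)"
    by (simp only: power_mult_distrib mult.assoc)
  finally show ?case
    by (simp add: mult.assoc)
qed

text \<open>Substituting \<gamma> \<theta>^2 for the rate absorbs the Jeffreys factor. Since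
  \<theta> now ranges over the whole space while a square root is nonnegative, \<open>F\<close> is
  evaluated at the absolute values.\<close>

lemma marginal_modified_jeffreys:
  fixes F :: "real ^ 'd \<Rightarrow> real"
  assumes t: "\<And>i. 0 < t $ i" and g: "\<And>i. 0 < \<gamma> $ i" and F[measurable]: "F \<in> borel_measurable borel" and F0: "\<And>\<theta>. 0 \<le> F \<theta>"
  shows "marginal t (modified_jeffreys_prior F (\<lambda>l. \<chi> i. sqrt (l $ i / \<gamma> $ i))) x
    = jeffreys_marginal t x * enn2real (\<integral>\<^sup>+\<theta>. ennreal (F (\<chi> i. \<bar>\<theta> $ i\<bar>) * post_density (\<chi> i. t $ i * \<gamma> $ i) x \<theta>) \<partial>lborel)"
proof -
  let ?\<theta> = "\<lambda>l::real ^ 'd. \<chi> i. sqrt (l $ i / \<gamma> $ i)"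
  let ?G = "\<Prod>i\<in>UNIV. sqrt (\<gamma> $ i)"
  let ?F = "\<lambda>l. ennreal (?G * poisson_prob t l x * F (?\<theta> l))"
  let ?D = "\<lambda>l. (\<Prod>i\<in>UNIV. ennreal (sqrt_density (\<gamma> $ i) (l $ i)))"
  let ?P = "\<lambda>\<theta>. F (\<chi> i. \<bar>\<theta> $ i\<bar>) * post_density (\<chi> i. t $ i * \<gamma> $ i) x \<theta>"
  let ?f = "\<lambda>l. indicator positive_orthant l *\<^sub>R (poisson_prob t l x * modified_jeffreys_prior F ?\<theta> l)"
  have f0: "0 \<le> ?f l" for l
  proof (cases "l \<in> positive_orthant")
    case True
    then have "0 < poisson_prob t l x" by (intro poisson_prob_pos t) (simp add: positive_orthant_def)
    moreover have "0 \<le> modified_jeffreys_prior F ?\<theta> l"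
      unfolding modified_jeffreys_prior_def jeffreys_prior_def by (intro mult_nonneg_nonneg F0 prod_nonneg) auto
    ultimately show ?thesis by simp
  qed simp
  have "marginal t (modified_jeffreys_prior F ?\<theta>) x = enn2real (\<integral>\<^sup>+l. ennreal (?f l) \<partial>lborel)"
    unfolding marginal_def set_lebesgue_integral_def
    by (rule integral_eq_nn_integral) (use f0 in \<open>auto simp: modified_jeffreys_prior_def[abs_def]\<close>)
  also have "(\<integral>\<^sup>+l. ennreal (?f l) \<partial>lborel) = (\<integral>\<^sup>+l. ?F l * (?D l) \<partial>lborel)"
  proof (rule nn_integral_cong, goal_cases)
    case (1 l)
    show ?case
    proof (cases "l \<in> positive_orthant")
      case True
      then have l: "0 < l $ i" for i by (simp add: positive_orthant_def)
      have "?D l = ennreal (\<Prod>i\<in>UNIV. (l $ i) powr (- 1 / 2) / sqrt (\<gamma> $ i))"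
        using l g by (subst prod_ennreal) (simp_all add: sqrt_density_def less_imp_le)
      also have "(\<Prod>i\<in>UNIV. (l $ i) powr (- 1 / 2) / sqrt (\<gamma> $ i)) = jeffreys_prior l / ?G"
        by (simp add: jeffreys_prior_def prod_dividef)
      finally have P: "?D l = ennreal (jeffreys_prior l / ?G)" .
      have G0: "0 < ?G" using g by (intro prod_pos) simp
      have "0 \<le> jeffreys_prior l" unfolding jeffreys_prior_def by (intro prod_nonneg) simp
      then show ?thesis
        unfolding P using True G0 poisson_prob_pos[OF t l, of x] F0[of "?\<theta> l"]
        by (subst ennreal_mult[symmetric]) (simp_all add: modified_jeffreys_prior_def mult_ac less_imp_neq[OF g, symmetric])
    next
      case False
      then obtain j where "\<not> 0 < l $ j" by (auto simp: positive_orthant_def)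
      then have "ennreal (sqrt_density (\<gamma> $ j) (l $ j)) = 0" by (simp add: sqrt_density_def)
      then have "?D l = 0" by (intro prod_zero) auto
      with False show ?thesis by simp
    qed
  qed
  also have "\<dots> = (\<integral>\<^sup>+\<theta>. ?F (\<chi> i. \<gamma> $ i * (\<theta> $ i)^2) \<partial>lborel)"
    by (rule nn_integral_square_subst) (use g in auto)
  also have "\<dots> = (\<integral>\<^sup>+\<theta>. ennreal (jeffreys_marginal t x) * ennreal (?P \<theta>) \<partial>lborel)"
  proof (rule nn_integral_cong, goal_cases)
    case (1 \<theta>)
    have "?\<theta> (\<chi> i. \<gamma> $ i * (\<theta> $ i)^2) = (\<chi> i. \<bar>\<theta> $ i\<bar>)"
    proof -
      have "\<gamma> $ i * (\<theta> $ i)^2 / \<gamma> $ i = (\<theta> $ i)^2" for i using g[of i] by simp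
      then show ?thesis by (simp add: vec_eq_iff)
    qed
    then have "?F (\<chi> i. \<gamma> $ i * (\<theta> $ i)^2) = ennreal (jeffreys_marginal t x * (?P \<theta>))"
      by (simp only: poisson_prob_square[OF t g] mult_ac)
    then show ?case
      using jeffreys_marginal_pos[OF t, of x] by (simp only: ennreal_mult' less_imp_le)
  qed
  also have "\<dots> = ennreal (jeffreys_marginal t x) * (\<integral>\<^sup>+\<theta>. ennreal (?P \<theta>) \<partial>lborel)"
  proof (rule nn_integral_cmult)
    show "(\<lambda>\<theta>. ennreal (?P \<theta>)) \<in> borel_measurable lborel"
      by measurable
  qed
  finally show ?thesis using jeffreys_marginal_pos[OF t, of x] by (simp add: enn2real_mult)
qed

lemma nn_integral_post_density:
  assumes t: "\<And>i. 0 < \<tau> $ i"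
  shows "(\<integral>\<^sup>+\<theta>. ennreal (post_density \<tau> x \<theta>) \<partial>lborel) = 1"
proof -
  have "(\<integral>\<^sup>+\<theta>. ennreal (post_density \<tau> x \<theta>) \<partial>lborel) = (\<integral>\<^sup>+\<theta>. (\<Prod>i\<in>UNIV. ennreal (post_dens (\<tau> $ i) (x $ i) (\<theta> $ i))) \<partial>lborel)"
    using t by (simp add: post_density_def prod_ennreal less_imp_le)
  also have "\<dots> = (\<Prod>i\<in>UNIV. \<integral>\<^sup>+t. ennreal (post_dens (\<tau> $ i) (x $ i) t) \<partial>lborel)"
    by (rule nn_integral_lborel_vec_prod) measurable
  finally show ?thesis by (simp only: nn_integral_post_dens[OF t] prod.neutral_const)
qed

lemma marginal_jeffreys:
  fixes t :: "real ^ 'd"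
  assumes t: "\<And>i. 0 < t $ i"
  shows "marginal t jeffreys_prior x = jeffreys_marginal t x"
proof -
  have "(jeffreys_prior :: real ^ 'd \<Rightarrow> real) = modified_jeffreys_prior (\<lambda>_. 1) (\<lambda>l. \<chi> i. sqrt (l $ i / (\<chi> i. 1) $ i))"
    by (simp add: modified_jeffreys_prior_def fun_eq_iff)
  then have "marginal t jeffreys_prior x = marginal t (modified_jeffreys_prior (\<lambda>_. 1) (\<lambda>l. \<chi> i. sqrt (l $ i / (\<chi> i. 1) $ i))) x"
    by (simp only:)
  also have "\<dots> = jeffreys_marginal t x * enn2real (\<integral>\<^sup>+\<theta>. ennreal (1 * post_density (\<chi> i. t $ i * (\<chi> i. 1) $ i) x \<theta>) \<partial>lborel)"
    by (rule marginal_modified_jeffreys) (use t in auto)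
  also have "\<dots> = jeffreys_marginal t x"
    using nn_integral_post_density[of "\<chi> i. t $ i * (\<chi> i. 1) $ i" x] t by simp
  finally show ?thesis .
qed

section \<open>Symmetrisation over sign changes\<close>

definition sign_vecs :: "(real ^ 'd) set" where
  "sign_vecs = {a. \<forall>i. a $ i \<in> {1, - 1}}"

lemma finite_sign_vecs [simp]: "finite sign_vecs"
  unfolding sign_vecs_def by (rule finite_vec_components) simp

lemma card_sign_vecs_pos: "0 < card (sign_vecs :: (real ^ 'd) set)"
proof -
  have "(\<chi> i. 1) \<in> (sign_vecs :: (real ^ 'd) set)" by (simp add: sign_vecs_def)
  then show ?thesis by (auto simp: card_gt_0_iff)
qed

lemma sign_vec_power2:
  assumes "a \<in> sign_vecs"
  shows "(a $ i) * (a $ i) = 1"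
  using assms by (auto simp: sign_vecs_def dest!: spec[of _ i])

text \<open>Sign vectors form a group under componentwise multiplication, in which every element is
  its own inverse, so multiplying by \<open>b\<close> permutes the summands.\<close>

lemma shrinkage_fun_sign:
  fixes \<theta> :: "real ^ 'd"
  assumes b: "b \<in> sign_vecs"
  shows "shrinkage_fun V \<alpha> (\<chi> i. b $ i * \<theta> $ i) = shrinkage_fun V \<alpha> \<theta>"
  unfolding shrinkage_fun_def sign_vecs_def[symmetric]
proof (rule sum.reindex_bij_witness[of _ "\<lambda>a. \<chi> i. a $ i * b $ i" "\<lambda>a. \<chi> i. a $ i * b $ i"])
  fix a :: "real ^ 'd" assume a: "a \<in> sign_vecs"
  show "(\<chi> i. (\<chi> i. a $ i * b $ i) $ i * b $ i) = a" "(\<chi> i. (\<chi> i. a $ i * b $ i) $ i * b $ i) = a"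
    using sign_vec_power2[OF b] by (simp_all add: vec_eq_iff mult.assoc)
  show "(\<chi> i. a $ i * b $ i) \<in> sign_vecs" "(\<chi> i. a $ i * b $ i) \<in> sign_vecs"
    using a b by (auto simp: sign_vecs_def) (metis mult_1 mult_minus1 minus_minus)+
  show "sq_dist V (\<chi> i. (\<chi> i. a $ i * b $ i) $ i * \<theta> $ i) powr - \<alpha> = sq_dist V (\<chi> i. a $ i * (\<chi> i. b $ i * \<theta> $ i) $ i) powr - \<alpha>"
    by (simp add: mult.assoc)
qed

lemma shrinkage_fun_abs:
  fixes \<theta> :: "real ^ 'd"
  shows "shrinkage_fun V \<alpha> (\<chi> i. \<bar>\<theta> $ i\<bar>) = shrinkage_fun V \<alpha> \<theta>"
proof -
  let ?b = "(\<chi> i. if \<theta> $ i < 0 then - 1 else 1) :: real ^ 'd"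
  have "?b \<in> sign_vecs" by (simp add: sign_vecs_def)
  from shrinkage_fun_sign[OF this, of V \<alpha> \<theta>]
  have "shrinkage_fun V \<alpha> (\<chi> i. ?b $ i * \<theta> $ i) = shrinkage_fun V \<alpha> \<theta>" .
  moreover have "(\<chi> i. ?b $ i * \<theta> $ i) = (\<chi> i. \<bar>\<theta> $ i\<bar>)" by (simp add: vec_eq_iff)
  ultimately show ?thesis by simp
qed

lemma orthogonal_transformation_sign:
  assumes a: "a \<in> sign_vecs"
  shows "orthogonal_transformation (\<lambda>\<theta> :: real ^ 'd. \<chi> i. a $ i * \<theta> $ i)"
  unfolding orthogonal_transformation_def
proof (intro conjI allI)
  show "linear (\<lambda>\<theta> :: real ^ 'd. \<chi> i. a $ i * \<theta> $ i)"
    by (rule linearI) (simp_all add: vec_eq_iff algebra_simps)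
  fix v w :: "real ^ 'd"
  have "(a $ i * v $ i) * (a $ i * w $ i) = v $ i * w $ i" for i
    using sign_vec_power2[OF a, of i] by (metis mult.assoc mult.commute mult_1)
  then have "(\<Sum>i\<in>UNIV. (a $ i * v $ i) * (a $ i * w $ i)) = (\<Sum>i\<in>UNIV. v $ i * w $ i)"
    by (intro sum.cong) (simp_all only:)
  then show "(\<chi> i. a $ i * v $ i) \<bullet> (\<chi> i. a $ i * w $ i) = v \<bullet> w"
    by (simp add: inner_vec_def)
qed

lemma borel_measurable_shrinkage_fun [measurable]:
  fixes V :: "(real ^ 'd) set"
  shows "shrinkage_fun V \<alpha> \<in> borel_measurable borel"
  unfolding shrinkage_fun_def[abs_def]
proof (intro borel_measurable_sum)
  fix a :: "real ^ 'd"
  show "(\<lambda>\<theta>. sq_dist V (\<chi> i. a $ i * \<theta> $ i) powr - \<alpha>) \<in> borel_measurable borel" by measurable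
qed

context shrinkage_setup
begin

text \<open>The posterior density is even in each coordinate and a sign change is orthogonal, so
  every summand contributes the same \<open>post_mean\<close>. The symmetrisation thus costs only a
  constant factor, which cancels in the predictive distribution.\<close>

lemma nn_integral_shrinkage_fun:
  assumes t: "\<And>i. 0 < \<tau> $ i"
  shows "(\<integral>\<^sup>+\<theta>. ennreal (shrinkage_fun V \<alpha> \<theta> * post_density \<tau> x \<theta>) \<partial>lborel)
    = ennreal (card (sign_vecs :: (real ^ 'd) set) * post_mean V \<alpha> \<tau> x)"
proof -
  let ?g = "\<lambda>\<theta>. ennreal (sq_dist V \<theta> powr (- \<alpha>) * post_density \<tau> x \<theta>)"
  let ?f = "\<lambda>\<theta>. shrinkage_fun V \<alpha> \<theta> * post_density \<tau> x \<theta>"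
  let ?m = "\<lambda>a \<theta>. (\<chi> i. a $ i * \<theta> $ i)"
  have even: "post_density \<tau> x (?m a \<theta>) = post_density \<tau> x \<theta>" if a: "a \<in> sign_vecs" for a \<theta>
    unfolding post_density_def
  proof (rule prod.cong[OF refl], goal_cases)
    case (1 i)
    have "(a $ i * \<theta> $ i)^2 = (\<theta> $ i)^2"
      using sign_vec_power2[OF a, of i] by (simp add: power_mult_distrib power2_eq_square)
    then show ?case
      by (simp add: post_dens_def power_mult)
  qed
  have "(\<integral>\<^sup>+\<theta>. ennreal (?f \<theta>) \<partial>lborel)
    = (\<integral>\<^sup>+\<theta>. (\<Sum>a\<in>sign_vecs. ?g (?m a \<theta>)) \<partial>lborel)"
  proof (rule nn_integral_cong, goal_cases)
    case (1 \<theta>)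
    have "?f \<theta> = (\<Sum>a\<in>sign_vecs. sq_dist V (?m a \<theta>) powr (- \<alpha>) * post_density \<tau> x (?m a \<theta>))"
      unfolding shrinkage_fun_def sign_vecs_def[symmetric] sum_distrib_right by (intro sum.cong) (simp_all add: even)
    then show ?case
      using t by (subst sum_ennreal) simp_all
  qed
  also have "\<dots> = (\<Sum>a\<in>sign_vecs. \<integral>\<^sup>+\<theta>. ?g (?m a \<theta>) \<partial>lborel)"
    by (rule nn_integral_sum) measurable
  also have "\<dots> = (\<Sum>a\<in>(sign_vecs :: (real ^ 'd) set). ennreal (post_mean V \<alpha> \<tau> x))"
  proof (rule sum.cong[OF refl])
    fix a :: "real ^ 'd" assume "a \<in> sign_vecs"
    then show "(\<integral>\<^sup>+\<theta>. ?g (?m a \<theta>) \<partial>lborel) = ennreal (post_mean V \<alpha> \<tau> x)"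
      unfolding ennreal_post_mean[OF t] by (intro nn_integral_lborel_orthogonal orthogonal_transformation_sign) measurable
  qed
  also have "\<dots> = ennreal (card (sign_vecs :: (real ^ 'd) set) * post_mean V \<alpha> \<tau> x)"
    by (simp add: ennreal_mult' ennreal_of_nat_eq_real_of_nat)
  finally show ?thesis .
qed

lemma marginal_shrinkage:
  assumes t: "\<And>i. 0 < t $ i" and g: "\<And>i. 0 < \<gamma> $ i"
  shows "marginal t (modified_jeffreys_prior (shrinkage_fun V \<alpha>) (\<lambda>l. \<chi> i. sqrt (l $ i / \<gamma> $ i))) x
    = jeffreys_marginal t x * (card (sign_vecs :: (real ^ 'd) set) * post_mean V \<alpha> (\<chi> i. t $ i * \<gamma> $ i) x)"
proof -
  have tg: "0 < (\<chi> i. t $ i * \<gamma> $ i) $ i" for i using t[of i] g[of i] by simp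
  have "0 \<le> shrinkage_fun V \<alpha> \<theta>" for \<theta> unfolding shrinkage_fun_def by (intro sum_nonneg) auto
  then have "marginal t (modified_jeffreys_prior (shrinkage_fun V \<alpha>) (\<lambda>l. \<chi> i. sqrt (l $ i / \<gamma> $ i))) x
    = jeffreys_marginal t x * enn2real (\<integral>\<^sup>+\<theta>. ennreal (shrinkage_fun V \<alpha> (\<chi> i. \<bar>\<theta> $ i\<bar>) * post_density (\<chi> i. t $ i * \<gamma> $ i) x \<theta>) \<partial>lborel)"
    by (intro marginal_modified_jeffreys t g borel_measurable_shrinkage_fun)
  then show ?thesis
    using post_mean_pos[OF tg, of x] by (simp add: shrinkage_fun_abs nn_integral_shrinkage_fun[OF tg] less_imp_le)
qed

end

section \<open>The risk under the Jeffreys prior\<close>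

definition jeffreys_log_ratio :: "real ^ 'd \<Rightarrow> real ^ 'd \<Rightarrow> nat ^ 'd \<Rightarrow> real" where
  "jeffreys_log_ratio t l x = (\<Sum>i\<in>UNIV. real (x $ i) * ln (t $ i * l $ i) - t $ i * l $ i + 1 / 2 * ln (t $ i)
     - ln (Gamma (real (x $ i) + 1 / 2)))"

lemma ln_poisson_prob_jeffreys_marginal:
  assumes t: "\<And>i. 0 < t $ i" and l: "\<And>i. 0 < l $ i"
  shows "ln (poisson_prob t l x / jeffreys_marginal t x) = jeffreys_log_ratio t l x"
proof -
  let ?f = "\<lambda>i. (t $ i * l $ i) ^ (x $ i) * exp (- (t $ i * l $ i)) * sqrt (t $ i) / Gamma (real (x $ i) + 1 / 2)"
  have G: "0 < Gamma (real (x $ i) + 1 / 2)" for i by (rule Gamma_real_pos) simp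
  have tl: "0 < t $ i * l $ i" for i using t[of i] l[of i] by simp
  have "poisson_prob t l x / jeffreys_marginal t x = (\<Prod>i\<in>UNIV. ?f i)"
    unfolding poisson_prob_def jeffreys_marginal_def prod_dividef[symmetric] by (intro prod.cong) simp_all
  moreover have "?f i \<noteq> 0" for i
    using l[of i] t[of i] G[of i] by (intro less_imp_neq[symmetric] divide_pos_pos mult_pos_pos zero_less_power) simp_all
  ultimately have "ln (poisson_prob t l x / jeffreys_marginal t x) = (\<Sum>i\<in>UNIV. ln (?f i))"
    by (simp only: ln_prod finite_class.finite_UNIV not_False_eq_True)
  also have "\<dots> = jeffreys_log_ratio t l x"
    unfolding jeffreys_log_ratio_def
  proof (rule sum.cong[OF refl], goal_cases)
    case (1 i)
    have "ln (?f i) = ln ((t $ i * l $ i) ^ (x $ i)) + ln (exp (- (t $ i * l $ i))) + ln (sqrt (t $ i)) - ln (Gamma (real (x $ i) + 1 / 2))"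
      using tl[of i] t[of i] G[of i]
      by (simp only: ln_divide_pos ln_mult_pos mult_pos_pos zero_less_power exp_gt_zero real_sqrt_gt_zero)
    then show ?case
      using tl[of i] t[of i] by (simp add: ln_realpow ln_sqrt)
  qed
  finally show ?thesis .
qed

lemma pois_real: "pois m real = m"
  using pois_Suc[of "\<lambda>_. 1" m] by simp

lemma jeffreys_log_ratio_expectation:
  fixes t l :: "real ^ 'd"
  assumes t: "\<And>i. 0 < t $ i" and l: "\<And>i. 0 < l $ i"
  shows "integrable (poisson_vec t l) (jeffreys_log_ratio t l)"
    and "vec_expect t l (jeffreys_log_ratio t l)
      = (\<Sum>i\<in>UNIV. jeffreys_potential (t $ i * l $ i) + 1 / 2 * ln (t $ i))"
proof -
  let ?g = "\<lambda>i n. (real n * ln (t $ i * l $ i) + (1 / 2 * ln (t $ i) - t $ i * l $ i)) - ln (Gamma (real n + 1 / 2))"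
  have b: "exp_bounded (?g i)" for i
    by (intro exp_bounded_add exp_bounded_diff exp_bounded_mult exp_bounded_real exp_bounded_const exp_bounded_ln_Gamma_half)
  have J: "jeffreys_log_ratio t l = (\<lambda>x. \<Sum>i\<in>UNIV. ?g i (x $ i))"
    by (simp add: jeffreys_log_ratio_def fun_eq_iff algebra_simps)
  have int: "integrable (poisson_vec t l) (\<lambda>x. ?g i (x $ i))" for i
    by (rule integrable_poisson_vec_component(1)[OF t l b])
  show "integrable (poisson_vec t l) (jeffreys_log_ratio t l)"
    unfolding J by (intro Bochner_Integration.integrable_sum int)
  have "vec_expect t l (jeffreys_log_ratio t l) = (\<Sum>i\<in>UNIV. vec_expect t l (\<lambda>x. ?g i (x $ i)))"
    unfolding J by (rule Bochner_Integration.integral_sum) (rule int)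
  also have "\<dots> = (\<Sum>i\<in>UNIV. jeffreys_potential (t $ i * l $ i) + 1 / 2 * ln (t $ i))"
  proof (rule sum.cong[OF refl], goal_cases)
    case (1 i)
    let ?m = "t $ i * l $ i"
    have b1: "exp_bounded (\<lambda>n. real n * ln ?m)"
      by (intro exp_bounded_mult exp_bounded_real exp_bounded_const)
    have "pois ?m (?g i) = (pois ?m (\<lambda>n. real n * ln ?m) + (1 / 2 * ln (t $ i) - ?m)) - pois ?m (\<lambda>n. ln (Gamma (real n + 1 / 2)))"
      by (subst pois_diff, intro exp_bounded_add b1 exp_bounded_const, rule exp_bounded_ln_Gamma_half,
          subst pois_add, rule b1, rule exp_bounded_const, simp)
    also have "pois ?m (\<lambda>n. real n * ln ?m) = ln ?m * ?m"
      using pois_cmult[OF exp_bounded_real, of ?m "ln ?m"] by (simp add: pois_real mult.commute)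
    finally have "pois ?m (?g i) = jeffreys_potential ?m + 1 / 2 * ln (t $ i)"
      by (simp add: jeffreys_potential_def algebra_simps)
    then show ?case
      unfolding integrable_poisson_vec_component(2)[OF t l b] .
  qed
  finally show "vec_expect t l (jeffreys_log_ratio t l)
      = (\<Sum>i\<in>UNIV. jeffreys_potential (t $ i * l $ i) + 1 / 2 * ln (t $ i))" .
qed

context poisson_pair
begin

lemma KL_risk_jeffreys:
  "KL_risk r s (predictive r s jeffreys_prior) l = ereal
    (vec_expect (r + s) l (jeffreys_log_ratio (r + s) l)
      - vec_expect r l (jeffreys_log_ratio r l))"
proof -
  let ?A = "\<lambda>z. ln (poisson_prob (r + s) l z / marginal (r + s) jeffreys_prior z)"
  let ?B = "\<lambda>x. ln (poisson_prob r l x / marginal r jeffreys_prior x)"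
  note J = ln_poisson_prob_jeffreys_marginal[OF r l] ln_poisson_prob_jeffreys_marginal[OF rs l]
  note m = marginal_jeffreys[OF r] marginal_jeffreys[OF rs]
  have "KL_risk r s (predictive r s jeffreys_prior) l = ereal
    (vec_expect (r + s) l (\<lambda>z. ?A z)
      - vec_expect r l (\<lambda>x. ?B x))"
  proof (rule KL_risk_predictive)
    show "integrable (poisson_vec (r + s) l) (\<lambda>z. ?A z)"
      unfolding m J by (rule jeffreys_log_ratio_expectation(1)[OF rs l])
    show "integrable (poisson_vec r l) (\<lambda>x. ?B x)"
      unfolding m J by (rule jeffreys_log_ratio_expectation(1)[OF r l])
  qed (simp_all only: m jeffreys_marginal_pos[OF r] jeffreys_marginal_pos[OF rs])
  then show ?thesis unfolding m J .
qed

lemma KL_risk_jeffreys_less: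
  "KL_risk r s (predictive r s jeffreys_prior) l < ereal (1.04 * minimax_lower_bound r s)"
proof -
  let ?D = "\<lambda>i. jeffreys_potential ((r + s) $ i * l $ i) - jeffreys_potential (r $ i * l $ i)"
  let ?L = "\<lambda>i. ln ((r $ i + s $ i) / r $ i)"
  have "(\<Sum>i\<in>UNIV. jeffreys_potential ((r + s) $ i * l $ i) + 1 / 2 * ln ((r + s) $ i)) - (\<Sum>i\<in>UNIV. jeffreys_potential (r $ i * l $ i) + 1 / 2 * ln (r $ i))
    = (\<Sum>i\<in>UNIV. (?D i) + 1 / 2 * (?L i))"
    unfolding sum_subtractf[symmetric]
  proof (rule sum.cong[OF refl], goal_cases)
    case (1 i)
    have "(?L i) = ln ((r + s) $ i) - ln (r $ i)"
      using rs[of i] r[of i] by (simp add: ln_divide_pos)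
    then show ?case
      by simp
  qed
  also have "\<dots> < (\<Sum>i\<in>UNIV. 1.04 * (0.5 * (?L i)))"
  proof (rule sum_strict_mono)
    fix i
    have "(?D i) < 1 / 50 * ln (((r + s) $ i * l $ i) / (r $ i * l $ i))"
      using r[of i] s[of i] l[of i] by (intro jeffreys_potential_diff_less) simp_all
    also have "((r + s) $ i * l $ i) / (r $ i * l $ i) = (r $ i + s $ i) / r $ i"
      using l[of i] by simp
    \<comment> \<open>Here 1.04 * 0.5 = 1 / 2 + 1 / 50: the half comes from the normalisation of the
      marginals, the rest from \<open>jeffreys_potential_diff_less\<close>.\<close>
    finally show "(?D i) + 1 / 2 * (?L i)
      < 1.04 * (0.5 * (?L i))" by simp
  qed auto
  also have "\<dots> = 1.04 * minimax_lower_bound r s"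
    by (simp add: minimax_lower_bound_def sum_distrib_left)
  finally show ?thesis
    unfolding KL_risk_jeffreys jeffreys_log_ratio_expectation(2)[OF r l] jeffreys_log_ratio_expectation(2)[OF rs l]
    by simp
qed

end

section \<open>Strict domination of the Jeffreys predictive distribution\<close>

context shrinkage_setup
begin

lemma integrable_ln_post_mean:
  assumes \<tau>: "\<And>i. 0 < \<tau> $ i" and t: "\<And>i. 0 < t $ i" and l: "\<And>i. 0 < l $ i"
  shows "integrable (poisson_vec t l) (\<lambda>x. ln (post_mean V \<alpha> \<tau> x))"
proof -
  obtain C where C: "\<And>x. \<bar>ln (post_mean V \<alpha> \<tau> x)\<bar> \<le> C * (1 + (\<Sum>i\<in>UNIV. real (x $ i)))"
    using abs_ln_post_mean_le[OF \<tau>] by blast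
  show ?thesis
  proof (rule Bochner_Integration.integrable_bound)
    show "integrable (poisson_vec t l) (\<lambda>x. C * (1 + (\<Sum>i\<in>UNIV. real (x $ i))))"
      by (intro integrable_mult_right Bochner_Integration.integrable_add Bochner_Integration.integrable_sum
          measure_pmf.integrable_const integrable_poisson_vec_component(1)[OF t l exp_bounded_real])
    show "AE x in poisson_vec t l. norm (ln (post_mean V \<alpha> \<tau> x)) \<le> norm (C * (1 + (\<Sum>i\<in>UNIV. real (x $ i))))"
      using C by (intro AE_I2) (simp add: order_trans[OF _ abs_ge_self])
  qed simp
qed

end

locale shrinkage_risk = shrinkage_setup V k \<alpha> + poisson_pair r s l
  for V :: "(real ^ 'd) set" and k \<alpha> and r s l :: "real ^ 'd"
begin

lemma expectation_ln_post_mean_less: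
  fixes \<gamma> :: "real ^ 'd"
  assumes g: "\<And>i. \<gamma> $ i = gamma_coeff r s i"
  shows "vec_expect r l (\<lambda>x. ln (post_mean V \<alpha> (\<chi> i. r $ i * \<gamma> $ i) x))
    < vec_expect (r + s) l (\<lambda>z. ln (post_mean V \<alpha> (\<chi> i. (r + s) $ i * \<gamma> $ i) z))"
proof -
  let ?\<tau> = "\<chi> i. r $ i * \<gamma> $ i" and ?\<tau>' = "\<chi> i. (r + s) $ i * \<gamma> $ i"
  let ?h = "post_mean V \<alpha> ?\<tau>" and ?h' = "post_mean V \<alpha> ?\<tau>'"
  let ?X = "poisson_vec r l" and ?Z = "poisson_vec (r + s) l"
  let ?P = "pair_pmf ?X (poisson_vec s l)"
  let ?R = "\<lambda>w. ?h (fst w) / ?h' (fst w + snd w)"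
  have \<gamma>: "\<gamma> $ i = s $ i / (r $ i * (r $ i + s $ i))" for i
    using r[of i] rs[of i] by (simp add: g gamma_coeff_def field_simps)
  have \<tau>: "?\<tau> $ i = s $ i / (r $ i + s $ i)" "?\<tau>' $ i = s $ i / r $ i" for i
    using r[of i] rs[of i] by (simp_all add: \<gamma>)
  have \<tau>0: "0 < ?\<tau> $ i" "0 < ?\<tau>' $ i" for i unfolding \<tau> using r[of i] s[of i] by simp_all
  \<comment> \<open>The first identity is 1 / \<tau> = 1 / \<tau>' + 1, which the choice of \<gamma>
    achieves in every coordinate. The second says that the smoothing weights are the true
    conditional probabilities of x given x + y.\<close>
  have \<tau>\<tau>': "?\<tau> $ i = ?\<tau>' $ i / (1 + ?\<tau>' $ i)" "thinning $ i = 1 / (1 + ?\<tau>' $ i)" for i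
    unfolding \<tau> using r[of i] s[of i] by (simp_all add: field_simps)
  have h: "0 < ?h x" "0 < ?h' x" for x by (rule post_mean_pos[OF \<tau>0(1)], rule post_mean_pos[OF \<tau>0(2)])
  \<comment> \<open>The conditional expectation of h x / h' (x + y) given x + y = z.\<close>
  define \<rho> where "\<rho> z = (\<Sum>x\<in>{..z}. binom_weight thinning z x * ?h x) / ?h' z" for z
  have \<rho>: "0 \<le> \<rho> z" "\<rho> z < 1" for z
    unfolding \<rho>_def divide_less_eq_1_pos[OF h(2)]
    by (intro divide_nonneg_pos sum_nonneg mult_nonneg_nonneg binom_weight_thinning_nonneg h(2) less_imp_le[OF h(1)],
        rule sum_binom_weight_post_mean_less[OF \<tau>0(2) \<tau>\<tau>'])
  have "(\<integral>\<^sup>+w. ennreal (?R w) \<partial>?P)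
    = (\<integral>\<^sup>+z. (\<Sum>x\<in>{..z}. ennreal (binom_weight thinning z x) * ennreal (?h x / ?h' (x + (z - x)))) \<partial>?Z)"
    by (rule nn_integral_pair_poisson_vec)
  also have "\<dots> = (\<integral>\<^sup>+z. ennreal (\<rho> z) \<partial>?Z)"
  proof (rule nn_integral_cong, goal_cases)
    case (1 z)
    have "x + (z - x) = z" if "x \<le> z" for x using that by (auto simp: less_eq_vec_def vec_eq_iff)
    then have "(\<Sum>x\<in>{..z}. ennreal (binom_weight thinning z x) * ennreal (?h x / ?h' (x + (z - x)))) = (\<Sum>x\<in>{..z}. ennreal (binom_weight thinning z x * (?h x / ?h' z)))"
      by (intro sum.cong refl) (simp add: ennreal_mult'[OF binom_weight_thinning_nonneg, symmetric])
    also have "\<dots> = ennreal (\<rho> z)"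
      using binom_weight_thinning_nonneg h by (subst sum_ennreal) (simp_all add: \<rho>_def sum_divide_distrib less_imp_le)
    finally show ?case .
  qed
  also have "\<dots> < (\<integral>\<^sup>+z. 1 \<partial>?Z)"
  proof (rule nn_integral_less)
    have le: "(\<integral>\<^sup>+z. ennreal (\<rho> z) \<partial>?Z) \<le> (\<integral>\<^sup>+z. 1 \<partial>?Z)"
      using \<rho> by (intro nn_integral_mono) (simp add: less_imp_le)
    then show "(\<integral>\<^sup>+z. ennreal (\<rho> z) \<partial>?Z) \<noteq> \<infinity>" by (auto simp: top_unique)
    show "AE z in ?Z. ennreal (\<rho> z) \<le> 1" using \<rho> by (intro AE_I2) (simp add: less_imp_le)
    show "\<not> (AE z in ?Z. 1 \<le> ennreal (\<rho> z))"
    proof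
      assume "AE z in ?Z. 1 \<le> ennreal (\<rho> z)"
      moreover obtain z where "z \<in> set_pmf ?Z" using set_pmf_not_empty[of ?Z] by blast
      ultimately have "1 \<le> ennreal (\<rho> z)" by (auto simp: AE_measure_pmf_iff)
      then show False using \<rho>(2)[of z] by simp
    qed
  qed auto
  finally have R: "(\<integral>\<^sup>+w. ennreal (?R w) \<partial>?P) < 1" by simp
  have hh: "0 < (?R w)" for w using h by simp
  have intR: "integrable ?P (\<lambda>w. ?R w)"
    using R h by (intro integrableI_nonneg) (auto simp: less_imp_le intro: order_less_trans)
  have ER: "measure_pmf.expectation ?P (\<lambda>w. ?R w) < 1"
  proof -
    have "ennreal (measure_pmf.expectation ?P (\<lambda>w. ?R w)) = (\<integral>\<^sup>+w. ennreal (?R w) \<partial>?P)"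
      using hh by (intro nn_integral_eq_integral[symmetric] intR AE_I2) (simp add: less_imp_le)
    also have "\<dots> < ennreal 1" using R by simp
    finally show ?thesis by (subst (asm) ennreal_less_iff) (use h in \<open>auto simp: less_imp_le intro!: Bochner_Integration.integral_nonneg\<close>)
  qed
  note A = integrable_ln_post_mean[OF \<tau>0(2) rs l] and B = integrable_ln_post_mean[OF \<tau>0(1) r l]
  note D = expectation_pair_diff[OF A B]
  have "0 < measure_pmf.expectation ?P (\<lambda>w. 1 - (?R w))"
    unfolding Bochner_Integration.integral_diff[OF measure_pmf.integrable_const intR] using ER by simp
  also have "\<dots> \<le> measure_pmf.expectation ?P (\<lambda>(x, y). ln (?h' (x + y)) - ln (?h x))"
  proof (rule integral_mono)
    show "integrable ?P (\<lambda>w. 1 - (?R w))"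
      by (intro Bochner_Integration.integrable_diff measure_pmf.integrable_const intR)
    show "integrable ?P (\<lambda>(x, y). ln (?h' (x + y)) - ln (?h x))" by (rule D(1))
    fix w :: "(nat ^ 'd) \<times> (nat ^ 'd)"
    have "ln (?R w) \<le> (?R w) - 1"
      using hh by (rule ln_le_minus_one)
    moreover have "ln (?R w) = ln (?h (fst w)) - ln (?h' (fst w + snd w))"
      using h by (intro ln_divide_pos)
    ultimately show "1 - (?R w) \<le> (case w of (x, y) \<Rightarrow> ln (?h' (x + y)) - ln (?h x))"
      by (simp add: case_prod_beta)
  qed
  finally show ?thesis unfolding D(2) by simp
qed

lemma KL_risk_shrinkage_less:
  "KL_risk r s (predictive r s (modified_jeffreys_prior (shrinkage_fun V \<alpha>) (theta_diff r s))) l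
    < KL_risk r s (predictive r s jeffreys_prior) l"
proof -
  define \<gamma> :: "real ^ 'd" where "\<gamma> = (\<chi> i. gamma_coeff r s i)"
  let ?\<pi> = "modified_jeffreys_prior (shrinkage_fun V \<alpha>) (theta_diff r s)"
  let ?N = "real (card (sign_vecs :: (real ^ 'd) set))"
  let ?h = "post_mean V \<alpha> (\<chi> i. r $ i * \<gamma> $ i)" and ?h' = "post_mean V \<alpha> (\<chi> i. (r + s) $ i * \<gamma> $ i)"
  let ?A = "\<lambda>z. ln (poisson_prob (r + s) l z / marginal (r + s) ?\<pi> z)"
  let ?B = "\<lambda>x. ln (poisson_prob r l x / marginal r ?\<pi> x)"
  have g: "\<gamma> $ i = gamma_coeff r s i" for i by (simp add: \<gamma>_def)
  have \<gamma>: "0 < \<gamma> $ i" for i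
  proof -
    have "1 / (r $ i + s $ i) < 1 / r $ i" using r[of i] s[of i] by (intro divide_strict_left_mono) simp_all
    then show ?thesis by (simp add: g gamma_coeff_def)
  qed
  have th: "theta_diff r s = (\<lambda>l. \<chi> i. sqrt (l $ i / \<gamma> $ i))"
    by (simp add: theta_diff_def g fun_eq_iff)
  have N: "0 < ?N" using card_sign_vecs_pos by simp
  have h: "0 < ?h x" "0 < ?h' x" for x
    by (rule post_mean_pos, use r \<gamma> in simp, rule post_mean_pos, use rs \<gamma> in simp)
  have m: "marginal r ?\<pi> x = jeffreys_marginal r x * (?N * ?h x)" "marginal (r + s) ?\<pi> x = jeffreys_marginal (r + s) x * (?N * ?h' x)" for x
    unfolding th by (rule marginal_shrinkage[OF r \<gamma>], rule marginal_shrinkage[OF rs \<gamma>])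
  have ln: "ln (poisson_prob t l x / (jeffreys_marginal t x * (?N * u))) = jeffreys_log_ratio t l x - (ln ?N + ln u)"
    if t: "\<And>i. 0 < t $ i" and u: "0 < u" for t :: "real ^ 'd" and x u
  proof -
    have "ln (poisson_prob t l x / (jeffreys_marginal t x * (?N * u))) = ln (poisson_prob t l x / jeffreys_marginal t x / (?N * u))"
      by simp
    also have "\<dots> = ln (poisson_prob t l x / jeffreys_marginal t x) - (ln ?N + ln u)"
      using poisson_prob_pos[OF t l] jeffreys_marginal_pos[OF t] N u
      by (simp only: ln_divide_pos ln_mult_pos divide_pos_pos mult_pos_pos)
    finally show ?thesis by (simp only: ln_poisson_prob_jeffreys_marginal[OF t l])
  qed
  note A = jeffreys_log_ratio_expectation(1)[OF rs l] and B = jeffreys_log_ratio_expectation(1)[OF r l]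
  have ih: "integrable (poisson_vec (r + s) l) (\<lambda>z. ln (?h' z))" "integrable (poisson_vec r l) (\<lambda>x. ln (?h x))"
    by (rule integrable_ln_post_mean; use r rs l \<gamma> in simp)+
  note A' = Bochner_Integration.integrable_add[OF measure_pmf.integrable_const ih(1), of "ln ?N"]
    and B' = Bochner_Integration.integrable_add[OF measure_pmf.integrable_const ih(2), of "ln ?N"]
  have "KL_risk r s (predictive r s ?\<pi>) l = ereal
    (vec_expect (r + s) l (\<lambda>z. ?A z)
      - vec_expect r l (\<lambda>x. ?B x))"
  proof (rule KL_risk_predictive)
    show "integrable (poisson_vec (r + s) l) (\<lambda>z. ?A z)"
      unfolding m ln[OF rs h(2)] by (rule Bochner_Integration.integrable_diff[OF A A'])
    show "integrable (poisson_vec r l) (\<lambda>x. ?B x)"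
      unfolding m ln[OF r h(1)] by (rule Bochner_Integration.integrable_diff[OF B B'])
    show "0 < marginal r ?\<pi> x" "0 < marginal (r + s) ?\<pi> x" for x
      unfolding m using jeffreys_marginal_pos[OF r, of x] jeffreys_marginal_pos[OF rs, of x] N h by simp_all
  qed
  also have "\<dots> = ereal
    ((vec_expect (r + s) l (jeffreys_log_ratio (r + s) l) - (ln ?N + vec_expect (r + s) l (\<lambda>z. ln (?h' z))))
      - (vec_expect r l (jeffreys_log_ratio r l) - (ln ?N + vec_expect r l (\<lambda>x. ln (?h x)))))"
    unfolding m ln[OF rs h(2)] ln[OF r h(1)] Bochner_Integration.integral_diff[OF A A'] Bochner_Integration.integral_diff[OF B B']
      Bochner_Integration.integral_add[OF measure_pmf.integrable_const ih(1)] Bochner_Integration.integral_add[OF measure_pmf.integrable_const ih(2)]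
    by simp
  \<comment> \<open>The constant \<open>ln ?N\<close> occurs once for each duration and cancels;
    what remains is the Jeffreys risk minus the gain from
    \<open>expectation_ln_post_mean_less\<close>.\<close>
  also have "\<dots> < ereal (vec_expect (r + s) l (jeffreys_log_ratio (r + s) l)
      - vec_expect r l (jeffreys_log_ratio r l))"
    using expectation_ln_post_mean_less[OF g] by simp
  finally show ?thesis unfolding KL_risk_jeffreys .
qed

end

context shrinkage_setup
begin

lemma dominates_nearly_minimax_diff:
  fixes r s :: "real ^ 'd"
  assumes r: "\<And>i. 0 < r $ i" and s: "\<And>i. 0 < s $ i"
  defines "q \<equiv> predictive r s (modified_jeffreys_prior (shrinkage_fun V \<alpha>) (theta_diff r s))"
  shows "dominates r s q (predictive r s jeffreys_prior)" and "nearly_minimax r s q"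
proof -
  have less: "KL_risk r s q l < KL_risk r s (predictive r s jeffreys_prior) l" if "l \<in> positive_orthant" for l
  proof -
    interpret shrinkage_risk V k \<alpha> r s l
      using r s that by unfold_locales (simp_all add: positive_orthant_def)
    show ?thesis unfolding q_def by (rule KL_risk_shrinkage_less)
  qed
  have "(\<chi> i. 1) \<in> (positive_orthant :: (real ^ 'd) set)" by (simp add: positive_orthant_def)
  with less show "dominates r s q (predictive r s jeffreys_prior)"
    unfolding dominates_def by (auto intro: less_imp_le)
  show "nearly_minimax r s q"
    unfolding nearly_minimax_def
  proof
    fix l :: "real ^ 'd" assume l: "l \<in> positive_orthant"
    have "KL_risk r s (predictive r s jeffreys_prior) l < ereal (1.04 * minimax_lower_bound r s)"
      using r s l by (intro poisson_pair.KL_risk_jeffreys_less poisson_pair.intro) (simp_all add: positive_orthant_def)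
    with less[OF l] show "KL_risk r s q l < ereal (1.04 * minimax_lower_bound r s)" by (rule less_trans)
  qed
qed

end

section \<open>Equal durations as a special case\<close>

lemma predictive_cmult_prior:
  assumes "c \<noteq> 0"
  shows "predictive r s (\<lambda>l. c * \<pi> l) = predictive r s \<pi>"
proof (intro ext)
  fix x y
  have "(LINT l:positive_orthant|lborel. poisson_prob r l x * poisson_prob s l y * (c * \<pi> l))
    = c * (LINT l:positive_orthant|lborel. poisson_prob r l x * poisson_prob s l y * \<pi> l)"
    by (subst set_integral_mult_right[symmetric]) (simp add: mult_ac)
  moreover have "(LINT l:positive_orthant|lborel. poisson_prob r l x * (c * \<pi> l)) = c * (LINT l:positive_orthant|lborel. poisson_prob r l x * \<pi> l)"
    by (subst set_integral_mult_right[symmetric]) (simp add: mult_ac)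
  ultimately show "predictive r s (\<lambda>l. c * \<pi> l) x y = predictive r s \<pi> x y"
    using assms by (simp add: predictive_def)
qed

lemma shrinkage_fun_scaleR:
  fixes V :: "(real ^ 'd) set"
  assumes V: "subspace V"
  shows "shrinkage_fun V \<alpha> (c *\<^sub>R \<theta>) = (c^2) powr (- \<alpha>) * shrinkage_fun V \<alpha> \<theta>"
proof -
  have "(\<chi> i. a $ i * (c *\<^sub>R \<theta>) $ i) = c *\<^sub>R (\<chi> i. a $ i * \<theta> $ i)" for a
    by (simp add: vec_eq_iff)
  then show ?thesis
    by (simp add: shrinkage_fun_def sq_dist_scaleR[OF V] powr_mult sum_distrib_left)
qed

text \<open>For equal durations \<gamma> is the same in all coordinates, so the two parametrisations
  differ by the constant factor \<open>sqrt g\<close>. The shrinkage function is homogeneous of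
  degree - 2 \<alpha>, hence the two priors are proportional and the constant cancels in the ratio
  of integrals.\<close>

lemma predictive_same_eq_diff:
  fixes V :: "(real ^ 'd) set" and r0 s0 :: real
  assumes V: "subspace V" and r0: "0 < r0" and s0: "0 < s0"
  defines "r \<equiv> (\<chi> i. r0) :: real ^ 'd" and "s \<equiv> (\<chi> i. s0) :: real ^ 'd"
  shows "predictive r s (modified_jeffreys_prior (shrinkage_fun V \<alpha>) theta_same)
    = predictive r s (modified_jeffreys_prior (shrinkage_fun V \<alpha>) (theta_diff r s))"
proof -
  define g where "g = 1 / r0 - 1 / (r0 + s0)"
  have g: "0 < g"
  proof -
    have "1 / (r0 + s0) < 1 / r0" using r0 s0 by (intro divide_strict_left_mono) simp_all
    then show ?thesis by (simp add: g_def)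
  qed
  have "theta_same l = sqrt g *\<^sub>R theta_diff r s l" for l
    using g by (simp add: theta_same_def theta_diff_def gamma_coeff_def r_def s_def g_def[symmetric] vec_eq_iff real_sqrt_mult[symmetric])
  then have "modified_jeffreys_prior (shrinkage_fun V \<alpha>) theta_same
    = (\<lambda>l. ((sqrt g)^2) powr (- \<alpha>) * modified_jeffreys_prior (shrinkage_fun V \<alpha>) (theta_diff r s) l)"
    by (simp only: modified_jeffreys_prior_def shrinkage_fun_scaleR[OF V] fun_eq_iff mult.assoc) simp
  moreover have "((sqrt g)^2) powr (- \<alpha>) \<noteq> 0" using g by simp
  ultimately show ?thesis by (simp only: predictive_cmult_prior not_False_eq_True)
qed

theorem proposition2:
  fixes V :: "(real ^ 'd) set" and k :: nat and \<alpha> :: real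
  assumes "subspace V" and "dim V = k"
    and "0 < \<alpha>" and "\<alpha> \<le> (real CARD('d) - real k - 2) / 2"
  shows
    "(\<forall>(r0 :: real) (s0 :: real). 0 < r0 \<longrightarrow> 0 < s0 \<longrightarrow>
        (let r = (\<chi> i. r0) :: real ^ 'd; s = (\<chi> i. s0) :: real ^ 'd;
             q = predictive r s (modified_jeffreys_prior (shrinkage_fun V \<alpha>) theta_same)
         in dominates r s q (predictive r s jeffreys_prior) \<and> nearly_minimax r s q)) \<and>
     (\<forall>(r :: real ^ 'd) (s :: real ^ 'd). (\<forall>i. 0 < r $ i) \<longrightarrow> (\<forall>i. 0 < s $ i) \<longrightarrow>
        (let q = predictive r s (modified_jeffreys_prior (shrinkage_fun V \<alpha>) (theta_diff r s))
         in dominates r s q (predictive r s jeffreys_prior) \<and> nearly_minimax r s q))"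
proof -
  interpret shrinkage_setup V k \<alpha> using assms by unfold_locales
  show ?thesis
    unfolding Let_def
  proof (intro conjI allI impI)
    fix r0 s0 :: real assume pos: "0 < r0" "0 < s0"
    show "dominates (\<chi> i. r0) (\<chi> i. s0) (predictive (\<chi> i. r0) (\<chi> i. s0) (modified_jeffreys_prior (shrinkage_fun V \<alpha>) theta_same))
        (predictive (\<chi> i. r0) (\<chi> i. s0) jeffreys_prior)"
      "nearly_minimax (\<chi> i. r0) (\<chi> i. s0) (predictive (\<chi> i. r0) (\<chi> i. s0) (modified_jeffreys_prior (shrinkage_fun V \<alpha>) theta_same))"
      unfolding predictive_same_eq_diff[OF assms(1) pos]
      by (rule dominates_nearly_minimax_diff; use pos in simp)+
  qed (simp_all add: dominates_nearly_minimax_diff)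
qed

end
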